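(* Let $p$ be a zero-mean probability density on $\mathbb{R}^d$, with covariance matrix $\mathbf{\Sigma}$, satisfying the orthogonal independent components property. Let $\hat p$ be the proposed estimator computed from samples $X^{(1)},\dots,X^{(N)},Y^{(1)},\dots,Y^{(M)}\overset{\mathrm{iid}}{\sim}p$. Then for any $\epsilon>0$ and $0<\gamma<1$, $$h_d^2(\hat p,p)\le\epsilon$$ with probability at least $1-\gamma$ whenever $$N\ \ge\ \sup_{s\in\mathbb{S}^{d-1}}N^*\left(\epsilon/4d,\ \gamma/2d;\ p_s\right)$$ and $$M\ \ge\ \begin{cases}M^*\left(\frac14\,d^{-\frac{2+\alpha}{1+\alpha}}\,[\nabla\varphi]_\alpha^{-\frac1{1+\alpha}}\,\|\mathbf{\Sigma}\|_{\mathrm{op}}^{-1/2}\,\epsilon^{\frac1{1+\alpha}},\ \gamma/2;\ p\right)&\text{if S1 holds},\\[4pt] M^*\left(4^{-4}\left[\|\nabla p\|_{L^1}d^{7/4}+d^{9/4}\right]^{-2}\|\mathbf{\Sigma}\|_{\mathrm{op}}^{-1/2}\,\epsilon^2,\ \gamma/2;\ p\right)&\text{if S2 holds}.\end{cases}$$ Here $N^*$ and $M^*$ are respectively the sample complexities of the univariate density estimator and of the unmixing matrix estimator invoked by $\hat p$, and S1, S2 are the smoothness assumptions given in the context.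
   Context: Smoothness assumption S1: $p$ has finite second moments, is continuously differentiable, and $\int_{\mathbb{R}^d}\|x\|_2\|\nabla p(x)\|_2\,dx<\infty$; the function $\varphi=-\log p$ is finite-valued everywhere and belongs to $\mathcal{C}^{1,\alpha}(\mathbb{R}^d)$ for some $0<\alpha\le1$, i.e. $[\nabla\varphi]_\alpha:=\sup_{x\ne y}\|\nabla\varphi(y)-\nabla\varphi(x)\|_2/\|y-x\|_2^\alpha<\infty$. Smoothness assumption S2: $p$ has finite second moments and has a weak gradient $\nabla p$ with $\|\nabla p\|_{L^1}=\int_{\mathbb{R}^d}\|\nabla p(x)\|_2\,dx<\infty$. A zero-mean density $p$ satisfies the orthogonal independent components property if there is an orthogonal $\mathbf{W}\in\mathbb{R}^{d\times d}$ (an unmixing matrix) such that for $X\sim p$ the components of $\mathbf{W}X$ are independent; the rows $w_1,\dots,w_d$ of such a $\mathbf{W}$ are called independent directions of $p$ (they are not unique: e.g. they may be permuted and their signs flipped). For $s\in\mathbb{S}^{d-1}$, $p_s$ is the density on $\mathbb{R}$ of $s\cdot X$, $X\sim p$. The squared Hellinger distance is $h_d^2(p,q)=\frac12\int_{\mathbb{R}^d}(\sqrt{q}-\sqrt{p})^2\,dx$. $\|\cdot\|_{\mathrm{op}}$ is the operator norm. Proposed estimator: fix an unmixing matrix estimator (a procedure producing from samples an orthogonal matrix $\hat{\mathbf{W}}$) and a univariate density estimator (a procedure producing from real samples a probability density on $\mathbb{R}$). Compute $\hat{\mathbf{W}}$, with rows $\hat w_1,\dots,\hat w_d$, from $Y^{(1)},\dots,Y^{(M)}$.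 For each $i$, apply the univariate density estimator to the projected samples $\hat w_i\cdot X^{(1)},\dots,\hat w_i\cdot X^{(N)}$ to get $\hat p_{\hat w_i}$. Set $\hat p(x)=\prod_{i=1}^d\hat p_{\hat w_i}(\hat w_i\cdot x)$. Sample complexity of the univariate density estimator: for a univariate density $f$, $\epsilon>0$, $0<\gamma<1$, $N^*(\epsilon,\gamma;f)$ is the minimal positive integer such that any number $N\ge N^*$ of iid samples from $f$ suffices for the resulting estimate $\hat f$ to satisfy $\mathbb{P}(h_1^2(\hat f,f)\le\epsilon)\ge1-\gamma$. Sample complexity of the unmixing matrix estimator: for $\epsilon>0$, $0<\gamma<1$, $M^*(\epsilon,\gamma;p)$ is the minimal positive integer such that any number $M\ge M^*$ of iid samples from $p$ suffices for the rows $\hat w_i$ of the resulting $\hat{\mathbf{W}}$ to satisfy, with probability at least $1-\gamma$, $\left(d^{-1}\sum_{i=1}^d\|\hat w_i-w_i\|_2^2\right)^{1/2}\le\epsilon$ for some independent directions $w_1,\dots,w_d$ of $p$ (labelled and signed so as to match $\hat w_1,\dots,\hat w_d$). Sample complexities are $+\infty$ if no such integer exists. *)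

theory Defs
  imports "HOL-Probability.Probability"
begin

section \<open>Densities, moments and projections\<close>

definition is_density :: "('a::euclidean_space \<Rightarrow> real) \<Rightarrow> bool" where
  "is_density p \<longleftrightarrow> p \<in> borel_measurable borel \<and> (\<forall>x. 0 \<le> p x)
     \<and> integrable lborel p \<and> (LINT x|lborel. p x) = 1"

definition law :: "('a::euclidean_space \<Rightarrow> real) \<Rightarrow> 'a measure" where
  "law p = density lborel (\<lambda>x. ennreal (p x))"

definition mean :: "('a::euclidean_space \<Rightarrow> real) \<Rightarrow> 'a" where
  "mean p = (LINT x|lborel. p x *\<^sub>R x)"

definition zero_mean :: "('a::euclidean_space \<Rightarrow> real) \<Rightarrow> bool" where
  "zero_mean p \<longleftrightarrow> integrable lborel (\<lambda>x. p x *\<^sub>R x) \<and> mean p = 0"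

definition finite_second_moments :: "('a::euclidean_space \<Rightarrow> real) \<Rightarrow> bool" where
  "finite_second_moments p \<longleftrightarrow> integrable lborel (\<lambda>x. (norm x)\<^sup>2 * p x)"

definition covariance_matrix :: "(real ^ 'n \<Rightarrow> real) \<Rightarrow> real ^ 'n ^ 'n" where
  "covariance_matrix p =
     (\<chi> i j. LINT x|lborel. (x $ i - mean p $ i) * (x $ j - mean p $ j) * p x)"

definition op_norm :: "real ^ 'n ^ 'n \<Rightarrow> real" where
  "op_norm A = onorm (\<lambda>v. A *v v)"

text \<open>The density of \<open>s \<bullet> X\<close> for \<open>X\<close> with density \<open>p\<close>. It is determined only almost
  everywhere; the Radon-Nikodym derivative picks one version. It is meaningful for
  \<open>s \<noteq> 0\<close>, where the law of \<open>s \<bullet> X\<close> is absolutely continuous.\<close>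

definition proj_density :: "(real ^ 'n \<Rightarrow> real) \<Rightarrow> real ^ 'n \<Rightarrow> real \<Rightarrow> real" where
  "proj_density p s =
     (\<lambda>t. enn2real (RN_deriv lborel (distr (law p) borel (\<lambda>x. s \<bullet> x)) t))"

text \<open>For densities \<open>p\<close> and \<open>q\<close> the integrand is integrable, being bounded by \<open>p + q\<close>.\<close>

definition hellinger_sq :: "('a::euclidean_space \<Rightarrow> real) \<Rightarrow> ('a \<Rightarrow> real) \<Rightarrow> real" where
  "hellinger_sq p q = 1/2 * (LINT x|lborel. (sqrt (q x) - sqrt (p x))\<^sup>2)"


section \<open>Orthogonal independent components\<close>

text \<open>The rows of such a matrix are independent directions of \<open>p\<close>; all labellings and
  signs are covered, since permuting rows or flipping their signs preserves the predicate.\<close>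

definition unmixing_matrix :: "(real ^ 'n \<Rightarrow> real) \<Rightarrow> real ^ 'n ^ 'n \<Rightarrow> bool" where
  "unmixing_matrix p W \<longleftrightarrow> orthogonal_matrix W \<and>
     prob_space.indep_vars (law p) (\<lambda>_. borel) (\<lambda>i x. (W *v x) $ i) UNIV"

definition orthogonal_independent_components :: "(real ^ 'n \<Rightarrow> real) \<Rightarrow> bool" where
  "orthogonal_independent_components p \<longleftrightarrow> (\<exists>W. unmixing_matrix p W)"


section \<open>Smoothness assumptions\<close>

definition grad :: "(real ^ 'n \<Rightarrow> real) \<Rightarrow> real ^ 'n \<Rightarrow> real ^ 'n" where
  "grad f x = (THE D. GDERIV f x :> D)"

primrec Ck :: "nat \<Rightarrow> (real ^ 'n \<Rightarrow> real) \<Rightarrow> bool" where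
  "Ck 0 f \<longleftrightarrow> continuous_on UNIV f"
| "Ck (Suc k) f \<longleftrightarrow> (\<forall>x. \<exists>D. GDERIV f x :> D) \<and> (\<forall>i. Ck k (\<lambda>x. grad f x $ i))"

definition test_function :: "(real ^ 'n \<Rightarrow> real) \<Rightarrow> bool" where
  "test_function \<psi> \<longleftrightarrow> (\<forall>k. Ck k \<psi>) \<and> compact (closure {x. \<psi> x \<noteq> 0})"

definition locally_integrable :: "('a::euclidean_space \<Rightarrow> 'b::euclidean_space) \<Rightarrow> bool" where
  "locally_integrable f \<longleftrightarrow> (\<forall>K. compact K \<longrightarrow> set_integrable lborel K f)"

definition weak_gradient :: "(real ^ 'n \<Rightarrow> real) \<Rightarrow> (real ^ 'n \<Rightarrow> real ^ 'n) \<Rightarrow> bool" where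
  "weak_gradient p g \<longleftrightarrow> locally_integrable p \<and> locally_integrable g \<and>
     (\<forall>\<psi>. test_function \<psi> \<longrightarrow>
        (LINT x|lborel. p x *\<^sub>R grad \<psi> x) = - (LINT x|lborel. \<psi> x *\<^sub>R g x))"

definition holder_quotients :: "real \<Rightarrow> (real ^ 'n \<Rightarrow> real ^ 'n) \<Rightarrow> real set" where
  "holder_quotients \<alpha> v = {norm (v y - v x) / norm (y - x) powr \<alpha> | x y. x \<noteq> y}"

definition holder_seminorm :: "real \<Rightarrow> (real ^ 'n \<Rightarrow> real ^ 'n) \<Rightarrow> real" where
  "holder_seminorm \<alpha> v = Sup (holder_quotients \<alpha> v)"

definition neg_log :: "(real ^ 'n \<Rightarrow> real) \<Rightarrow> real ^ 'n \<Rightarrow> real" where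
  "neg_log p x = - ln (p x)"

text \<open>Positivity of \<open>p\<close> says that \<open>- log p\<close> is finite everywhere; \<open>bdd_above\<close> says that the
  Hoelder seminorm, a real supremum, is finite.\<close>

definition smoothness_S1 :: "real \<Rightarrow> (real ^ 'n \<Rightarrow> real) \<Rightarrow> bool" where
  "smoothness_S1 \<alpha> p \<longleftrightarrow> finite_second_moments p \<and> Ck 1 p
     \<and> integrable lborel (\<lambda>x. norm x * norm (grad p x))
     \<and> (\<forall>x. 0 < p x) \<and> 0 < \<alpha> \<and> \<alpha> \<le> 1
     \<and> Ck 1 (neg_log p) \<and> bdd_above (holder_quotients \<alpha> (grad (neg_log p)))"

text \<open>The weak gradient \<open>g\<close> is a parameter; it is determined by \<open>p\<close> almost everywhere.\<close>

definition smoothness_S2 :: "(real ^ 'n \<Rightarrow> real ^ 'n) \<Rightarrow> (real ^ 'n \<Rightarrow> real) \<Rightarrow> bool" where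
  "smoothness_S2 g p \<longleftrightarrow> finite_second_moments p \<and> weak_gradient p g
     \<and> integrable lborel (\<lambda>x. norm (g x))"

definition L1_norm :: "(real ^ 'n \<Rightarrow> real ^ 'n) \<Rightarrow> real" where
  "L1_norm g = (LINT x|lborel. norm (g x))"


section \<open>Estimators and sample complexities\<close>

text \<open>An estimator is a family indexed by the sample size \<open>n\<close>; a sample of size \<open>n\<close> is an
  element of the product space over \<open>{..<n}\<close>, hence an extensional function.\<close>

abbreviation sample_space :: "nat \<Rightarrow> (nat \<Rightarrow> 'a::euclidean_space) measure" where
  "sample_space n \<equiv> PiM {..<n} (\<lambda>_. borel)"

definition iid_law :: "nat \<Rightarrow> ('a::euclidean_space \<Rightarrow> real) \<Rightarrow> (nat \<Rightarrow> 'a) measure" where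
  "iid_law n p = PiM {..<n} (\<lambda>_. law p)"

definition unmixing_estimator ::
  "(nat \<Rightarrow> (nat \<Rightarrow> real ^ 'n) \<Rightarrow> real ^ 'n ^ 'n) \<Rightarrow> bool" where
  "unmixing_estimator What \<longleftrightarrow> (\<forall>n>0. What n \<in> sample_space n \<rightarrow>\<^sub>M borel
     \<and> (\<forall>y\<in>space (sample_space n). orthogonal_matrix (What n y)))"

text \<open>Joint measurability in the sample and the evaluation point makes the Hellinger distance
  of an estimate to a fixed density a random variable.\<close>

definition density_estimator ::
  "(nat \<Rightarrow> (nat \<Rightarrow> real) \<Rightarrow> real \<Rightarrow> real) \<Rightarrow> bool" where
  "density_estimator fhat \<longleftrightarrow> (\<forall>n>0.
     (\<lambda>(z, t). fhat n z t) \<in> sample_space n \<Otimes>\<^sub>M borel \<rightarrow>\<^sub>M borel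
     \<and> (\<forall>z\<in>space (sample_space n). is_density (fhat n z)))"

definition sufficient_sample_size :: "(nat \<Rightarrow> bool) \<Rightarrow> enat" where
  "sufficient_sample_size Q = Inf (enat ` {n. 0 < n \<and> (\<forall>m\<ge>n. Q m)})"

definition N_star :: "(nat \<Rightarrow> (nat \<Rightarrow> real) \<Rightarrow> real \<Rightarrow> real)
    \<Rightarrow> real \<Rightarrow> real \<Rightarrow> (real \<Rightarrow> real) \<Rightarrow> enat" where
  "N_star fhat \<epsilon> \<gamma> f = sufficient_sample_size (\<lambda>n.
     measure (iid_law n f) {z \<in> space (iid_law n f). hellinger_sq (fhat n z) f \<le> \<epsilon>} \<ge> 1 - \<gamma>)"

definition M_star :: "(nat \<Rightarrow> (nat \<Rightarrow> real ^ 'n) \<Rightarrow> real ^ 'n ^ 'n)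
    \<Rightarrow> real \<Rightarrow> real \<Rightarrow> (real ^ 'n \<Rightarrow> real) \<Rightarrow> enat" where
  "M_star What \<epsilon> \<gamma> p = sufficient_sample_size (\<lambda>n.
     measure (iid_law n p) {y \<in> space (iid_law n p).
       \<exists>W. unmixing_matrix p W \<and>
         sqrt (1 / real CARD('n) * (\<Sum>i\<in>UNIV. (norm (row i (What n y) - row i W))\<^sup>2)) \<le> \<epsilon>}
     \<ge> 1 - \<gamma>)"

text \<open>\<open>x\<close> carries the \<open>N\<close> samples used for the projected density estimates and \<open>y\<close> the \<open>M\<close>
  samples used for the unmixing matrix.\<close>

definition proposed_estimator ::
  "(nat \<Rightarrow> (nat \<Rightarrow> real ^ 'n) \<Rightarrow> real ^ 'n ^ 'n) \<Rightarrow> (nat \<Rightarrow> (nat \<Rightarrow> real) \<Rightarrow> real \<Rightarrow> real)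
    \<Rightarrow> nat \<Rightarrow> nat \<Rightarrow> (nat \<Rightarrow> real ^ 'n) \<Rightarrow> (nat \<Rightarrow> real ^ 'n) \<Rightarrow> real ^ 'n \<Rightarrow> real" where
  "proposed_estimator What fhat N M x y =
     (let W = What M (restrict y {..<M})
      in (\<lambda>u. \<Prod>i\<in>UNIV. fhat N (\<lambda>j\<in>{..<N}. row i W \<bullet> x j) (row i W \<bullet> u)))"

end

theory Submission
  imports Defs
begin

text \<open>Let \<open>V\<close> be the estimated unmixing matrix, \<open>W\<close> a true one close to it and \<open>R = W\<^sup>T V\<close>. The
  product \<open>q\<close> of the marginals of \<open>p\<close> along the rows of \<open>V\<close> separates the two sources of error. The
  squared Hellinger distance of the estimator to \<open>q\<close> is at most the sum of the univariate ones. For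
  the distance of \<open>q\<close> to \<open>p\<close>, compare with the rotated density \<open>p (R x)\<close>, which is also a product
  along the rows of \<open>V\<close>. Under S1, relative entropy bounds the distance by the expectation of
  \<open>\<phi> (R X) - \<phi> X\<close>, where \<open>\<phi> = - log p\<close>; its first order part is \<open>trace R - d \<le> 0\<close> after integration
  by parts, and the remainder is controlled by the Hoelder seminorm. Under S2, marginalisation contracts
  the \<open>L\<^sup>1\<close> distance, and the \<open>L\<^sup>1\<close> distance of \<open>p\<close> to its rotation is bounded by comparing averages
  over balls of a suitable radius. Since the two samples are independent, the errors combine by
  Fubini.\<close>

section \<open>Invariance of Lebesgue measure and product integrals\<close>

text \<open>The univariate guarantee concerns the marginal of \<open>p\<close> along the direction
  actually used for projecting, so \<open>q\<close> has to be built from the marginals along the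
  estimated rows and not from those along true independent directions. The estimated rows are
  random, which explains the supremum over directions and the two separate samples: once the
  \<open>Y\<close> sample is fixed, \<open>V\<close> is deterministic and the guarantee applies to
  the projected \<open>X\<close> sample.

  The squared Hellinger distance obeys a triangle inequality only up to a factor 2, so each error is
  allotted a quarter of \<epsilon>; the estimation error is then shared among d marginals. Each
  sample may fail with probability \<gamma>/2, and the \<open>X\<close> sample shares this among the
  d rows.

  The factor with exponent -1/2 of the norm of the covariance converts row errors into
  displacements: \<open>W *v (R *v x - x)\<close> has the coordinates
  \<open>(row i V - row i W) \<bullet> x\<close>, whose second moments are at most that norm times
  the squared row errors.

  Only the existence of a nearby \<open>W\<close> for each \<open>V\<close> is used, so no selection
  of \<open>W\<close> from the sample is made. Factorisations of \<open>p\<close> are identities of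
  laws and hold almost everywhere.\<close>

lemma nn_integral_lborel_translation:
  fixes f :: "'a::euclidean_space \<Rightarrow> ennreal"
  assumes [measurable]: "f \<in> borel_measurable borel"
  shows "(\<integral>\<^sup>+x. f (x + a) \<partial>lborel) = (\<integral>\<^sup>+x. f x \<partial>lborel)"
proof -
  have "(\<integral>\<^sup>+x. f x \<partial>lborel) = (\<integral>\<^sup>+x. f x \<partial>distr lborel borel ((+) a))"
    by (simp add: lborel_distr_plus)
  also have "\<dots> = (\<integral>\<^sup>+x. f (x + a) \<partial>lborel)"
    by (subst nn_integral_distr) (auto simp: add.commute)
  finally show ?thesis by simp
qed

lemma integral_lborel_translation:
  fixes f :: "'a::euclidean_space \<Rightarrow> 'b::{banach, second_countable_topology}"
  assumes [measurable]: "f \<in> borel_measurable borel"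
  shows "(LINT x|lborel. f (x + a)) = (LINT x|lborel. f x)"
proof -
  have "(LINT x|lborel. f x) = (LINT x|distr lborel borel ((+) a). f x)"
    by (simp add: lborel_distr_plus)
  also have "\<dots> = (LINT x|lborel. f (x + a))"
    by (subst integral_distr) (auto simp: add.commute)
  finally show ?thesis by simp
qed

lemma integrable_lborel_translation:
  fixes f :: "'a::euclidean_space \<Rightarrow> 'b::{banach, second_countable_topology}"
  assumes "integrable lborel f"
  shows "integrable lborel (\<lambda>x. f (x + a))"
proof -
  have "integrable (distr lborel borel ((+) a)) f"
    using assms by (simp add: lborel_distr_plus)
  then have "integrable lborel (\<lambda>x. f (a + x))"
    by (subst (asm) integrable_distr_eq) (use assms in auto)
  then show ?thesis by (simp add: add.commute)
qed

section \<open>Orthogonal invariance of Lebesgue measure\<close>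

lemma borel_measurable_matrix_vector [measurable]:
  fixes W :: "real ^ 'n ^ 'm"
  shows "(\<lambda>x. W *v x) \<in> borel_measurable borel"
  by (intro borel_measurable_continuous_onI linear_continuous_on linear_linear[THEN iffD2])
     auto

lemma norm_orthogonal_matrix:
  fixes W :: "real ^ 'n ^ 'n"
  assumes "orthogonal_matrix W"
  shows "norm (W *v x) = norm x"
proof -
  have "(W *v x) \<bullet> (W *v x) = x \<bullet> (transpose W *v (W *v x))"
    by (metis dot_lmul_matrix inner_commute transpose_matrix_vector)
  also have "\<dots> = x \<bullet> x"
    using assms by (simp add: orthogonal_matrix_def matrix_vector_mul_assoc del: transpose_matrix_vector)
  finally show ?thesis by (simp add: norm_eq_sqrt_inner)
qed

lemma orthogonal_matrix_transpose_cancel: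
  fixes W :: "real ^ 'n ^ 'n"
  assumes "orthogonal_matrix W"
  shows "W *v (transpose W *v x) = x" "transpose W *v (W *v x) = x"
  using assms
  by (simp_all add: orthogonal_matrix_def matrix_vector_mul_assoc del: transpose_matrix_vector)

text \<open>Integrate \<open>f (W x + y)\<close> over \<open>x\<close> and over \<open>y\<close> in the unit ball. Translation invariance in \<open>x\<close>
  and in \<open>y\<close> evaluates this in two ways, because the ball is invariant under \<open>W\<close>.\<close>

lemma nn_integral_lborel_orthogonal:
  fixes W :: "real ^ 'n ^ 'n"
  assumes W: "orthogonal_matrix W" and [measurable]: "f \<in> borel_measurable borel"
  shows "(\<integral>\<^sup>+x. f (W *v x) \<partial>lborel) = (\<integral>\<^sup>+x. f x \<partial>lborel)"
proof -
  let ?B = "ball (0 :: real ^ 'n) 1"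
  let ?V = "transpose W"
  have [measurable]: "?B \<in> sets borel" by simp
  have "(\<integral>\<^sup>+x. f (W *v x) \<partial>lborel) * emeasure lborel ?B
      = (\<integral>\<^sup>+y. (\<integral>\<^sup>+x. f (W *v x) \<partial>lborel) * indicator ?B y \<partial>lborel)"
    by (subst nn_integral_cmult) (auto intro!: borel_measurable_indicator)
  \<comment> \<open>Shifting \<open>x\<close> by \<open>?V *v y\<close> shifts \<open>W *v x\<close>
    by exactly \<open>y\<close>, because \<open>?V\<close> inverts \<open>W\<close>.\<close>
  also have "\<dots> = (\<integral>\<^sup>+y. (\<integral>\<^sup>+x. f (W *v (x + ?V *v y)) \<partial>lborel) * indicator ?B y \<partial>lborel)"
    by (subst nn_integral_lborel_translation) auto
  also have "\<dots> = (\<integral>\<^sup>+y. (\<integral>\<^sup>+x. f (W *v x + y) * indicator ?B y \<partial>lborel) \<partial>lborel)"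
    by (simp add: matrix_vector_right_distrib orthogonal_matrix_transpose_cancel[OF W]
        nn_integral_multc del: transpose_matrix_vector)
  also have "\<dots> = (\<integral>\<^sup>+x. (\<integral>\<^sup>+y. f (W *v x + y) * indicator ?B y \<partial>lborel) \<partial>lborel)"
    by (rule lborel_pair.Fubini') measurable
  also have "\<dots> = (\<integral>\<^sup>+x. (\<integral>\<^sup>+y. f y * indicator ?B (y - W *v x) \<partial>lborel) \<partial>lborel)"
  proof (rule nn_integral_cong)
    fix x :: "real ^ 'n"
    show "(\<integral>\<^sup>+y. f (W *v x + y) * indicator ?B y \<partial>lborel)
        = (\<integral>\<^sup>+y. f y * indicator ?B (y - W *v x) \<partial>lborel)"
      using nn_integral_lborel_translation[of "\<lambda>y. f y * indicator ?B (y - W *v x)" "W *v x"]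
      by (simp add: add.commute)
  qed
  also have "\<dots> = (\<integral>\<^sup>+y. (\<integral>\<^sup>+x. f y * indicator ?B (y - W *v x) \<partial>lborel) \<partial>lborel)"
    by (rule lborel_pair.Fubini') measurable
  also have "\<dots> = (\<integral>\<^sup>+y. f y * emeasure lborel ?B \<partial>lborel)"
  proof (intro nn_integral_cong)
    fix y
    have "indicator ?B (y - W *v x) = (indicator (ball (?V *v y) 1) x :: ennreal)" for x
    proof -
      have "norm (y - W *v x) = norm (W *v (?V *v y - x))"
        by (simp add: matrix_vector_mult_diff_distrib orthogonal_matrix_transpose_cancel[OF W]
            del: transpose_matrix_vector)
      then show ?thesis
        using norm_minus_commute[of y "W *v x"]
        by (auto simp: norm_orthogonal_matrix[OF W] dist_norm indicator_def
            simp del: transpose_matrix_vector)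
    qed
    then show "(\<integral>\<^sup>+x. f y * indicator ?B (y - W *v x) \<partial>lborel) = f y * emeasure lborel ?B"
      by (simp add: nn_integral_cmult_indicator emeasure_ball del: transpose_matrix_vector)
  qed
  also have "\<dots> = (\<integral>\<^sup>+x. f x \<partial>lborel) * emeasure lborel ?B"
    by (simp add: nn_integral_multc)
  finally have *: "(\<integral>\<^sup>+x. f (W *v x) \<partial>lborel) * emeasure lborel ?B = (\<integral>\<^sup>+x. f x \<partial>lborel) * emeasure lborel ?B" .
  have "0 < emeasure lborel ?B" "emeasure lborel ?B < \<infinity>"
    by (auto simp: emeasure_ball emeasure_lborel_ball_finite unit_ball_vol_pos)
  with * show ?thesis
    by (metis ennreal_mult_divide_eq less_irrefl infinity_ennreal_def)
qed

lemma distr_lborel_orthogonal: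
  fixes W :: "real ^ 'n ^ 'n"
  assumes W: "orthogonal_matrix W"
  shows "distr lborel borel (\<lambda>x. W *v x) = lborel"
proof (rule measure_eqI)
  fix A assume A: "A \<in> sets (distr lborel borel ((*v) W))"
  then have [measurable]: "A \<in> sets borel" by simp
  have "emeasure (distr lborel borel ((*v) W)) A
      = (\<integral>\<^sup>+x. indicator A x \<partial>distr lborel borel ((*v) W))"
    using A by simp
  also have "\<dots> = (\<integral>\<^sup>+x. indicator A x \<partial>lborel)"
    by (subst nn_integral_distr) (auto simp: nn_integral_lborel_orthogonal[OF W])
  finally show "emeasure (distr lborel borel ((*v) W)) A = emeasure lborel A" by simp
qed simp

lemma integral_lborel_orthogonal:
  fixes W :: "real ^ 'n ^ 'n" and f :: "real ^ 'n \<Rightarrow> 'b::{banach, second_countable_topology}"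
  assumes W: "orthogonal_matrix W" and [measurable]: "f \<in> borel_measurable borel"
  shows "(LINT x|lborel. f (W *v x)) = (LINT x|lborel. f x)"
    and "integrable lborel (\<lambda>x. f (W *v x)) \<longleftrightarrow> integrable lborel f"
proof -
  show "(LINT x|lborel. f (W *v x)) = (LINT x|lborel. f x)"
    by (subst distr_lborel_orthogonal[OF W, symmetric], subst integral_distr) auto
  show "integrable lborel (\<lambda>x. f (W *v x)) \<longleftrightarrow> integrable lborel f"
    by (subst (2) distr_lborel_orthogonal[OF W, symmetric], subst integrable_distr_eq) auto
qed

lemma AE_lborel_orthogonal:
  fixes W :: "real ^ 'n ^ 'n"
  assumes W: "orthogonal_matrix W" and "AE x in lborel. P x"
  shows "AE x in lborel. P (W *v x)"
proof -
  have "AE x in distr lborel borel ((*v) W). P x"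
    using assms distr_lborel_orthogonal[OF W] by metis
  then show ?thesis by (rule AE_distrD[rotated]) measurable
qed

section \<open>Product integrals in coordinates and along orthonormal rows\<close>

lemma nn_integral_lborel_prod_vec:
  fixes f :: "'n::finite \<Rightarrow> real \<Rightarrow> real"
  assumes [measurable]: "\<And>i. f i \<in> borel_measurable borel" and nn: "\<And>i t. 0 \<le> f i t"
  shows "(\<integral>\<^sup>+x. ennreal (\<Prod>i\<in>UNIV. f i (x $ i)) \<partial>lborel) = (\<Prod>i\<in>UNIV. (\<integral>\<^sup>+t. ennreal (f i t) \<partial>lborel))"
proof -
  let ?e = "\<lambda>i::'n. axis i (1::real)"
  have inj: "inj ?e" by (auto simp: inj_on_def axis_eq_axis)
  have B: "(Basis :: (real ^ 'n) set) = range ?e"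
    by (auto simp: Basis_vec_def)
  \<comment> \<open>The product formula labels its factors by basis vectors, so \<open>f\<close> is
    relabelled along \<open>?e\<close>.\<close>
  define F where "F b = f (inv ?e b)" for b
  have F: "F (?e i) = f i" for i
    by (simp add: F_def inv_f_f[OF inj])
  have "(\<integral>\<^sup>+x. (\<Prod>b\<in>Basis. ennreal (F b (x \<bullet> b))) \<partial>(lborel :: (real ^ 'n) measure)) = (\<Prod>b\<in>Basis. (\<integral>\<^sup>+t. ennreal (F b t) \<partial>lborel))"
    by (rule nn_integral_lborel_prod) (auto simp: F_def)
  then show ?thesis
    unfolding B prod.reindex[OF inj] comp_def F inner_axis
    by (simp add: prod_ennreal nn)
qed

lemma nn_integral_lborel_prod_rows:
  fixes W :: "real ^ 'n ^ 'n"
  assumes W: "orthogonal_matrix W"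
    and [measurable]: "\<And>i. f i \<in> borel_measurable borel" and nn: "\<And>i t. 0 \<le> f i t"
  shows "(\<integral>\<^sup>+x. ennreal (\<Prod>i\<in>UNIV. f i (row i W \<bullet> x)) \<partial>lborel)
    = (\<Prod>i\<in>UNIV. (\<integral>\<^sup>+t. ennreal (f i t) \<partial>lborel))"
proof -
  have row: "row i W \<bullet> x = (W *v x) $ i" for i x
    by (simp add: matrix_vector_mul_component row_def)
  show ?thesis
    unfolding row
    by (subst nn_integral_lborel_orthogonal[OF W,
          where f="\<lambda>x. ennreal (\<Prod>i\<in>UNIV. f i (x $ i))"])
       (auto simp: nn_integral_lborel_prod_vec nn)
qed

section \<open>Hellinger distance\<close>

lemma is_density_measurable [measurable_dest]: "is_density p \<Longrightarrow> p \<in> borel_measurable borel"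
  by (simp add: is_density_def)

lemma is_density_nonneg: "is_density p \<Longrightarrow> 0 \<le> p x"
  by (simp add: is_density_def)

lemma is_density_integrable: "is_density p \<Longrightarrow> integrable lborel p"
  by (simp add: is_density_def)

lemma is_density_integral: "is_density p \<Longrightarrow> (LINT x|lborel. p x) = 1"
  by (simp add: is_density_def)

lemma is_density_nn_integral:
  assumes "is_density p"
  shows "(\<integral>\<^sup>+x. ennreal (p x) \<partial>lborel) = 1"
  using assms by (subst nn_integral_eq_integral) (auto simp: is_density_def)

lemma is_densityI:
  assumes [measurable]: "p \<in> borel_measurable borel" and "\<And>x. 0 \<le> p x"
    and "(\<integral>\<^sup>+x. ennreal (p x) \<partial>lborel) = 1"
  shows "is_density p"
proof -
  have i: "integrable lborel p"
    using assms by (intro integrableI_nonneg) auto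
  moreover have "ennreal (LINT x|lborel. p x) = 1"
    using assms nn_integral_eq_integral[OF i] by simp
  ultimately show ?thesis
    using assms by (simp add: is_density_def)
qed

lemma sqrt_mult_le_add:
  fixes a b :: real
  assumes "0 \<le> a" "0 \<le> b"
  shows "sqrt a * sqrt b \<le> a + b"
  using arith_geo_mean_sqrt[OF assms] assms by (simp add: real_sqrt_mult)

lemma integrable_sqrt_mult:
  assumes p: "is_density p" and q: "is_density q"
  shows "integrable lborel (\<lambda>x. sqrt (p x) * sqrt (q x))"
proof (rule Bochner_Integration.integrable_bound[where f="\<lambda>x. p x + q x"])
  show "integrable lborel (\<lambda>x. p x + q x)"
    using p q by (simp add: is_density_def)
  show "(\<lambda>x. sqrt (p x) * sqrt (q x)) \<in> borel_measurable lborel"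
    using p q by (auto simp: is_density_def)
  show "AE x in lborel. norm (sqrt (p x) * sqrt (q x)) \<le> norm (p x + q x)"
    using p q by (auto simp: is_density_def sqrt_mult_le_add)
qed

lemma sqrt_diff_square:
  fixes a b :: real
  assumes "0 \<le> a" "0 \<le> b"
  shows "(sqrt b - sqrt a)\<^sup>2 = a + b - 2 * (sqrt a * sqrt b)"
  using assms by (simp add: power2_diff)

lemma integrable_hellinger:
  assumes "is_density p" "is_density q"
  shows "integrable lborel (\<lambda>x. (sqrt (q x) - sqrt (p x))\<^sup>2)"
  using assms integrable_sqrt_mult[OF assms]
  by (simp add: sqrt_diff_square is_density_nonneg is_density_integrable)

lemma hellinger_sq_eq_affinity:
  assumes "is_density p" "is_density q"
  shows "hellinger_sq p q = 1 - (LINT x|lborel. sqrt (p x) * sqrt (q x))"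
  using assms integrable_sqrt_mult[OF assms]
  by (simp add: hellinger_sq_def sqrt_diff_square is_density_nonneg is_density_integrable
      is_density_integral)

lemma hellinger_sq_nonneg: "0 \<le> hellinger_sq p q"
  by (simp add: hellinger_sq_def)

lemma hellinger_sq_le_1:
  assumes "is_density p" "is_density q"
  shows "hellinger_sq p q \<le> 1"
  using assms by (simp add: hellinger_sq_eq_affinity is_density_nonneg)

lemma hellinger_sq_commute: "hellinger_sq p q = hellinger_sq q p"
  by (simp add: hellinger_sq_def power2_commute)

lemma power2_diff_le:
  fixes a b c :: real
  shows "(c - a)\<^sup>2 \<le> 2 * (b - a)\<^sup>2 + 2 * (c - b)\<^sup>2"
  using zero_le_power2[of "b - a - (c - b)"] by (simp add: power2_eq_square algebra_simps)

text \<open>The factors 2 come from squaring a sum: the distance is a metric, its square is not.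
  They are the source of the quarters of \<epsilon> in the final bound.\<close>

lemma hellinger_sq_triangle:
  assumes p: "is_density p" and q: "is_density q" and r: "is_density r"
  shows "hellinger_sq p r \<le> 2 * hellinger_sq p q + 2 * hellinger_sq q r"
proof -
  have "(LINT x|lborel. (sqrt (r x) - sqrt (p x))\<^sup>2)
      \<le> (LINT x|lborel. 2 * (sqrt (q x) - sqrt (p x))\<^sup>2 + 2 * (sqrt (r x) - sqrt (q x))\<^sup>2)"
  proof (intro integral_mono)
    show "(sqrt (r x) - sqrt (p x))\<^sup>2
        \<le> 2 * (sqrt (q x) - sqrt (p x))\<^sup>2 + 2 * (sqrt (r x) - sqrt (q x))\<^sup>2" for x
      by (rule power2_diff_le)
  qed (intro Bochner_Integration.integrable_add integrable_mult_right integrable_hellinger assms)+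
  then show ?thesis
    using assms by (simp add: hellinger_sq_def integrable_hellinger)
qed

lemma hellinger_sq_le_L1:
  assumes p: "is_density p" and q: "is_density q"
  shows "hellinger_sq p q \<le> (LINT x|lborel. \<bar>p x - q x\<bar>) / 2"
proof -
  have "(LINT x|lborel. (sqrt (q x) - sqrt (p x))\<^sup>2) \<le> (LINT x|lborel. \<bar>p x - q x\<bar>)"
  proof (intro integral_mono)
    fix x
    let ?a = "sqrt (p x)" and ?b = "sqrt (q x)"
    have nn: "0 \<le> ?a" "0 \<le> ?b" using assms by (auto simp: is_density_nonneg)
    have "(?b - ?a)\<^sup>2 = \<bar>?a - ?b\<bar> * \<bar>?a - ?b\<bar>"
      by (simp add: power2_eq_square algebra_simps)
    also have "\<dots> \<le> \<bar>?a - ?b\<bar> * \<bar>?a + ?b\<bar>"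
    proof (rule mult_left_mono)
      show "\<bar>?a - ?b\<bar> \<le> \<bar>?a + ?b\<bar>" using nn by linarith
    qed simp
    also have "\<dots> = \<bar>(?a - ?b) * (?a + ?b)\<bar>" by (simp add: abs_mult)
    also have "(?a - ?b) * (?a + ?b) = p x - q x"
      using assms by (simp add: algebra_simps is_density_nonneg)
    finally show "(sqrt (q x) - sqrt (p x))\<^sup>2 \<le> \<bar>p x - q x\<bar>" .
  qed (use assms in \<open>auto simp: integrable_hellinger is_density_integrable\<close>)
  then show ?thesis by (simp add: hellinger_sq_def)
qed

lemma hellinger_sq_cong_AE:
  assumes "AE x in lborel. p x = p' x" "AE x in lborel. q x = q' x"
    and [measurable]: "p \<in> borel_measurable borel" "p' \<in> borel_measurable borel"
      "q \<in> borel_measurable borel" "q' \<in> borel_measurable borel"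
  shows "hellinger_sq p q = hellinger_sq p' q'"
proof -
  have "AE x in lborel. (sqrt (q x) - sqrt (p x))\<^sup>2 = (sqrt (q' x) - sqrt (p' x))\<^sup>2"
    using assms(1,2) by eventually_elim simp
  then have "(LINT x|lborel. (sqrt (q x) - sqrt (p x))\<^sup>2) = (LINT x|lborel. (sqrt (q' x) - sqrt (p' x))\<^sup>2)"
    by (intro integral_cong_AE) auto
  then show ?thesis by (simp add: hellinger_sq_def)
qed

section \<open>Product densities along orthonormal rows\<close>

lemma sqrt_prod: "sqrt (\<Prod>i\<in>I. f i) = (\<Prod>i\<in>I. sqrt (f i))"
  by (induction I rule: infinite_finite_induct) (simp_all add: real_sqrt_mult)

text \<open>For orthogonal \<open>W\<close> and univariate densities \<open>f i\<close> this is the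
  density of \<open>transpose W *v Z\<close>, where \<open>Z\<close> has independent coordinates
  with densities \<open>f i\<close>. The proposed estimator has this form as well.\<close>

definition prod_rows :: "real ^ 'n ^ 'n \<Rightarrow> ('n \<Rightarrow> real \<Rightarrow> real) \<Rightarrow> real ^ 'n \<Rightarrow> real" where
  "prod_rows W f x = (\<Prod>i\<in>UNIV. f i (row i W \<bullet> x))"

lemma is_density_prod_rows:
  assumes W: "orthogonal_matrix W" and f: "\<And>i. is_density (f i)"
  shows "is_density (prod_rows W f)"
proof (rule is_densityI)
  have [measurable]: "f i \<in> borel_measurable borel" for i
    using f by (rule is_density_measurable)
  show "prod_rows W f \<in> borel_measurable borel"
    unfolding prod_rows_def by measurable
  show "0 \<le> prod_rows W f x" for x
    unfolding prod_rows_def by (intro prod_nonneg) (simp add: f is_density_nonneg)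
  show "(\<integral>\<^sup>+x. ennreal (prod_rows W f x) \<partial>lborel) = 1"
    unfolding prod_rows_def
    by (subst nn_integral_lborel_prod_rows[OF W])
       (simp_all add: f is_density_nonneg is_density_nn_integral)
qed

text \<open>The affinity, one minus the squared distance, is multiplicative over products.
  Weierstrass' inequality for a product of numbers \<open>1 - h i\<close> with \<open>h i\<close> in
  the unit interval then turns the product into a sum.\<close>

lemma hellinger_sq_prod_rows:
  assumes W: "orthogonal_matrix W" and f: "\<And>i. is_density (f i)" and g: "\<And>i. is_density (g i)"
  shows "hellinger_sq (prod_rows W f) (prod_rows W g) \<le> (\<Sum>i\<in>UNIV. hellinger_sq (f i) (g i))"
proof -
  have [measurable]: "f i \<in> borel_measurable borel" "g i \<in> borel_measurable borel" for i
    using f g by (auto intro: is_density_measurable)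
  let ?s = "\<lambda>i t. sqrt (f i t) * sqrt (g i t)"
  have s0: "0 \<le> ?s i t" for i t
    using f g by (simp add: is_density_nonneg)
  have eq: "sqrt (prod_rows W f x) * sqrt (prod_rows W g x) = (\<Prod>i\<in>UNIV. ?s i (row i W \<bullet> x))" for x
    by (simp add: prod_rows_def sqrt_prod prod.distrib)
  have "ennreal (LINT x|lborel. sqrt (prod_rows W f x) * sqrt (prod_rows W g x))
      = (\<integral>\<^sup>+x. ennreal (sqrt (prod_rows W f x) * sqrt (prod_rows W g x)) \<partial>lborel)"
    by (intro nn_integral_eq_integral[symmetric] integrable_sqrt_mult)
       (auto simp: is_density_prod_rows W f g is_density_nonneg)
  also have "\<dots> = (\<Prod>i\<in>UNIV. (\<integral>\<^sup>+t. ennreal (?s i t) \<partial>lborel))"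
    unfolding eq by (rule nn_integral_lborel_prod_rows[OF W]) (use s0 in auto)
  also have "\<dots> = (\<Prod>i\<in>UNIV. ennreal (LINT t|lborel. ?s i t))"
    by (intro prod.cong nn_integral_eq_integral integrable_sqrt_mult f g refl) (use s0 in auto)
  also have "\<dots> = ennreal (\<Prod>i\<in>UNIV. (LINT t|lborel. ?s i t))"
    by (rule prod_ennreal) (use s0 in \<open>auto intro!: integral_nonneg\<close>)
  finally have "(LINT x|lborel. sqrt (prod_rows W f x) * sqrt (prod_rows W g x))
      = (\<Prod>i\<in>UNIV. (LINT t|lborel. ?s i t))"
    by (subst (asm) ennreal_inj)
       (use s0 in \<open>auto intro!: integral_nonneg prod_nonneg simp: is_density_nonneg is_density_prod_rows W f g\<close>)
  then have "hellinger_sq (prod_rows W f) (prod_rows W g)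
      = 1 - (\<Prod>i\<in>UNIV. 1 - hellinger_sq (f i) (g i))"
    by (simp add: hellinger_sq_eq_affinity is_density_prod_rows W f g)
  moreover have "1 - (\<Sum>i\<in>UNIV. hellinger_sq (f i) (g i)) \<le> (\<Prod>i\<in>UNIV. 1 - hellinger_sq (f i) (g i))"
    by (intro Weierstrass_prod_ineq) (auto simp: hellinger_sq_nonneg hellinger_sq_le_1 f g)
  ultimately show ?thesis by linarith
qed

section \<open>Projected densities\<close>

lemma sets_law [simp, measurable_cong]: "sets (law p) = sets borel"
  by (simp add: law_def)

lemma space_law [simp]: "space (law p) = UNIV"
  by (simp add: law_def)

lemma emeasure_law:
  assumes [measurable]: "p \<in> borel_measurable borel" "A \<in> sets borel"
  shows "emeasure (law p) A = (\<integral>\<^sup>+x. ennreal (p x) * indicator A x \<partial>lborel)"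
  unfolding law_def by (subst emeasure_density) auto

lemma prob_space_law:
  assumes "is_density p"
  shows "prob_space (law p)"
proof
  have [measurable]: "p \<in> borel_measurable borel"
    using assms by (rule is_density_measurable)
  show "emeasure (law p) (space (law p)) = 1"
    using assms by (simp add: emeasure_law is_density_nn_integral)
qed

lemma nn_integral_law:
  assumes [measurable]: "p \<in> borel_measurable borel" "f \<in> borel_measurable borel"
  shows "(\<integral>\<^sup>+x. f x \<partial>law p) = (\<integral>\<^sup>+x. ennreal (p x) * f x \<partial>lborel)"
  unfolding law_def by (subst nn_integral_density) auto

lemma AE_law:
  assumes "is_density p"
  shows "(AE x in law p. P x) \<longleftrightarrow> (AE x in lborel. 0 < p x \<longrightarrow> P x)"
  unfolding law_def using assms by (subst AE_density) (auto dest: is_density_measurable)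

text \<open>A law fixes its density up to null sets; this is how a factorisation of the law of
  \<open>p\<close> becomes one of \<open>p\<close> almost everywhere.\<close>

lemma law_eq_iff:
  assumes p: "is_density p" and q: "is_density q" and eq: "law p = law q"
  shows "AE x in lborel. p x = q x"
proof -
  have "AE x in lborel. ennreal (p x) = ennreal (q x)"
    using eq p q unfolding law_def
    by (subst (asm) sigma_finite_measure.density_unique_iff[OF sigma_finite_lborel]) (auto dest: is_density_measurable)
  then show ?thesis
    by eventually_elim (use p q in \<open>auto simp: is_density_nonneg\<close>)
qed

text \<open>By translation invariance \<open>\<integral> indicator A (s \<bullet> x + t) dx\<close> does not depend on \<open>t\<close>, while
  its integral over \<open>t\<close> vanishes.\<close>

lemma null_sets_inner_vimage:
  fixes s :: "real ^ 'n"
  assumes s: "norm s = 1" and A: "A \<in> null_sets lborel"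
  shows "emeasure lborel {x. s \<bullet> x \<in> A} = 0"
proof -
  have [measurable]: "A \<in> sets borel" using A by auto
  define c where "c = (\<integral>\<^sup>+x. indicator A (s \<bullet> x) \<partial>lborel)"
  have c: "(\<integral>\<^sup>+x. indicator A (s \<bullet> x + t) \<partial>lborel) = c" for t
  proof -
    have "s \<bullet> (x + t *\<^sub>R s) = s \<bullet> x + t" for x
      using s by (simp add: inner_add_right dot_square_norm)
    then show ?thesis
      using nn_integral_lborel_translation[of "\<lambda>x. indicator A (s \<bullet> x)" "t *\<^sub>R s"]
      by (simp add: c_def)
  qed
  have "c * emeasure lborel (UNIV :: real set) = (\<integral>\<^sup>+t. c \<partial>(lborel :: real measure))"
    by simp
  also have "\<dots> = (\<integral>\<^sup>+t. (\<integral>\<^sup>+x. indicator A (s \<bullet> x + t) \<partial>lborel) \<partial>lborel)"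
    by (simp add: c)
  also have "\<dots> = (\<integral>\<^sup>+x. (\<integral>\<^sup>+t. indicator A (s \<bullet> x + t) \<partial>lborel) \<partial>lborel)"
    by (rule lborel_pair.Fubini') measurable
  also have "\<dots> = (\<integral>\<^sup>+x. (\<integral>\<^sup>+t. indicator A t \<partial>lborel) \<partial>(lborel :: (real ^ 'n) measure))"
    using nn_integral_lborel_translation[of "indicator A" "s \<bullet> _"]
    by (simp add: add.commute)
  also have "\<dots> = 0"
    using null_setsD1[OF A] by simp
  finally have "c = 0" by simp
  moreover have "emeasure lborel {x. s \<bullet> x \<in> A} = c"
  proof -
    have "(\<lambda>x. indicator A (s \<bullet> x) :: ennreal) = indicator {x. s \<bullet> x \<in> A}"
      by (auto simp: indicator_def)
    then show ?thesis
      by (simp add: c_def)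
  qed
  ultimately show ?thesis by simp
qed

lemma law_proj_density:
  fixes p :: "real ^ 'n \<Rightarrow> real"
  assumes p: "is_density p" and s: "norm s = 1"
  shows "law (proj_density p s) = distr (law p) borel (\<lambda>x. s \<bullet> x)"
    and "is_density (proj_density p s)"
proof -
  interpret law: prob_space "law p" by (rule prob_space_law[OF p])
  have [measurable]: "p \<in> borel_measurable borel" by (rule is_density_measurable[OF p])
  let ?N = "distr (law p) borel (\<lambda>x. s \<bullet> x)"
  interpret N: prob_space ?N by (rule law.prob_space_distr) measurable
  \<comment> \<open>The Radon-Nikodym derivative recovers \<open>?N\<close> only under absolute
    continuity, which holds since null sets on the line pull back to null sets along a unit
    vector.\<close>
  have ac: "absolutely_continuous lborel ?N"
    unfolding absolutely_continuous_def
  proof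
    fix A :: "real set" assume A: "A \<in> null_sets lborel"
    then have [measurable]: "A \<in> sets borel" by auto
    have "emeasure ?N A = emeasure (law p) {x. s \<bullet> x \<in> A}"
      by (subst emeasure_distr) (auto simp: vimage_def)
    also have "\<dots> = (\<integral>\<^sup>+x. ennreal (p x) * indicator {x. s \<bullet> x \<in> A} x \<partial>lborel)"
      by (rule emeasure_law) measurable
    also have "\<dots> = 0"
    proof -
      have "{x. s \<bullet> x \<in> A} \<in> null_sets lborel"
        by (intro null_setsI null_sets_inner_vimage s A) measurable
      then have "AE x in lborel. x \<notin> {x. s \<bullet> x \<in> A}"
        by (rule AE_not_in)
      then have "AE x in lborel. ennreal (p x) * indicator {x. s \<bullet> x \<in> A} x = 0"
        by eventually_elim simp
      then show ?thesis
        by (subst nn_integral_0_iff_AE) auto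
    qed
    finally show "A \<in> null_sets ?N" by (intro null_setsI) auto
  qed
  have [measurable]: "proj_density p s \<in> borel_measurable borel"
    unfolding proj_density_def by measurable
  \<comment> \<open>\<open>enn2real\<close> sends infinity to 0, so finiteness almost everywhere is
    what makes the real-valued version a density of \<open>?N\<close>.\<close>
  have fin: "AE t in lborel. RN_deriv lborel ?N t \<noteq> \<infinity>"
    by (rule sigma_finite_measure.RN_deriv_finite[OF sigma_finite_lborel _ ac]) (auto intro: N.sigma_finite_measure_axioms)
  then have "AE t in lborel. ennreal (proj_density p s t) = RN_deriv lborel ?N t"
    by eventually_elim (simp add: proj_density_def ennreal_enn2real_if)
  then have "law (proj_density p s) = density lborel (RN_deriv lborel ?N)"
    unfolding law_def[of "proj_density p s"] by (intro density_cong) auto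
  also have "\<dots> = ?N"
    by (rule sigma_finite_measure.density_RN_deriv[OF sigma_finite_lborel ac]) simp
  finally show eq: "law (proj_density p s) = ?N" .
  show "is_density (proj_density p s)"
  proof (rule is_densityI)
    have "(\<integral>\<^sup>+t. ennreal (proj_density p s t) \<partial>lborel) = emeasure (law (proj_density p s)) UNIV"
      by (simp add: emeasure_law)
    then show "(\<integral>\<^sup>+t. ennreal (proj_density p s t) \<partial>lborel) = 1"
      using N.emeasure_space_1 by (simp add: eq)
  qed (auto simp: proj_density_def)
qed

lemma norm_row_orthogonal_matrix:
  fixes W :: "real ^ 'n ^ 'n"
  shows "orthogonal_matrix W \<Longrightarrow> norm (row i W) = 1"
  by (simp add: orthogonal_matrix_orthonormal_rows)

lemma matrix_vector_mult_row: "(W *v x) $ i = row i W \<bullet> x"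
  by (simp add: matrix_vector_mul_component row_def)

definition proj_rows :: "(real ^ 'n \<Rightarrow> real) \<Rightarrow> real ^ 'n ^ 'n \<Rightarrow> 'n \<Rightarrow> real \<Rightarrow> real" where
  "proj_rows p W i = proj_density p (row i W)"

lemma is_density_proj_rows:
  "is_density p \<Longrightarrow> orthogonal_matrix W \<Longrightarrow> is_density (proj_rows p W i)"
  unfolding proj_rows_def by (intro law_proj_density norm_row_orthogonal_matrix)

text \<open>Open boxes are closed under intersection, generate the Borel sets and exhaust the space.
  This serves for the factorised law and, later, for functions with vanishing integrals over
  boxes.\<close>

lemma measure_eqI_box:
  fixes M N :: "'a::euclidean_space measure"
  assumes "sets M = sets borel" "sets N = sets borel" "finite_measure M"
    and "\<And>a b. emeasure M (box a b) = emeasure N (box a b)"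
  shows "M = N"
proof -
  interpret finite_measure M by fact
  let ?E = "range (\<lambda>(a, b). box a b :: 'a set)"
  show ?thesis
  proof (rule measure_eqI_generator_eq)
    show "Int_stable ?E" "?E \<subseteq> Pow UNIV"
      by (auto simp: Int_stable_def box_Int_box)
    show "sets M = sigma_sets UNIV ?E" "sets N = sigma_sets UNIV ?E"
      using assms by (simp_all add: borel_eq_box)
    let ?A = "\<lambda>n::nat. box (- (real n *\<^sub>R One)) (real n *\<^sub>R One) :: 'a set"
    show "range ?A \<subseteq> ?E" "(\<Union>i. ?A i) = UNIV"
      unfolding UN_box_eq_UNIV by auto
    show "emeasure M (?A i) \<noteq> \<infinity>" for i by simp
    show "emeasure M X = emeasure N X" if "X \<in> ?E" for X
      using that assms(4) by auto
  qed
qed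

text \<open>Independence evaluates the law of \<open>W *v x\<close> on a box as a product of
  marginal probabilities, and integrating the product density over the same box gives the same
  product. Agreement on boxes identifies the two image laws.\<close>

lemma law_unmixing_matrix:
  fixes p :: "real ^ 'n \<Rightarrow> real"
  assumes p: "is_density p" and W: "unmixing_matrix p W"
  shows "law p = law (prod_rows W (proj_rows p W))"
proof -
  have W': "orthogonal_matrix W" using W by (simp add: unmixing_matrix_def)
  interpret law: prob_space "law p" by (rule prob_space_law[OF p])
  have ind: "law.indep_vars (\<lambda>_. borel) (\<lambda>i x. (W *v x) $ i) UNIV"
    using W by (simp add: unmixing_matrix_def)
  let ?f = "proj_rows p W"
  let ?q = "prod_rows W ?f"
  have f: "is_density (?f i)" for i by (rule is_density_proj_rows[OF p W'])
  have q: "is_density ?q" by (rule is_density_prod_rows[OF W' f])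
  have [measurable]: "?f i \<in> borel_measurable borel" for i
    by (rule is_density_measurable[OF f])
  have [measurable]: "?q \<in> borel_measurable borel" by (rule is_density_measurable[OF q])
  let ?M = "distr (law p) borel ((*v) W)" and ?N = "distr (law ?q) borel ((*v) W)"
  have "?M = ?N"
  proof (rule measure_eqI_box)
    show "finite_measure ?M"
      using law.prob_space_distr[of "(*v) W" borel] by (simp add: prob_space_def)
    fix a b :: "real ^ 'n"
    let ?I = "\<lambda>i. {a $ i <..< b $ i}"
    have vimage: "(*v) W -` box a b = {x. \<forall>i. row i W \<bullet> x \<in> ?I i}"
      by (auto simp: mem_box_cart matrix_vector_mult_row)
    have "emeasure ?M (box a b) = emeasure (law p) {x. \<forall>i. row i W \<bullet> x \<in> ?I i}"
      by (subst emeasure_distr) (auto simp: vimage)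
    also have "{x. \<forall>i. row i W \<bullet> x \<in> ?I i}
        = (\<Inter>i\<in>UNIV. (\<lambda>x. (W *v x) $ i) -` ?I i \<inter> space (law p))"
      by (auto simp: matrix_vector_mult_row)
    also have "emeasure (law p) \<dots> = (\<Prod>i\<in>UNIV. emeasure (law p) ((\<lambda>x. (W *v x) $ i) -` ?I i \<inter> space (law p)))"
      using law.indep_varsD_finite[OF ind, of ?I]
      by (simp add: law.emeasure_eq_measure prod_ennreal)
    also have "\<dots> = (\<Prod>i\<in>UNIV. emeasure (law (?f i)) (?I i))"
      unfolding proj_rows_def law_proj_density(1)[OF p norm_row_orthogonal_matrix[OF W']]
      by (intro prod.cong refl, subst emeasure_distr) (auto simp: matrix_vector_mult_row)
    also have "\<dots> = (\<Prod>i\<in>UNIV. (\<integral>\<^sup>+t. ennreal (?f i t * indicator (?I i) t) \<partial>lborel))"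
      by (intro prod.cong refl)
         (auto simp: emeasure_law ennreal_mult'' ennreal_indicator f is_density_nonneg)
    also have "\<dots> = (\<integral>\<^sup>+x. ennreal (\<Prod>i\<in>UNIV. ?f i (row i W \<bullet> x) * indicator (?I i) (row i W \<bullet> x)) \<partial>lborel)"
      by (rule nn_integral_lborel_prod_rows[OF W', symmetric]) (auto simp: f is_density_nonneg)
    also have "\<dots> = (\<integral>\<^sup>+x. ennreal (?q x) * indicator {x. \<forall>i. row i W \<bullet> x \<in> ?I i} x \<partial>lborel)"
    proof (intro nn_integral_cong)
      fix x
      have "(\<Prod>i\<in>UNIV. indicator (?I i) (row i W \<bullet> x) :: real)
          = indicator {x. \<forall>i. row i W \<bullet> x \<in> ?I i} x"
        by (auto simp: indicator_def prod_zero_iff split: if_splits)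
      then show "ennreal (\<Prod>i\<in>UNIV. ?f i (row i W \<bullet> x) * indicator (?I i) (row i W \<bullet> x))
          = ennreal (?q x) * indicator {x. \<forall>i. row i W \<bullet> x \<in> ?I i} x"
        by (simp add: prod.distrib prod_rows_def indicator_def split: if_splits)
    qed
    also have "\<dots> = emeasure (law ?q) {x. \<forall>i. row i W \<bullet> x \<in> ?I i}"
      by (rule emeasure_law[symmetric]) measurable
    also have "\<dots> = emeasure ?N (box a b)"
      by (subst emeasure_distr) (auto simp: vimage)
    finally show "emeasure ?M (box a b) = emeasure ?N (box a b)" .
  qed simp_all
  \<comment> \<open>Mapping by the transpose undoes \<open>W\<close> on both sides.\<close>
  then have "distr ?M borel ((*v) (transpose W)) = distr ?N borel ((*v) (transpose W))"
    by simp
  then have "distr (law p) borel (\<lambda>x. x) = distr (law ?q) borel (\<lambda>x. x)"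
    by (simp add: distr_distr comp_def orthogonal_matrix_transpose_cancel[OF W']
        del: transpose_matrix_vector)
  then show ?thesis
    by (metis distr_id2 sets_law)
qed

section \<open>Integration by parts and the Hoelder condition\<close>

lemma borel_measurable_vec_nth [measurable (raw)]:
  fixes f :: "'a \<Rightarrow> real ^ 'n"
  assumes "f \<in> borel_measurable M"
  shows "(\<lambda>x. f x $ i) \<in> borel_measurable M"
  by (rule measurable_compose[OF assms]) (intro borel_measurable_continuous_onI continuous_intros)

lemma GDERIV_unique: "GDERIV f x :> D \<Longrightarrow> GDERIV f x :> E \<Longrightarrow> D = E"
  unfolding gderiv_def
  by (drule (1) has_derivative_unique) (metis ext inner_commute vector_eq_ldot)

lemma grad_eqI: "GDERIV f x :> D \<Longrightarrow> grad f x = D"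
  unfolding grad_def by (rule the_equality) (auto dest: GDERIV_unique)

lemma GDERIV_grad: "GDERIV f x :> D \<Longrightarrow> GDERIV f x :> grad f x"
  using grad_eqI by metis

lemma GDERIV_line:
  assumes "GDERIV f (x + t *\<^sub>R v) :> D"
  shows "((\<lambda>t. f (x + t *\<^sub>R v)) has_real_derivative v \<bullet> D) (at t)"
proof -
  have "((\<lambda>t. f (x + t *\<^sub>R v)) has_derivative (\<lambda>h. (h *\<^sub>R v) \<bullet> D)) (at t)"
    using assms unfolding gderiv_def
    by (rule has_derivative_compose[where g=f, rotated]) (auto intro!: derivative_eq_intros)
  then show ?thesis
    by (simp add: has_field_derivative_def mult_commute_abs)
qed

text \<open>The mean of \<open>h\<close> over the segment from \<open>x\<close> to
  \<open>x + v\<close>. The indicator keeps it an integral over the whole line, so that Fubini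
  applies to products of Lebesgue measures.\<close>

definition line_average :: "('a::euclidean_space \<Rightarrow> real) \<Rightarrow> 'a \<Rightarrow> 'a \<Rightarrow> real" where
  "line_average h v x = (LINT t|lborel. indicator {0..1} t * h (x + t *\<^sub>R v))"

text \<open>For each fixed \<open>t\<close> the slice is a translate of \<open>h\<close>, so all
  slices have the same integral and the same absolute integral; Fubini does the rest.\<close>

lemma line_average:
  fixes h :: "'a::euclidean_space \<Rightarrow> real"
  assumes h: "integrable lborel h"
  shows "integrable lborel (line_average h v)"
    and "(LINT x|lborel. line_average h v x) = (LINT x|lborel. h x)"
proof -
  have [measurable]: "h \<in> borel_measurable borel" using h by auto
  let ?F = "\<lambda>t x. indicator {0..1} t * h (x + t *\<^sub>R v) :: real"
  have F: "integrable (lborel \<Otimes>\<^sub>M lborel) (case_prod ?F)"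
  proof (rule lborel_pair.Fubini_integrable)
    have "(LINT x|lborel. norm (case (t, x) of (t, x) \<Rightarrow> ?F t x)) = indicator {0..1} t * (LINT x|lborel. \<bar>h x\<bar>)" for t
      using integral_lborel_translation[of "\<lambda>x. \<bar>h x\<bar>" "t *\<^sub>R v"] by (simp add: abs_mult)
    then show "integrable lborel (\<lambda>t. LINT x|lborel. norm (case (t, x) of (t, x) \<Rightarrow> ?F t x))"
      by simp
    show "AE t in lborel. integrable lborel (\<lambda>x. case (t, x) of (t, x) \<Rightarrow> ?F t x)"
      by (auto intro!: integrable_lborel_translation h)
  qed measurable
  show "integrable lborel (line_average h v)"
    unfolding line_average_def using lborel_pair.integrable_snd[OF F] by simp
  have "(LINT x|lborel. line_average h v x) = (LINT t|lborel. LINT x|lborel. ?F t x)"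
    unfolding line_average_def by (rule lborel_pair.Fubini_integral[OF F])
  also have "\<dots> = (LINT t|lborel. indicator {0..1::real} t * (LINT x|lborel. h x))"
    by (simp add: integral_lborel_translation)
  also have "\<dots> = (LINT x|lborel. h x)"
    by simp
  finally show "(LINT x|lborel. line_average h v x) = (LINT x|lborel. h x)" .
qed

lemma line_average_abs: "\<bar>line_average h v x\<bar> \<le> line_average (\<lambda>x. \<bar>h x\<bar>) v x"
  unfolding line_average_def
  by (rule order_trans[OF integral_abs_bound]) (simp add: abs_mult)

lemma line_average_GDERIV:
  fixes f :: "'a::euclidean_space \<Rightarrow> real"
  assumes D: "\<And>x. GDERIV f x :> D x" and cont: "continuous_on UNIV D"
  shows "line_average (\<lambda>x. v \<bullet> D x) v x = f (x + v) - f x"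
proof -
  have c: "continuous_on UNIV (\<lambda>t. v \<bullet> D (x + t *\<^sub>R v))"
    by (intro continuous_intros continuous_on_compose2[OF cont]) auto
  have "(LINT t|lborel. (v \<bullet> D (x + t *\<^sub>R v)) * indicator {0..1} t)
      = f (x + 1 *\<^sub>R v) - f (x + 0 *\<^sub>R v)"
  proof (rule integral_FTC_Icc_real)
    show "((\<lambda>t. f (x + t *\<^sub>R v)) has_real_derivative v \<bullet> D (x + t *\<^sub>R v)) (at t)" for t
      by (rule GDERIV_line[OF D])
    show "isCont (\<lambda>t. v \<bullet> D (x + t *\<^sub>R v)) t" for t
      using c by (simp add: continuous_on_eq_continuous_at)
  qed simp
  then show ?thesis
    by (simp add: line_average_def mult.commute)
qed

text \<open>The difference \<open>f (x + v) - f x\<close> integrates to zero and is a segment average of the directional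
  derivative.\<close>

lemma integral_directional_derivative:
  fixes f :: "'a::euclidean_space \<Rightarrow> real"
  assumes D: "\<And>x. GDERIV f x :> D x" and cont: "continuous_on UNIV D"
    and f: "integrable lborel f" and i: "integrable lborel (\<lambda>x. v \<bullet> D x)"
  shows "(LINT x|lborel. v \<bullet> D x) = 0"
proof -
  have [measurable]: "f \<in> borel_measurable borel" using f by auto
  have "(LINT x|lborel. v \<bullet> D x) = (LINT x|lborel. f (x + v) - f x)"
    using line_average(2)[OF i, of v] by (simp add: line_average_GDERIV[OF D cont])
  also have "\<dots> = (LINT x|lborel. f (x + v)) - (LINT x|lborel. f x)"
    by (intro Bochner_Integration.integral_diff integrable_lborel_translation f)
  finally show ?thesis by (simp add: integral_lborel_translation)
qed

lemma Ck_1_grad: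
  assumes "Ck 1 f"
  shows "GDERIV f x :> grad f x" "continuous_on UNIV (grad f)"
proof -
  show "GDERIV f x :> grad f x"
    using assms by (auto intro: GDERIV_grad)
  have "\<forall>i. continuous_on UNIV (\<lambda>x. grad f x $ i)"
    using assms by simp
  then show "continuous_on UNIV (grad f)"
    using continuous_on_vec_lambda[of UNIV "\<lambda>i x. grad f x $ i"] by simp
qed

lemma integrable_norm_density:
  fixes p :: "'a::euclidean_space \<Rightarrow> real"
  assumes p: "is_density p" and "finite_second_moments p"
  shows "integrable lborel (\<lambda>x. norm x * p x)"
proof (rule Bochner_Integration.integrable_bound[where f="\<lambda>x. p x + (norm x)\<^sup>2 * p x"])
  show "integrable lborel (\<lambda>x. p x + (norm x)\<^sup>2 * p x)"
    using assms by (simp add: is_density_integrable finite_second_moments_def)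
  show "(\<lambda>x. norm x * p x) \<in> borel_measurable lborel"
    using is_density_measurable[OF p] by auto
  have "norm x * p x \<le> p x + (norm x)\<^sup>2 * p x" for x
  proof -
    have "norm x \<le> 1 + (norm x)\<^sup>2"
      using zero_le_power2[of "norm x - 1"] norm_ge_zero[of x]  by (simp only: power2_diff power_one mult_1_right)
    from mult_right_mono[OF this is_density_nonneg[OF p, of x]]
    show ?thesis by (simp add: algebra_simps)
  qed
  then show "AE x in lborel. norm (norm x * p x) \<le> norm (p x + (norm x)\<^sup>2 * p x)"
    using p by (auto simp: is_density_nonneg)
qed

text \<open>Integration by parts: the divergence of \<open>A x\<close> is the trace of \<open>A\<close>.\<close>

lemma integral_grad_linear:
  fixes p :: "real ^ 'n \<Rightarrow> real" and A :: "real ^ 'n ^ 'n"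
  assumes p: "is_density p" "finite_second_moments p" "Ck 1 p"
    and g: "integrable lborel (\<lambda>x. norm x * norm (grad p x))"
  shows "integrable lborel (\<lambda>x. grad p x \<bullet> (A *v x))"
    and "(LINT x|lborel. grad p x \<bullet> (A *v x)) = - trace A"
proof -
  note G = Ck_1_grad[OF p(3)]
  have [measurable]: "p \<in> borel_measurable borel" by (rule is_density_measurable[OF p(1)])
  have [measurable]: "grad p \<in> borel_measurable borel"
    by (rule borel_measurable_continuous_onI[OF G(2)])
  have ij: "integrable lborel (\<lambda>x. x $ j * grad p x $ i)" for i j
  proof (rule Bochner_Integration.integrable_bound[OF g])
    show "AE x in lborel. norm (x $ j * grad p x $ i) \<le> norm (norm x * norm (grad p x))"
      by (auto simp: abs_mult intro!: mult_mono component_le_norm_cart)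
  qed measurable
  have "(LINT x|lborel. x $ j * grad p x $ i) = - (if i = j then 1 else 0)" for i j
  proof -
    let ?e = "\<lambda>i::'n. axis i (1::real)"
    \<comment> \<open>The gradient of \<open>x $ j * p x\<close>. Its derivative in direction
      \<open>?e i\<close> integrates to zero; for \<open>i = j\<close> the product rule contributes
      an extra \<open>p\<close>, of integral 1.\<close>
    let ?D = "\<lambda>x. x $ j *\<^sub>R grad p x + p x *\<^sub>R ?e j"
    have D: "GDERIV (\<lambda>x. x $ j * p x) x :> ?D x" for x
    proof (rule GDERIV_mult)
      show "GDERIV (\<lambda>x::real^'n. x $ j) x :> ?e j"
        unfolding gderiv_def by (simp add: inner_axis bounded_linear_imp_has_derivative
            bounded_linear_vec_nth)
    qed (rule G(1))
    have eq: "?e i \<bullet> ?D x = x $ j * grad p x $ i + (if i = j then p x else 0)" for x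
      by (simp add: inner_add_right inner_axis' inner_axis_axis) (simp add: axis_def)
    have int: "integrable lborel (\<lambda>x. x $ j * grad p x $ i + (if i = j then p x else 0))"
      by (intro Bochner_Integration.integrable_add ij) (cases "i = j"; simp add: is_density_integrable p)
    have "continuous_on UNIV p"
      using G(1) unfolding gderiv_def
      by (meson continuous_at_imp_continuous_on has_derivative_continuous)
    then have "continuous_on UNIV ?D"
      by (intro continuous_intros G(2))
    then have "(LINT x|lborel. ?e i \<bullet> ?D x) = 0"
    proof (rule integral_directional_derivative[OF D])
      show "integrable lborel (\<lambda>x. x $ j * p x)"
        by (rule Bochner_Integration.integrable_bound[OF integrable_norm_density[OF p(1,2)]])
           (auto simp: abs_mult intro!: mult_mono component_le_norm_cart)
      show "integrable lborel (\<lambda>x. ?e i \<bullet> ?D x)"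
        unfolding eq by (rule int)
    qed
    then have "(LINT x|lborel. x $ j * grad p x $ i) + (if i = j then 1 else 0) = 0"
      unfolding eq using ij[of j i] p(1)
      by (cases "i = j") (simp_all add: is_density_integrable is_density_integral)
    then show ?thesis by simp
  qed
  note ij_eq = this
  have eq: "grad p x \<bullet> (A *v x) = (\<Sum>i\<in>UNIV. \<Sum>j\<in>UNIV. A $ i $ j * (x $ j * grad p x $ i))" for x
    unfolding inner_vec_def matrix_vector_mult_def
    by (simp add: sum_distrib_left ac_simps)
  show "integrable lborel (\<lambda>x. grad p x \<bullet> (A *v x))"
    unfolding eq by (intro Bochner_Integration.integrable_sum integrable_mult_right ij)
  have "(LINT x|lborel. grad p x \<bullet> (A *v x))
      = (\<Sum>i\<in>UNIV. \<Sum>j\<in>UNIV. A $ i $ j * (LINT x|lborel. x $ j * grad p x $ i))"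
    unfolding eq by (simp add: ij)
  also have "\<dots> = - trace A"
    by (simp add: ij_eq trace_def if_distrib sum.delta sum_negf cong: if_cong)
  finally show "(LINT x|lborel. grad p x \<bullet> (A *v x)) = - trace A" .
qed

section \<open>Hoelder gradients and the log-likelihood of a rotation\<close>

lemma holder_gradient_bound:
  fixes v :: "real ^ 'n \<Rightarrow> real ^ 'n"
  assumes "bdd_above (holder_quotients \<alpha> v)"
  shows "norm (v y - v x) \<le> holder_seminorm \<alpha> v * norm (y - x) powr \<alpha>"
proof (cases "x = y")
  case False
  then have "norm (v y - v x) / norm (y - x) powr \<alpha> \<in> holder_quotients \<alpha> v"
    unfolding holder_quotients_def by blast
  then have "norm (v y - v x) / norm (y - x) powr \<alpha> \<le> holder_seminorm \<alpha> v"
    unfolding holder_seminorm_def using assms by (rule cSup_upper)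
  then show ?thesis using False by (simp add: divide_le_eq)
qed simp

lemma holder_seminorm_nonneg:
  fixes v :: "real ^ 'n \<Rightarrow> real ^ 'n"
  assumes "bdd_above (holder_quotients \<alpha> v)"
  shows "0 \<le> holder_seminorm \<alpha> v"
proof -
  \<comment> \<open>Two points at distance 1 are chosen so that the power of the distance is
    1.\<close>
  have "0 \<le> norm (v (axis undefined 1) - v 0)" by simp
  also have "\<dots> \<le> holder_seminorm \<alpha> v * norm (axis undefined 1 - 0 :: real ^ 'n) powr \<alpha>"
    by (rule holder_gradient_bound[OF assms])
  finally show ?thesis by simp
qed

text \<open>The mean value theorem expresses the increment through the gradient at a point of the
  segment, which is no farther from \<open>x\<close> than \<open>y\<close> is. Integrating along the
  segment would improve the constant by the factor 1 / (1 + \<alpha>); the cruder one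
  suffices.\<close>

lemma holder_taylor:
  fixes f :: "real ^ 'n \<Rightarrow> real"
  assumes f: "Ck 1 f" and \<alpha>: "0 < \<alpha>" and bdd: "bdd_above (holder_quotients \<alpha> (grad f))"
  shows "\<bar>f y - f x - grad f x \<bullet> (y - x)\<bar>
    \<le> holder_seminorm \<alpha> (grad f) * norm (y - x) powr (1 + \<alpha>)"
proof -
  let ?v = "y - x" and ?L = "holder_seminorm \<alpha> (grad f)"
  have "\<exists>z>0. z < 1 \<and> f (x + 1 *\<^sub>R ?v) - f (x + 0 *\<^sub>R ?v) = (1 - 0) * (?v \<bullet> grad f (x + z *\<^sub>R ?v))"
    by (rule MVT2) (auto intro: GDERIV_line Ck_1_grad f)
  then obtain z where z: "0 < z" "z < 1" "f y - f x = ?v \<bullet> grad f (x + z *\<^sub>R ?v)"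
    by auto
  have "\<bar>f y - f x - grad f x \<bullet> ?v\<bar> = \<bar>(grad f (x + z *\<^sub>R ?v) - grad f x) \<bullet> ?v\<bar>"
    by (simp add: z inner_diff_left inner_diff_right inner_commute)
  also have "\<dots> \<le> norm (grad f (x + z *\<^sub>R ?v) - grad f x) * norm ?v"
    by (rule Cauchy_Schwarz_ineq2)
  also have "\<dots> \<le> (?L * norm (z *\<^sub>R ?v) powr \<alpha>) * norm ?v"
    using holder_gradient_bound[OF bdd, of "x + z *\<^sub>R ?v" x] by (intro mult_right_mono) simp_all
  also have "\<dots> \<le> (?L * norm ?v powr \<alpha>) * norm ?v"
    using z \<alpha> holder_seminorm_nonneg[OF bdd]
    by (intro mult_right_mono mult_left_mono powr_mono2) (auto simp: mult_left_le_one_le)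
  also have "\<dots> = ?L * norm ?v powr (1 + \<alpha>)"
    by (simp add: powr_add)
  finally show ?thesis .
qed

lemma grad_neg_log:
  assumes "GDERIV p x :> D" "0 < p x"
  shows "grad (neg_log p) x = - (1 / p x) *\<^sub>R D"
proof (rule grad_eqI)
  have "GDERIV (\<lambda>x. ln (p x)) x :> (1 / p x) *\<^sub>R D"
    by (rule GDERIV_DERIV_compose[OF assms(1)]) (use assms(2) in \<open>auto intro!: derivative_eq_intros\<close>)
  from GDERIV_minus[OF this]
  show "GDERIV (neg_log p) x :> - (1 / p x) *\<^sub>R D"
    by (simp add: neg_log_def[abs_def])
qed

lemma trace_orthogonal_matrix_le:
  fixes R :: "real ^ 'n ^ 'n"
  assumes "orthogonal_matrix R"
  shows "trace R \<le> real CARD('n)"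
proof -
  have "R $ i $ i \<le> 1" for i
  proof -
    have "R $ i $ i = row i R $ i" by (simp add: row_def)
    also have "\<dots> \<le> norm (row i R)" by (rule order_trans[OF abs_ge_self component_le_norm_cart])
    finally show ?thesis using norm_row_orthogonal_matrix[OF assms] by simp
  qed
  then have "trace R \<le> (\<Sum>i\<in>(UNIV::'n set). 1)"
    unfolding trace_def by (intro sum_mono)
  then show ?thesis by simp
qed

lemma rotation_log_likelihood:
  fixes p :: "real ^ 'n \<Rightarrow> real" and R :: "real ^ 'n ^ 'n"
  assumes p: "is_density p" and S1: "smoothness_S1 \<alpha> p" and R: "orthogonal_matrix R"
  defines "L \<equiv> holder_seminorm \<alpha> (grad (neg_log p))"
  shows "integrable lborel (\<lambda>x. p x * (neg_log p (R *v x) - neg_log p x))"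
    and "(LINT x|lborel. p x * (neg_log p (R *v x) - neg_log p x))
      \<le> L * (LINT x|lborel. p x * norm (R *v x - x) powr (1 + \<alpha>))"
    and "integrable lborel (\<lambda>x. p x * norm (R *v x - x) powr (1 + \<alpha>))"
proof -
  have S: "finite_second_moments p" "Ck 1 p" "integrable lborel (\<lambda>x. norm x * norm (grad p x))"
    "\<And>x. 0 < p x" "0 < \<alpha>" "\<alpha> \<le> 1" "Ck 1 (neg_log p)"
    "bdd_above (holder_quotients \<alpha> (grad (neg_log p)))"
    using S1 by (auto simp: smoothness_S1_def)
  have [measurable]: "p \<in> borel_measurable borel" by (rule is_density_measurable[OF p])
  have [measurable]: "neg_log p \<in> borel_measurable borel" unfolding neg_log_def by measurable
  let ?A = "R - mat 1"
  have A: "?A *v x = R *v x - x" for x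
    by (simp add: matrix_vector_mult_diff_rdistrib)
  define r where "r x = p x * norm (R *v x - x) powr (1 + \<alpha>)" for x
  have nR: "norm (R *v x - x) \<le> 2 * norm x" for x
    using norm_triangle_ineq4[of "R *v x" x] norm_orthogonal_matrix[OF R, of x] by simp
  show r: "integrable lborel (\<lambda>x. p x * norm (R *v x - x) powr (1 + \<alpha>))"
  proof (rule Bochner_Integration.integrable_bound[where f="\<lambda>x. p x + 4 * ((norm x)\<^sup>2 * p x)"])
    show "integrable lborel (\<lambda>x. p x + 4 * ((norm x)\<^sup>2 * p x))"
      using p S(1) by (simp add: is_density_integrable finite_second_moments_def)
    show "AE x in lborel. norm (p x * norm (R *v x - x) powr (1 + \<alpha>)) \<le> norm (p x + 4 * ((norm x)\<^sup>2 * p x))"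
    proof (rule AE_I2)
      fix x
      let ?n = "norm (R *v x - x)"
      have "?n powr (1 + \<alpha>) \<le> 1 + ?n\<^sup>2"
      proof (cases "?n \<le> 1")
        case True
        then have "?n powr (1 + \<alpha>) \<le> 1" using S by (intro powr_le1) auto
        then show ?thesis by (smt (verit) zero_le_power2)
      next
        case False
        then have "?n powr (1 + \<alpha>) \<le> ?n powr 2" using S by (intro powr_mono) auto
        then show ?thesis using False by (simp add: powr_numeral)
      qed
      also have "?n\<^sup>2 \<le> (2 * norm x)\<^sup>2" by (intro power_mono nR) simp
      finally have "?n powr (1 + \<alpha>) \<le> 1 + 4 * (norm x)\<^sup>2" by (simp add: power_mult_distrib)
      from mult_left_mono[OF this is_density_nonneg[OF p, of x]]
      show "norm (p x * ?n powr (1 + \<alpha>)) \<le> norm (p x + 4 * ((norm x)\<^sup>2 * p x))"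
        using is_density_nonneg[OF p, of x] by (simp add: algebra_simps)
    qed
  qed measurable
  \<comment> \<open>Multiplication by \<open>p\<close> removes the denominator in the gradient of
    the logarithm. The first order term thereby becomes linear in \<open>grad p\<close> and open to
    integration by parts.\<close>
  have g: "p x *\<^sub>R grad (neg_log p) x = - grad p x" for x
    using grad_neg_log[OF Ck_1_grad(1)[OF S(2)] S(4), of x] S(4)[of x] by simp
  have bound: "\<bar>p x * (neg_log p (R *v x) - neg_log p x) + grad p x \<bullet> (?A *v x)\<bar> \<le> L * r x" for x
  proof -
    have "p x * (neg_log p (R *v x) - neg_log p x) + grad p x \<bullet> (?A *v x)
        = p x * (neg_log p (R *v x) - neg_log p x) - (p x *\<^sub>R grad (neg_log p) x) \<bullet> (?A *v x)"
      unfolding g by simp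
    also have "\<dots> = p x * (neg_log p (R *v x) - neg_log p x - grad (neg_log p) x \<bullet> (R *v x - x))"
      unfolding A by (simp add: algebra_simps)
    also have "\<bar>\<dots>\<bar> = p x * \<bar>neg_log p (R *v x) - neg_log p x - grad (neg_log p) x \<bullet> (R *v x - x)\<bar>"
      using S(4)[of x] by (simp add: abs_mult)
    also have "\<dots> \<le> p x * (L * norm (R *v x - x) powr (1 + \<alpha>))"
      unfolding L_def using S(4)[of x] by (intro mult_left_mono holder_taylor S) auto
    finally show ?thesis by (simp add: r_def mult.left_commute)
  qed
  note gl = integral_grad_linear[OF p S(1-3), of ?A]
  have [measurable]: "grad p \<in> borel_measurable borel"
    by (rule borel_measurable_continuous_onI[OF Ck_1_grad(2)[OF S(2)]])
  have r': "integrable lborel r" using r by (simp add: r_def[abs_def])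
  \<comment> \<open>The remainder is dominated by \<open>L * r x\<close> and the first order term is
    integrable, so the difference of the two logarithms is integrable without treating either
    logarithm alone.\<close>
  have "integrable lborel (\<lambda>x. p x * (neg_log p (R *v x) - neg_log p x) + grad p x \<bullet> (?A *v x))"
  proof (rule Bochner_Integration.integrable_bound[where f="\<lambda>x. L * r x"])
    show "AE x in lborel. norm (p x * (neg_log p (R *v x) - neg_log p x) + grad p x \<bullet> (?A *v x)) \<le> norm (L * r x)"
      using bound by (intro AE_I2) (smt (verit) real_norm_def)
  qed (use r' in auto)
  from Bochner_Integration.integrable_diff[OF this gl(1)]
  show i: "integrable lborel (\<lambda>x. p x * (neg_log p (R *v x) - neg_log p x))" by simp
  have "(LINT x|lborel. p x * (neg_log p (R *v x) - neg_log p x)) \<le> (LINT x|lborel. L * r x - grad p x \<bullet> (?A *v x))"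
  proof (rule integral_mono[OF i])
    show "integrable lborel (\<lambda>x. L * r x - grad p x \<bullet> (?A *v x))"
      using r' gl(1) by simp
    show "p x * (neg_log p (R *v x) - neg_log p x) \<le> L * r x - grad p x \<bullet> (?A *v x)" for x
      using bound[of x] by linarith
  qed
  also have "\<dots> = L * (LINT x|lborel. r x) + trace ?A"
    using r' gl by simp
  also have "trace ?A \<le> 0"
    using trace_orthogonal_matrix_le[OF R] by (simp add: trace_sub trace_I)
  finally show "(LINT x|lborel. p x * (neg_log p (R *v x) - neg_log p x))
      \<le> L * (LINT x|lborel. p x * norm (R *v x - x) powr (1 + \<alpha>))"
    by (simp add: r_def)
qed

section \<open>Marginals along rotated directions\<close>

lemma ln_ge_1_minus_inverse:
  fixes t :: real
  assumes "0 < t"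
  shows "1 - 1 / t \<le> ln t"
  using ln_le_minus_one[of "1 / t"] assms by (simp add: ln_div)

lemma AE_law_proj_rows:
  fixes p :: "real ^ 'n \<Rightarrow> real"
  assumes p: "is_density p" and V: "orthogonal_matrix V"
    and P: "AE t in law (proj_rows p V i). P t"
  shows "AE x in law p. P (row i V \<bullet> x)"
proof -
  have "law (proj_rows p V i) = distr (law p) borel (\<lambda>x. row i V \<bullet> x)"
    unfolding proj_rows_def by (rule law_proj_density(1)[OF p norm_row_orthogonal_matrix[OF V]])
  with P have "AE t in distr (law p) borel (\<lambda>x. row i V \<bullet> x). P t"
    by (simp only:)
  then show ?thesis by (rule AE_distrD[rotated]) measurable
qed

text \<open>Under \<open>p\<close> the projection \<open>row i V \<bullet> x\<close> has density
  \<open>u\<close>, so the integral is that of \<open>v\<close> over the set where \<open>u\<close>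
  is nonzero. Mass of \<open>v\<close> on the zeros of \<open>u\<close> is lost, as division by zero
  gives 0; hence an inequality.\<close>

lemma integral_density_ratio:
  fixes p :: "real ^ 'n \<Rightarrow> real" and i :: 'n
  assumes p: "is_density p" and V: "orthogonal_matrix V" and v: "is_density v"
  defines "u \<equiv> proj_rows p V i"
  shows "integrable lborel (\<lambda>x. p x * (v (row i V \<bullet> x) / u (row i V \<bullet> x)))"
    and "(LINT x|lborel. p x * (v (row i V \<bullet> x) / u (row i V \<bullet> x))) \<le> 1"
proof -
  have u: "is_density u" unfolding u_def by (rule is_density_proj_rows[OF p V])
  have [measurable]: "p \<in> borel_measurable borel" "u \<in> borel_measurable borel" "v \<in> borel_measurable borel"
    using p u v by (auto dest: is_density_measurable)
  let ?f = "\<lambda>x. p x * (v (row i V \<bullet> x) / u (row i V \<bullet> x))"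
  have nn: "0 \<le> ?f x" for x using p u v by (simp add: is_density_nonneg)
  have "(\<integral>\<^sup>+x. ennreal (?f x) \<partial>lborel) = (\<integral>\<^sup>+x. ennreal (v (row i V \<bullet> x) / u (row i V \<bullet> x)) \<partial>law p)"
    by (subst nn_integral_law)
       (auto intro!: nn_integral_cong ennreal_mult simp: p u v is_density_nonneg
         simp del: times_divide_eq_right)
  also have "\<dots> = (\<integral>\<^sup>+t. ennreal (v t / u t) \<partial>distr (law p) borel (\<lambda>x. row i V \<bullet> x))"
    by (subst nn_integral_distr) auto
  also have "\<dots> = (\<integral>\<^sup>+t. ennreal (v t / u t) \<partial>law u)"
    using law_proj_density(1)[OF p norm_row_orthogonal_matrix[OF V], of i]
    by (simp add: u_def proj_rows_def)
  also have "\<dots> = (\<integral>\<^sup>+t. ennreal (u t) * ennreal (v t / u t) \<partial>lborel)"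
    by (subst nn_integral_law) auto
  also have "\<dots> \<le> (\<integral>\<^sup>+t. ennreal (v t) \<partial>lborel)"
    using u v by (intro nn_integral_mono)
      (auto simp: ennreal_mult'[symmetric] is_density_nonneg)
  also have "\<dots> = 1" by (rule is_density_nn_integral[OF v])
  finally have le: "(\<integral>\<^sup>+x. ennreal (?f x) \<partial>lborel) \<le> 1" .
  show i: "integrable lborel ?f"
    by (rule integrableI_nonneg) (use le nn in \<open>auto simp: top_unique less_top[symmetric]\<close>)
  have "ennreal (LINT x|lborel. ?f x) \<le> 1"
    using le nn_integral_eq_integral[OF i] nn by simp
  then show "(LINT x|lborel. ?f x) \<le> 1" by (simp add: ennreal_le_1)
qed

text \<open>With \<open>R = transpose W ** V\<close> this is \<open>W ** R = V\<close> read row by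
  row: precomposing with \<open>R\<close> turns a product along the rows of \<open>W\<close> into
  one along the rows of \<open>V\<close> with the same factors.\<close>

lemma row_inner_transpose_mult:
  fixes W V :: "real ^ 'n ^ 'n"
  assumes "orthogonal_matrix W"
  shows "row i W \<bullet> ((transpose W ** V) *v x) = row i V \<bullet> x"
  using orthogonal_matrix_transpose_cancel(1)[OF assms]
  by (simp add: matrix_vector_mult_row[symmetric] matrix_vector_mul_assoc[symmetric]
      del: transpose_matrix_vector)

lemma prod_rows_orthogonal:
  fixes W V :: "real ^ 'n ^ 'n"
  assumes "orthogonal_matrix W"
  shows "prod_rows W f ((transpose W ** V) *v x) = prod_rows V f x"
  unfolding prod_rows_def row_inner_transpose_mult[OF assms] ..

lemma orthogonal_matrix_transpose_mult:
  fixes W V :: "real ^ 'n ^ 'n"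
  shows "orthogonal_matrix W \<Longrightarrow> orthogonal_matrix V \<Longrightarrow> orthogonal_matrix (transpose W ** V)"
  by (intro orthogonal_matrix_mul) (simp_all add: orthogonal_matrix_transpose)

text \<open>The product \<open>prod_rows V (proj_rows p V)\<close> of the marginals along the rows of \<open>V\<close> is closer to \<open>p\<close>
  in relative entropy than any other product along these rows, in particular than the rotated
  density. Working with the pointwise bounds \<open>exp t \<ge> 1 + t\<close> and \<open>ln t \<ge> 1 - 1 / t\<close> avoids
  any integrability requirement on the logarithms of the marginals.\<close>

lemma hellinger_sq_marginals_le_log_likelihood:
  fixes p :: "real ^ 'n \<Rightarrow> real"
  assumes p: "is_density p" and pos: "\<And>x. 0 < p x"
    and W: "unmixing_matrix p W" and V: "orthogonal_matrix V"
  defines "R \<equiv> transpose W ** V"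
  assumes i: "integrable lborel (\<lambda>x. p x * (neg_log p (R *v x) - neg_log p x))"
  shows "hellinger_sq p (prod_rows V (proj_rows p V))
    \<le> (LINT x|lborel. p x * (neg_log p (R *v x) - neg_log p x)) / 2"
proof -
  have W': "orthogonal_matrix W" using W by (simp add: unmixing_matrix_def)
  have R: "orthogonal_matrix R"
    unfolding R_def by (rule orthogonal_matrix_transpose_mult[OF W' V])
  let ?u = "proj_rows p V" and ?v = "proj_rows p W"
  let ?pt = "prod_rows V ?u"
  have u: "is_density (?u i)" and v: "is_density (?v i)" for i
    using is_density_proj_rows p V W' by auto
  have pt: "is_density ?pt" by (rule is_density_prod_rows[OF V u])
  let ?r = "\<lambda>i x. p x * (?v i (row i V \<bullet> x) / ?u i (row i V \<bullet> x))"
  note ratio = integral_density_ratio[OF p V v]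
  let ?k = "\<lambda>x. p x * (neg_log p (R *v x) - neg_log p x)"
  have "AE x in lborel. p x = prod_rows W ?v x"
    by (rule law_eq_iff[OF p is_density_prod_rows[OF W' v] law_unmixing_matrix[OF p W]])
  from AE_lborel_orthogonal[OF R this]
  have q: "AE x in lborel. p (R *v x) = prod_rows V ?v x"
    unfolding R_def by (simp add: prod_rows_orthogonal[OF W'])
  have "AE x in law p. 0 < ?u i (row i V \<bullet> x)" for i
    by (rule AE_law_proj_rows[OF p V]) (simp add: AE_law u)
  \<comment> \<open>As \<open>p\<close> is positive everywhere, null sets of its law are Lebesgue
    null sets, so the ratios below have nonzero denominators almost everywhere.\<close>
  then have u0: "AE x in lborel. \<forall>i. 0 < ?u i (row i V \<bullet> x)"
    by (intro eventually_all_finite) (simp add: AE_law p pos)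
  \<comment> \<open>The affinity integrand is \<open>p x * sqrt (?pt x / p x)\<close>, bounded below
    through the logarithm of the ratio. That logarithm is split at \<open>p (R *v x)\<close>: one
    part is a sum of logarithms of marginal ratios, the other is minus the increment of
    \<open>neg_log p\<close>.\<close>
  have "AE x in lborel. p x + 1/2 * ((\<Sum>i\<in>UNIV. p x - ?r i x) - ?k x) \<le> sqrt (p x) * sqrt (?pt x)"
    using q u0
  proof eventually_elim
    case (elim x)
    let ?a = "\<lambda>i. ?u i (row i V \<bullet> x)" and ?b = "\<lambda>i. ?v i (row i V \<bullet> x)"
    have a: "0 < ?a i" for i using elim by simp
    have "0 < (\<Prod>i\<in>UNIV. ?b i)"
      using elim(1) pos[of "R *v x"] by (simp add: prod_rows_def)
    then have "(\<Prod>i\<in>UNIV. ?b i) \<noteq> 0" by (metis less_irrefl)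
    then have "?b i \<noteq> 0" for i
      using prod_zero_iff[of UNIV ?b] by simp
    then have b: "0 < ?b i" for i
      using is_density_nonneg[OF v[of i], of "row i V \<bullet> x"] order_le_neq_trans by metis
    have ptx: "?pt x = (\<Prod>i\<in>UNIV. ?a i)" by (simp add: prod_rows_def)
    have pt0: "0 < ?pt x" unfolding ptx by (intro prod_pos) (simp add: a)
    have "(\<Sum>i\<in>UNIV. 1 - ?b i / ?a i) \<le> (\<Sum>i\<in>UNIV. ln (?a i) - ln (?b i))"
    proof (rule sum_mono)
      fix i
      show "1 - ?b i / ?a i \<le> ln (?a i) - ln (?b i)"
        using ln_ge_1_minus_inverse[of "?a i / ?b i"] a[of i] b[of i] by (simp add: ln_div)
    qed
    also have "\<dots> = ln (?pt x) - ln (p (R *v x))"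
      unfolding ptx elim(1) prod_rows_def using a b by (simp add: sum_subtractf ln_prod less_imp_neq[symmetric])
    finally have 1: "(\<Sum>i\<in>UNIV. 1 - ?b i / ?a i) \<le> ln (?pt x) - ln (p (R *v x))" .
    \<comment> \<open>Writing the root as an exponential of half the logarithm prepares the bound
      \<open>exp t \<ge> 1 + t\<close>; the half is the final factor 1/2.\<close>
    have "sqrt (?pt x / p x) = exp (ln (?pt x / p x) / 2)"
      using pt0 pos[of x] by (simp add: ln_sqrt[symmetric])
    then have "1 + ln (?pt x / p x) / 2 \<le> sqrt (?pt x / p x)"
      using exp_ge_add_one_self by metis
    then have "1 + (ln (?pt x) - ln (p x)) / 2 \<le> sqrt (?pt x / p x)"
      using pt0 pos[of x] by (simp add: ln_div)
    with 1 have "1 + 1/2 * ((\<Sum>i\<in>UNIV. 1 - ?b i / ?a i) - (neg_log p (R *v x) - neg_log p x)) \<le> sqrt (?pt x / p x)"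
      unfolding neg_log_def by argo
    from mult_left_mono[OF this less_imp_le[OF pos[of x]]]
    have "p x + 1/2 * ((\<Sum>i\<in>UNIV. p x - ?r i x) - ?k x) \<le> p x * sqrt (?pt x / p x)"
      by (simp add: algebra_simps sum_distrib_left sum_subtractf)
    also have "\<dots> = sqrt (p x) * sqrt (?pt x)"
      using pos[of x] by (simp add: real_sqrt_divide field_simps)
    finally show ?case .
  qed
  moreover have "integrable lborel (\<lambda>x. p x + 1/2 * ((\<Sum>i\<in>UNIV. p x - ?r i x) - ?k x))"
    by (intro Bochner_Integration.integrable_add integrable_mult_right Bochner_Integration.integrable_diff
        Bochner_Integration.integrable_sum is_density_integrable[OF p] ratio i)
  ultimately have "(LINT x|lborel. p x + 1/2 * ((\<Sum>i\<in>UNIV. p x - ?r i x) - ?k x))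
      \<le> (LINT x|lborel. sqrt (p x) * sqrt (?pt x))"
    by (intro integral_mono_AE integrable_sqrt_mult p pt)
  also have "(LINT x|lborel. p x + 1/2 * ((\<Sum>i\<in>UNIV. p x - ?r i x) - ?k x))
      = 1 + 1/2 * ((\<Sum>i\<in>UNIV. 1 - (LINT x|lborel. ?r i x)) - (LINT x|lborel. ?k x))"
    by (simp add: i ratio p is_density_integrable is_density_integral del: times_divide_eq_right)
  finally have "1 + 1/2 * ((\<Sum>i\<in>UNIV. 1 - (LINT x|lborel. ?r i x)) - (LINT x|lborel. ?k x))
      \<le> (LINT x|lborel. sqrt (p x) * sqrt (?pt x))" .
  \<comment> \<open>This replaces the nonnegativity of relative entropy between the two products:
    every ratio has integral at most 1 against \<open>p\<close>, so the sum may be dropped.\<close>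
  moreover have "0 \<le> (\<Sum>i\<in>UNIV. 1 - (LINT x|lborel. ?r i x))"
    by (intro sum_nonneg) (use ratio(2) in \<open>simp only: diff_ge_0_iff_ge\<close>)
  ultimately show ?thesis
    unfolding hellinger_sq_eq_affinity[OF p pt] by argo
qed

section \<open>Test functions\<close>

text \<open>For \<open>k = 0\<close> this is \<open>exp (- 1 / t)\<close> on the positive half-line; the family is closed under
  differentiation up to linear combinations.\<close>

definition exp_bump :: "nat \<Rightarrow> real \<Rightarrow> real" where
  "exp_bump k t = (if t \<le> 0 then 0 else inverse t ^ k / exp (inverse t))"

lemma exp_bump_tendsto_0: "(exp_bump k \<longlongrightarrow> 0) (at_right 0)"
proof -
  have "((\<lambda>t::real. inverse t ^ k / exp (inverse t)) \<longlongrightarrow> 0) (at_right 0)"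
    by (rule filterlim_compose[OF tendsto_power_div_exp_0 filterlim_inverse_at_top_right])
  then show ?thesis
    by (rule Lim_transform_eventually) (auto simp: exp_bump_def eventually_at_filter)
qed

lemma exp_bump_deriv:
  "(exp_bump k has_real_derivative exp_bump (k + 2) t - real k * exp_bump (k + 1) t) (at t)"
proof -
  consider "t > 0" | "t < 0" | "t = 0" by linarith
  then show ?thesis
  proof cases
    case 1
    define y where "y = inverse t"
    have a: "(inverse has_real_derivative - (y\<^sup>2)) (at t)"
      using DERIV_inverse[of t] 1 by (simp add: y_def power2_eq_square)
    \<comment> \<open>For \<open>k = 0\<close> the truncated exponent \<open>k - 1\<close> is
      harmless, as it occurs with the factor 0.\<close>
    have b: "((\<lambda>t. inverse t ^ k) has_real_derivative real k * (- (y\<^sup>2) * y ^ (k - 1))) (at t)"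
      using DERIV_power[OF a, of k] by (simp add: y_def)
    have c: "((\<lambda>t. exp (- inverse t)) has_real_derivative exp (- y) * y\<^sup>2) (at t)"
      using DERIV_chain2[OF DERIV_exp DERIV_minus[OF a]] by (simp add: y_def)
    have "real k * (- (y\<^sup>2) * y ^ (k - 1)) * exp (- y) + exp (- y) * y\<^sup>2 * y ^ k
        = exp_bump (k + 2) t - real k * exp_bump (k + 1) t"
      using 1 by (cases k)
        (simp_all add: exp_bump_def y_def[symmetric] exp_minus power2_eq_square divide_inverse algebra_simps)
    with DERIV_mult[OF b c] have "((\<lambda>t. inverse t ^ k * exp (- inverse t)) has_real_derivative
        exp_bump (k + 2) t - real k * exp_bump (k + 1) t) (at t)"
      by (simp add: y_def)
    then show ?thesis
      by (rule has_field_derivative_transform_within_open[where S="{0<..}"])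
         (use 1 in \<open>auto simp: exp_bump_def exp_minus field_simps\<close>)
  next
    case 2
    have "((\<lambda>t. 0) has_real_derivative exp_bump (k + 2) t - real k * exp_bump (k + 1) t) (at t)"
      using 2 by (simp add: exp_bump_def)
    then show ?thesis
      by (rule has_field_derivative_transform_within_open[where S="{..<0}"])
         (use 2 in \<open>auto simp: exp_bump_def\<close>)
  next
    case 3
    \<comment> \<open>To the right of 0 the difference quotient is \<open>exp_bump (Suc k)\<close>
      itself, so flatness at 0 passes from one member of the family to the next.\<close>
    have "((\<lambda>h. exp_bump k h / h) \<longlongrightarrow> 0) (at_right 0)"
      using exp_bump_tendsto_0[of "Suc k"]
      by (rule Lim_transform_eventually)
         (auto simp: exp_bump_def eventually_at_filter field_simps)
    moreover have "((\<lambda>h. exp_bump k h / h) \<longlongrightarrow> 0) (at_left 0)"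
      by (rule Lim_transform_eventually[OF tendsto_const])
         (auto simp: exp_bump_def eventually_at_filter)
    ultimately have "((\<lambda>h. exp_bump k h / h) \<longlongrightarrow> 0) (at 0)"
      by (simp add: filterlim_split_at)
    then show ?thesis
      using 3 by (simp add: DERIV_def exp_bump_def)
  qed
qed

lemma exp_bump_bounds: "0 \<le> exp_bump 0 t" "exp_bump 0 t \<le> 1"
  by (auto simp: exp_bump_def divide_le_eq)

text \<open>Rescaling steepens the bump into the indicator of the open positive half-line; products
  of such limits give indicators of open boxes.\<close>

lemma exp_bump_scaled_tendsto:
  "(\<lambda>n. exp_bump 0 (real n * t)) \<longlonglongrightarrow> (if 0 < t then 1 else 0)"
proof (cases "0 < t")
  case True
  have "(\<lambda>n. exp (- inverse (real n) * inverse t)) \<longlonglongrightarrow> exp (- 0 * inverse t)"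
    by (intro tendsto_intros lim_inverse_n)
  then have "(\<lambda>n. exp_bump 0 (real n * t)) \<longlonglongrightarrow> exp (- 0 * inverse t)"
  proof (rule Lim_transform_eventually)
    show "\<forall>\<^sub>F n in sequentially. exp (- inverse (real n) * inverse t) = exp_bump 0 (real n * t)"
      using eventually_gt_at_top[of 0]
      by eventually_elim (use True in \<open>auto simp: exp_bump_def exp_minus inverse_eq_divide zero_less_mult_iff not_le\<close>)
  qed
  then show ?thesis using True by simp
next
  case False
  then have "exp_bump 0 (real n * t) = 0" for n
    by (simp add: exp_bump_def mult_nonneg_nonpos)
  then show ?thesis using False by simp
qed

section \<open>Closure properties of the classes of smooth functions\<close>

lemma Ck_SucI:
  assumes "\<And>x. GDERIV f x :> D x" "\<And>i. Ck k (\<lambda>x. D x $ i)"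
  shows "Ck (Suc k) f"
proof -
  have "grad f = D" using grad_eqI[OF assms(1)] by auto
  then show ?thesis using assms by auto
qed

lemma Ck_Suc_GDERIV: "Ck (Suc k) f \<Longrightarrow> GDERIV f x :> grad f x"
  by (auto intro: GDERIV_grad)

lemma GDERIV_continuous_on:
  assumes "\<And>x. GDERIV f x :> D x"
  shows "continuous_on UNIV f"
  using assms unfolding gderiv_def
  by (meson continuous_at_imp_continuous_on has_derivative_continuous)

text \<open>The product rule leaves one factor undifferentiated; this supplies its smoothness at the
  lower order in the induction for products.\<close>

lemma Ck_SucD: "Ck (Suc k) f \<Longrightarrow> Ck k f"
proof (induction k arbitrary: f)
  case 0
  then show ?case using GDERIV_continuous_on[OF Ck_Suc_GDERIV[OF 0]] by simp
next
  case (Suc k)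
  show ?case
    by (rule Ck_SucI[OF Ck_Suc_GDERIV[OF Suc.prems]]) (rule Suc.IH, use Suc.prems in simp)
qed

lemma Ck_const: "Ck k (\<lambda>x. c)"
proof (induction k arbitrary: c)
  case (Suc k)
  show ?case by (rule Ck_SucI[where D="\<lambda>x. 0"]) (auto simp: GDERIV_const Suc)
qed simp

lemma Ck_add: "Ck k f \<Longrightarrow> Ck k g \<Longrightarrow> Ck k (\<lambda>x. f x + g x)"
proof (induction k arbitrary: f g)
  case 0
  then show ?case by (simp add: continuous_on_add)
next
  case (Suc k)
  show ?case
  proof (rule Ck_SucI)
    show "GDERIV (\<lambda>x. f x + g x) x :> grad f x + grad g x" for x
      by (rule GDERIV_add[OF Ck_Suc_GDERIV[OF Suc.prems(1)] Ck_Suc_GDERIV[OF Suc.prems(2)]])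
    show "Ck k (\<lambda>x. (grad f x + grad g x) $ i)" for i
      using Suc.prems by (simp add: Suc.IH)
  qed
qed

lemma Ck_mult: "Ck k f \<Longrightarrow> Ck k g \<Longrightarrow> Ck k (\<lambda>x. f x * g x)"
proof (induction k arbitrary: f g)
  case 0
  then show ?case by (simp add: continuous_on_mult)
next
  case (Suc k)
  show ?case
  proof (rule Ck_SucI)
    show "GDERIV (\<lambda>x. f x * g x) x :> f x *\<^sub>R grad g x + g x *\<^sub>R grad f x" for x
      by (rule GDERIV_mult[OF Ck_Suc_GDERIV[OF Suc.prems(1)] Ck_Suc_GDERIV[OF Suc.prems(2)]])
    show "Ck k (\<lambda>x. (f x *\<^sub>R grad g x + g x *\<^sub>R grad f x) $ i)" for i
      using Suc.prems Ck_SucD[OF Suc.prems(1)] Ck_SucD[OF Suc.prems(2)]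
      by (simp add: Suc.IH Ck_add)
  qed
qed

lemma Ck_prod: "(\<And>i. i \<in> I \<Longrightarrow> Ck k (f i)) \<Longrightarrow> Ck k (\<lambda>x. \<Prod>i\<in>I. f i x)"
  by (induction I rule: infinite_finite_induct) (simp_all add: Ck_const Ck_mult)

text \<open>The induction on \<open>k\<close> runs over all \<open>m\<close> at once because
  differentiating raises \<open>m\<close>.\<close>

lemma Ck_exp_bump: "Ck k (\<lambda>x :: real ^ 'n. exp_bump m (c + s * x $ i))"
proof (induction k arbitrary: m)
  case 0
  have "continuous_on UNIV (exp_bump m)"
    using exp_bump_deriv by (meson DERIV_isCont continuous_at_imp_continuous_on)
  then show ?case
    by (auto intro!: continuous_on_compose2[of UNIV "exp_bump m"] continuous_intros)
next
  case (Suc k)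
  let ?b = "\<lambda>m (x :: real ^ 'n). exp_bump m (c + s * x $ i)"
  let ?D = "\<lambda>x. (?b (m + 2) x - real m * ?b (m + 1) x) *\<^sub>R (s *\<^sub>R axis i 1)"
  show ?case
  proof (rule Ck_SucI)
    fix x :: "real ^ 'n"
    have "GDERIV (\<lambda>x :: real ^ 'n. c + s * x $ i) x :> s *\<^sub>R axis i 1"
      unfolding gderiv_def
      by (auto intro!: derivative_eq_intros bounded_linear_imp_has_derivative bounded_linear_vec_nth
          simp: inner_axis)
    then show "GDERIV (?b m) x :> ?D x"
      by (rule GDERIV_DERIV_compose[OF _ exp_bump_deriv])
  next
    fix j
    have "Ck k (\<lambda>x. (s * axis i 1 $ j) * ?b (m + 2) x + (- real m * (s * axis i 1 $ j)) * ?b (m + 1) x)"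
      by (intro Ck_add Ck_mult Ck_const Suc)
    then show "Ck k (\<lambda>x. ?D x $ j)"
      by (simp add: algebra_simps)
  qed
qed

lemma Ck_translate: "Ck k f \<Longrightarrow> Ck k (\<lambda>x. f (x + a))"
proof (induction k arbitrary: f)
  case 0
  then show ?case
    by (auto intro!: continuous_on_compose2[of UNIV f] continuous_intros)
next
  case (Suc k)
  show ?case
  proof (rule Ck_SucI)
    fix x
    have "(f has_derivative (\<lambda>h. h \<bullet> grad f (x + a))) (at (x + a))"
      using Ck_Suc_GDERIV[OF Suc.prems] by (simp add: gderiv_def)
    then have "((\<lambda>x. f (x + a)) has_derivative (\<lambda>h. h \<bullet> grad f (x + a))) (at x)"
      by (rule has_derivative_compose[where g=f, rotated]) (auto intro!: derivative_eq_intros)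
    then show "GDERIV (\<lambda>x. f (x + a)) x :> grad f (x + a)"
      by (simp add: gderiv_def)
  next
    show "Ck k (\<lambda>x. grad f (x + a) $ i)" for i
      using Suc.IH[of "\<lambda>x. grad f x $ i"] Suc.prems by simp
  qed
qed

section \<open>Test functions and the fundamental lemma of the calculus of variations\<close>

lemma test_function_translate:
  assumes "test_function \<psi>"
  shows "test_function (\<lambda>x. \<psi> (x + a))"
proof -
  have "{x. \<psi> (x + a) \<noteq> 0} = (+) (- a) ` {x. \<psi> x \<noteq> 0}"
  proof safe
    fix x assume "\<psi> (x + a) \<noteq> 0"
    then show "x \<in> (+) (- a) ` {x. \<psi> x \<noteq> 0}"
      by (intro image_eqI[of _ _ "x + a"]) auto
  qed simp
  then show ?thesis
    using assms by (auto simp: test_function_def Ck_translate bounded_translation_minus)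
qed

text \<open>Each factor vanishes beyond one face of \<open>box a b\<close> and tends to 1 strictly
  inside it. The supports stay within the fixed box, so these are smooth approximations of its
  indicator from below.\<close>

definition box_bump :: "real ^ 'n \<Rightarrow> real ^ 'n \<Rightarrow> nat \<Rightarrow> real ^ 'n \<Rightarrow> real" where
  "box_bump a b n x = (\<Prod>i\<in>UNIV. exp_bump 0 (real n * (x $ i - a $ i)) * exp_bump 0 (real n * (b $ i - x $ i)))"

lemma test_function_box_bump: "test_function (box_bump a b n)"
  unfolding test_function_def
proof safe
  fix k
  have "Ck k (\<lambda>x. \<Prod>i\<in>UNIV. exp_bump 0 (- (real n * a $ i) + real n * x $ i)
      * exp_bump 0 (real n * b $ i + (- real n) * x $ i))"
    by (intro Ck_prod Ck_mult Ck_exp_bump)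
  then show "Ck k (box_bump a b n)"
    by (simp add: box_bump_def[abs_def] algebra_simps)
next
  have "{x. box_bump a b n x \<noteq> 0} \<subseteq> box a b"
  proof
    fix x assume "x \<in> {x. box_bump a b n x \<noteq> 0}"
    then have "\<forall>i. exp_bump 0 (real n * (x $ i - a $ i)) \<noteq> 0 \<and> exp_bump 0 (real n * (b $ i - x $ i)) \<noteq> 0"
      by (simp add: box_bump_def)
    then show "x \<in> box a b"
      by (auto simp: mem_box_cart exp_bump_def zero_less_mult_iff not_le split: if_splits)
  qed
  then show "compact (closure {x. box_bump a b n x \<noteq> 0})"
    using bounded_box bounded_subset compact_closure by blast
qed

lemma box_bump_tendsto: "(\<lambda>n. box_bump a b n x) \<longlonglongrightarrow> indicator (box a b) x"
proof -
  have "(\<lambda>n. box_bump a b n x) \<longlonglongrightarrow>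
      (\<Prod>i\<in>UNIV. (if 0 < x $ i - a $ i then 1 else 0) * (if 0 < b $ i - x $ i then 1 else 0))"
    unfolding box_bump_def by (intro tendsto_prod tendsto_mult exp_bump_scaled_tendsto)
  also have "(\<Prod>i\<in>UNIV. (if 0 < x $ i - a $ i then 1 else 0) * (if 0 < b $ i - x $ i then 1 else 0))
      = (indicator (box a b) x :: real)"
    by (auto simp: indicator_def mem_box_cart prod_zero_iff split: if_splits)
  finally show ?thesis .
qed

lemma box_bump_bounds: "0 \<le> box_bump a b n x" "box_bump a b n x \<le> 1"
  unfolding box_bump_def
  by (auto intro!: prod_nonneg prod_le_1 mult_le_one mult_nonneg_nonneg exp_bump_bounds)

lemma test_function_continuous: "test_function \<psi> \<Longrightarrow> continuous_on UNIV \<psi>"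
  using Ck.simps(1) unfolding test_function_def by blast

text \<open>\<open>ennreal\<close> cuts negative values off, so the densities \<open>F\<close> and
  \<open>- F\<close> define the positive and the negative part of the signed measure of
  \<open>F\<close>. They agree on boxes, hence everywhere, and two parts of which one is always 0
  can only agree if both are 0.\<close>

lemma AE_eq_0_if_boxes:
  fixes F :: "'a::euclidean_space \<Rightarrow> real"
  assumes F: "integrable lborel F" and box: "\<And>a b. (LINT x|lborel. indicator (box a b) x * F x) = 0"
  shows "AE x in lborel. F x = 0"
proof -
  have [measurable]: "F \<in> borel_measurable borel" using F by auto
  let ?P = "density lborel (\<lambda>x. ennreal (F x))" and ?N = "density lborel (\<lambda>x. ennreal (- F x))"
  have i': "integrable lborel (\<lambda>x. indicator (box a b) x * max 0 (G x))"
    if "integrable lborel G" for a b and G :: "'a \<Rightarrow> real"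
    using integrable_real_mult_indicator[of "box a b" lborel "\<lambda>x. max 0 (G x)"] that
    by (simp add: mult.commute)
  note i = i'[OF F] i'[OF Bochner_Integration.integrable_minus[OF F]]
  have "?P = ?N"
  proof (rule measure_eqI_box)
    show "finite_measure ?P"
    proof
      have "(\<integral>\<^sup>+x. ennreal (F x) \<partial>lborel) \<le> (\<integral>\<^sup>+x. ennreal (norm (F x)) \<partial>lborel)"
        by (intro nn_integral_mono ennreal_leI) simp
      also have "\<dots> < \<infinity>"
        using F by (simp add: integrable_iff_bounded)
      finally show "emeasure ?P (space ?P) \<noteq> \<infinity>"
        by (simp add: emeasure_density)
    qed
    fix a b :: 'a
    have pos: "emeasure (density lborel (\<lambda>x. ennreal (G x))) (box a b)
        = ennreal (LINT x|lborel. indicator (box a b) x * max 0 (G x))"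
      if [measurable]: "G \<in> borel_measurable borel"
        and "integrable lborel (\<lambda>x. indicator (box a b) x * max 0 (G x))" for G
    proof -
      have "emeasure (density lborel (\<lambda>x. ennreal (G x))) (box a b)
          = (\<integral>\<^sup>+x. ennreal (indicator (box a b) x * max 0 (G x)) \<partial>lborel)"
        by (subst emeasure_density)
           (auto intro!: nn_integral_cong simp: indicator_def max_def ennreal_neg)
      also have "\<dots> = ennreal (LINT x|lborel. indicator (box a b) x * max 0 (G x))"
        by (intro nn_integral_eq_integral that) auto
      finally show ?thesis .
    qed
    have "(LINT x|lborel. indicator (box a b) x * max 0 (F x)) - (LINT x|lborel. indicator (box a b) x * max 0 (- F x))
        = (LINT x|lborel. indicator (box a b) x * F x)"
      by (subst Bochner_Integration.integral_diff[symmetric, OF i])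
         (auto intro!: Bochner_Integration.integral_cong simp: max_def indicator_def)
    then have "(LINT x|lborel. indicator (box a b) x * max 0 (F x)) = (LINT x|lborel. indicator (box a b) x * max 0 (- F x))"
      by (simp add: box)
    then show "emeasure ?P (box a b) = emeasure ?N (box a b)"
      by (simp add: pos i)
  qed simp_all
  then have "AE x in lborel. ennreal (F x) = ennreal (- F x)"
    by (subst (asm) sigma_finite_measure.density_unique_iff[OF sigma_finite_lborel]) auto
  then show ?thesis
    by eventually_elim (metis (no_types, opaque_lifting) ennreal_eq_0_iff linorder_le_cases minus_le_iff neg_0_le_iff_le neg_le_0_iff_le order_antisym)
qed

text \<open>The functions \<open>box_bump a b n\<close> converge to the indicator of the box and are
  bounded by 1, so dominated convergence with majorant \<open>\<bar>F x\<bar>\<close> reduces the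
  claim to boxes.\<close>

lemma AE_eq_0_if_test_functions:
  fixes F :: "real ^ 'n \<Rightarrow> real"
  assumes F: "integrable lborel F"
    and test: "\<And>\<psi>. test_function \<psi> \<Longrightarrow> (LINT x|lborel. F x * \<psi> x) = 0"
  shows "AE x in lborel. F x = 0"
proof (rule AE_eq_0_if_boxes[OF F])
  fix a b :: "real ^ 'n"
  have [measurable]: "F \<in> borel_measurable borel" using F by auto
  have [measurable]: "box_bump a b n \<in> borel_measurable borel" for n
    by (intro borel_measurable_continuous_onI test_function_continuous test_function_box_bump)
  have "(\<lambda>n. LINT x|lborel. F x * box_bump a b n x) \<longlonglongrightarrow> (LINT x|lborel. F x * indicator (box a b) x)"
  proof (rule integral_dominated_convergence[where w="\<lambda>x. \<bar>F x\<bar>"])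
    show "AE x in lborel. (\<lambda>n. F x * box_bump a b n x) \<longlonglongrightarrow> F x * indicator (box a b) x"
      by (intro AE_I2 tendsto_intros box_bump_tendsto)
    show "AE x in lborel. norm (F x * box_bump a b n x) \<le> \<bar>F x\<bar>" for n
      using box_bump_bounds[of a b n] by (intro AE_I2) (simp add: abs_mult mult_left_le)
  qed (use F in auto)
  then show "(LINT x|lborel. indicator (box a b) x * F x) = 0"
    by (simp add: test test_function_box_bump LIMSEQ_const_iff mult.commute)
qed

section \<open>Translates and weak gradients\<close>

text \<open>A bound on the absolute integrals that is uniform in \<open>t\<close>, together with the
  finite length of the interval, gives absolute integrability on the product.\<close>

lemma Fubini_unit_interval:
  fixes K :: "real \<Rightarrow> 'a::euclidean_space \<Rightarrow> real"
  assumes [measurable]: "case_prod K \<in> borel_measurable (borel \<Otimes>\<^sub>M borel)"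
    and K: "\<And>t. integrable lborel (K t)" and C: "\<And>t. (LINT x|lborel. \<bar>K t x\<bar>) \<le> C"
  shows "(LINT x|lborel. LINT t|lborel. indicator {0..1} t * K t x)
    = (LINT t|lborel. indicator {0..1} t * (LINT x|lborel. K t x))"
proof -
  have [measurable]: "K t \<in> borel_measurable borel" for t using K[of t] by auto
  let ?F = "\<lambda>t x. indicator {0..1} t * K t x :: real"
  have "integrable (lborel \<Otimes>\<^sub>M lborel) (case_prod ?F)"
  proof (rule lborel_pair.Fubini_integrable)
    show "integrable lborel (\<lambda>t. LINT x|lborel. norm (case (t, x) of (t, x) \<Rightarrow> ?F t x))"
    proof (rule Bochner_Integration.integrable_bound[where f="\<lambda>t. indicator {0..1} t * C"])
      have "\<bar>LINT x|lborel. \<bar>K t x\<bar>\<bar> \<le> \<bar>C\<bar>" for t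
        using C[of t] by (simp add: order_trans[OF _ abs_ge_self])
      then show "AE t in lborel. norm (LINT x|lborel. norm (case (t, x) of (t, x) \<Rightarrow> ?F t x))
          \<le> norm (indicator {0..1} t * C)"
        by (intro AE_I2) (simp add: abs_mult mult_left_mono)
    qed auto
    show "AE t in lborel. integrable lborel (\<lambda>x. case (t, x) of (t, x) \<Rightarrow> ?F t x)"
      using K by (intro AE_I2) simp
  qed measurable
  from lborel_pair.Fubini_integral[OF this]
  have "(LINT x|lborel. LINT t|lborel. ?F t x) = (LINT t|lborel. LINT x|lborel. ?F t x)" .
  then show ?thesis using K by simp
qed

lemma integrable_mult_bounded:
  fixes h b :: "'a \<Rightarrow> real"
  assumes "integrable M h" and [measurable]: "b \<in> borel_measurable M" and "\<And>x. \<bar>b x\<bar> \<le> B"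
  shows "integrable M (\<lambda>x. h x * b x)" "(LINT x|M. \<bar>h x * b x\<bar>) \<le> B * (LINT x|M. \<bar>h x\<bar>)"
proof -
  have le: "\<bar>h x * b x\<bar> \<le> B * \<bar>h x\<bar>" for x
    using assms(3)[of x] by (simp add: abs_mult mult.commute mult_right_mono)
  show i: "integrable M (\<lambda>x. h x * b x)"
  proof (rule Bochner_Integration.integrable_bound[where f="\<lambda>x. B * \<bar>h x\<bar>"])
    show "AE x in M. norm (h x * b x) \<le> norm (B * \<bar>h x\<bar>)"
      using le by (intro AE_I2) (metis abs_ge_self order_trans real_norm_def)
  qed (use assms(1) in auto)
  have "(LINT x|M. \<bar>h x * b x\<bar>) \<le> (LINT x|M. B * \<bar>h x\<bar>)"
    by (intro integral_mono le) (use i assms(1) in auto)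
  then show "(LINT x|M. \<bar>h x * b x\<bar>) \<le> B * (LINT x|M. \<bar>h x\<bar>)" by simp
qed

text \<open>Both pairings are written as integrals over \<open>t\<close> of pairings with a
  translate. An identity known for each single translate can then be used under the integral over
  \<open>t\<close>.\<close>

lemma line_average_adjoint:
  fixes h b :: "'a::euclidean_space \<Rightarrow> real"
  assumes h: "integrable lborel h" and [measurable]: "b \<in> borel_measurable borel"
    and B: "\<And>x. \<bar>b x\<bar> \<le> B"
  shows "(LINT x|lborel. h x * line_average b v x)
      = (LINT t|lborel. indicator {0..1} t * (LINT x|lborel. h x * b (x + t *\<^sub>R v)))" (is ?A)
    and "(LINT x|lborel. line_average h v x * b x)
      = (LINT t|lborel. indicator {0..1} t * (LINT x|lborel. h (x + t *\<^sub>R v) * b x))" (is ?B)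
proof -
  have [measurable]: "h \<in> borel_measurable borel" using h by auto
  have "(LINT x|lborel. h x * line_average b v x)
      = (LINT x|lborel. LINT t|lborel. indicator {0..1} t * (h x * b (x + t *\<^sub>R v)))"
    unfolding line_average_def by (subst integral_mult_right_zero[symmetric]) (simp add: ac_simps)
  also have "\<dots> = (LINT t|lborel. indicator {0..1} t * (LINT x|lborel. h x * b (x + t *\<^sub>R v)))"
    by (rule Fubini_unit_interval[where C="B * (LINT x|lborel. \<bar>h x\<bar>)"])
       (auto intro!: integrable_mult_bounded h B)
  finally show ?A .
  have "(LINT x|lborel. line_average h v x * b x)
      = (LINT x|lborel. LINT t|lborel. indicator {0..1} t * (h (x + t *\<^sub>R v) * b x))"
    unfolding line_average_def by (subst integral_mult_left_zero[symmetric]) (simp add: ac_simps)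
  also have "\<dots> = (LINT t|lborel. indicator {0..1} t * (LINT x|lborel. h (x + t *\<^sub>R v) * b x))"
  proof (rule Fubini_unit_interval[where C="B * (LINT x|lborel. \<bar>h x\<bar>)"])
    fix t
    have 1: "integrable lborel (\<lambda>x. h (x + t *\<^sub>R v))"
      by (rule integrable_lborel_translation[OF h])
    show "integrable lborel (\<lambda>x. h (x + t *\<^sub>R v) * b x)"
      by (rule integrable_mult_bounded[OF 1 _ B]) measurable
    have "(LINT x|lborel. \<bar>h (x + t *\<^sub>R v) * b x\<bar>) \<le> B * (LINT x|lborel. \<bar>h (x + t *\<^sub>R v)\<bar>)"
      by (rule integrable_mult_bounded[OF 1 _ B]) measurable
    then show "(LINT x|lborel. \<bar>h (x + t *\<^sub>R v) * b x\<bar>) \<le> B * (LINT x|lborel. \<bar>h x\<bar>)"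
      using integral_lborel_translation[of "\<lambda>x. \<bar>h x\<bar>" "t *\<^sub>R v"] by simp
  qed measurable
  finally show ?B .
qed

lemma bounded_if_compact_support:
  fixes f :: "'a::euclidean_space \<Rightarrow> 'b::real_normed_vector"
  assumes "continuous_on UNIV f" "compact K" "\<And>x. x \<notin> K \<Longrightarrow> f x = 0"
  shows "\<exists>B. \<forall>x. norm (f x) \<le> B"
proof -
  have "compact (f ` K)"
    by (rule compact_continuous_image[OF continuous_on_subset[OF assms(1)] assms(2)]) simp
  then obtain B where "\<forall>y\<in>f ` K. norm y \<le> B"
    using compact_imp_bounded bounded_iff by metis
  then have "norm (f x) \<le> max B 0" for x
    by (cases "x \<in> K") (auto simp: assms(3) le_max_iff_disj)
  then show ?thesis by blast
qed

lemma test_function_facts: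
  assumes "test_function \<psi>"
  shows "\<And>x. GDERIV \<psi> x :> grad \<psi> x" "continuous_on UNIV (grad \<psi>)"
    "\<exists>B. \<forall>x. \<bar>\<psi> x\<bar> \<le> B" "\<exists>B. \<forall>x. norm (grad \<psi> x) \<le> B"
proof -
  have "Ck 1 \<psi>" using assms by (simp only: test_function_def)
  note G = Ck_1_grad[OF this]
  show "\<And>x. GDERIV \<psi> x :> grad \<psi> x" "continuous_on UNIV (grad \<psi>)" by (fact G)+
  let ?K = "closure {x. \<psi> x \<noteq> 0}"
  have K: "compact ?K" using assms by (simp only: test_function_def)
  have z: "\<psi> x = 0" if "x \<notin> ?K" for x
    using that closure_subset[of "{x. \<psi> x \<noteq> 0}"] by auto
  show "\<exists>B. \<forall>x. \<bar>\<psi> x\<bar> \<le> B"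
    using bounded_if_compact_support[OF test_function_continuous[OF assms] K z] by simp
  \<comment> \<open>Off the closed support \<psi> vanishes on a whole neighbourhood, so its
    derivative does too.\<close>
  have "grad \<psi> x = 0" if "x \<notin> ?K" for x
  proof (rule grad_eqI)
    have "((\<lambda>x. 0) has_derivative (\<lambda>h. 0)) (at x)" by simp
    then have "(\<psi> has_derivative (\<lambda>h. 0)) (at x)"
    proof (rule has_derivative_transform_within_open[where s="- ?K"])
      show "open (- ?K)" by (rule open_Compl[OF closed_closure])
      show "x \<in> - ?K" using that by (simp only: Compl_iff not_False_eq_True)
      show "0 = \<psi> y" if "y \<in> - ?K" for y
        using z[OF ComplD[OF that]] by (rule sym)
    qed
    then show "GDERIV \<psi> x :> 0" by (simp add: gderiv_def)
  qed
  with bounded_if_compact_support[OF G(2) K]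
  show "\<exists>B. \<forall>x. norm (grad \<psi> x) \<le> B" by blast
qed

text \<open>Local integrability speaks only of restrictions to compact sets. The function itself is
  the limit of its truncations to growing balls.\<close>

lemma locally_integrable_measurable:
  fixes g :: "'a::euclidean_space \<Rightarrow> 'b::euclidean_space"
  assumes "locally_integrable g"
  shows "g \<in> borel_measurable borel"
proof (rule borel_measurable_LIMSEQ_metric)
  have "integrable lborel (\<lambda>x. indicator (cball 0 (real n)) x *\<^sub>R g x)" for n
    using assms by (simp add: locally_integrable_def set_integrable_def)
  from borel_measurable_integrable[OF this]
  show "(\<lambda>x. indicator (cball 0 (real n)) x *\<^sub>R g x) \<in> borel_measurable borel" for n
    by simp
  fix x :: 'a
  obtain m :: nat where m: "norm x \<le> real m" using real_arch_simple by blast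
  have "\<forall>\<^sub>F n in sequentially. g x = indicator (cball 0 (real n)) x *\<^sub>R g x"
    using eventually_ge_at_top[of m] by eventually_elim (use m in \<open>auto simp: indicator_def\<close>)
  then show "(\<lambda>n. indicator (cball 0 (real n)) x *\<^sub>R g x) \<longlonglongrightarrow> g x"
    by (rule Lim_transform_eventually[OF tendsto_const])
qed

text \<open>Testing the difference against \<open>\<psi>\<close> moves the translation to \<open>\<psi>\<close>, where the fundamental theorem of
  calculus applies.\<close>

lemma weak_gradient_translation:
  fixes p :: "real ^ 'n \<Rightarrow> real"
  assumes p: "integrable lborel p" and w: "weak_gradient p g"
    and g: "integrable lborel (\<lambda>x. norm (g x))"
  shows "AE x in lborel. p (x + z) - p x = line_average (\<lambda>x. z \<bullet> g x) z x"
proof -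
  have [measurable]: "p \<in> borel_measurable borel" using p by auto
  have [measurable]: "g \<in> borel_measurable borel"
    using w by (intro locally_integrable_measurable) (simp add: weak_gradient_def)
  have gi: "integrable lborel g" using g by (simp add: integrable_norm_iff)
  have zg: "integrable lborel (\<lambda>x. z \<bullet> g x)" using gi by simp
  note la = line_average(1)[OF zg, of z]
  note pz = integrable_lborel_translation[OF p]
  let ?F = "\<lambda>x. (p (x + z) - p x) - line_average (\<lambda>x. z \<bullet> g x) z x"
  have "AE x in lborel. ?F x = 0"
  proof (rule AE_eq_0_if_test_functions)
    show "integrable lborel ?F" using la pz p by simp
    fix \<psi> :: "real ^ 'n \<Rightarrow> real" assume \<psi>: "test_function \<psi>"
    note T = test_function_facts[OF \<psi>]
    obtain B where B: "\<And>x. \<bar>\<psi> x\<bar> \<le> B" using T(3) by blast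
    obtain B' where B': "\<And>x. norm (grad \<psi> x) \<le> B'" using T(4) by blast
    have [measurable]: "\<psi> \<in> borel_measurable borel" "grad \<psi> \<in> borel_measurable borel"
      using test_function_continuous[OF \<psi>] T(2) by (auto intro: borel_measurable_continuous_onI)
    have \<psi>z: "integrable lborel (\<lambda>x. p x * \<psi> (x + a))" for a
      by (rule integrable_mult_bounded[OF p _ B]) measurable
    have "(LINT x|lborel. (p (x + z) - p x) * \<psi> x)
        = (LINT x|lborel. p (x + z) * \<psi> x) - (LINT x|lborel. p x * \<psi> x)"
      unfolding left_diff_distrib
      by (intro Bochner_Integration.integral_diff integrable_mult_bounded[OF _ _ B] p pz) measurable
    also have "(LINT x|lborel. p (x + z) * \<psi> x) = (LINT x|lborel. p x * \<psi> (x + (- z)))"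
      using integral_lborel_translation[of "\<lambda>x. p x * \<psi> (x - z)" z] by simp
    also have "\<dots> - (LINT x|lborel. p x * \<psi> x) = (LINT x|lborel. p x * (\<psi> (x + (- z)) - \<psi> x))"
      using \<psi>z[of "- z"] \<psi>z[of 0] by (simp add: right_diff_distrib)
    also have "\<dots> = (LINT x|lborel. p x * line_average (\<lambda>x. (- z) \<bullet> grad \<psi> x) (- z) x)"
      using line_average_GDERIV[OF T(1,2), of "- z"] by simp
    also have "\<dots> = (LINT t|lborel. indicator {0..1} t * (LINT x|lborel. p x * ((- z) \<bullet> grad \<psi> (x + t *\<^sub>R (- z)))))"
    proof (rule line_average_adjoint(1)[OF p])
      show "\<bar>(- z) \<bullet> grad \<psi> x\<bar> \<le> norm z * B'" for x
        using Cauchy_Schwarz_ineq2[of "- z" "grad \<psi> x"] B'[of x] norm_ge_zero[of z]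
        by (smt (verit) mult_left_mono norm_minus_cancel)
    qed measurable
    \<comment> \<open>For each \<open>t\<close> the weak gradient identity is applied to the
      translate of \<psi> by \<open>t *\<^sub>R (- z)\<close>. Its minus sign cancels the one in
      \<open>- z\<close>, and a change of variables moves the translation onto
      \<open>g\<close>.\<close>
    also have "\<dots> = (LINT t|lborel. indicator {0..1} t * (LINT x|lborel. (z \<bullet> g (x + t *\<^sub>R z)) * \<psi> x))"
    proof (rule Bochner_Integration.integral_cong[OF refl], rule arg_cong2[where f="(*)", OF refl])
      fix t :: real
      let ?a = "t *\<^sub>R (- z)"
      let ?\<psi> = "\<lambda>x. \<psi> (x + ?a)"
      have \<psi>': "test_function ?\<psi>" by (rule test_function_translate[OF \<psi>])
      have gr: "grad ?\<psi> x = grad \<psi> (x + ?a)" for x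
      proof (rule grad_eqI)
        have "(\<psi> has_derivative (\<lambda>h. h \<bullet> grad \<psi> (x + ?a))) (at (x + ?a))"
          using T(1) by (simp add: gderiv_def)
        then have "(?\<psi> has_derivative (\<lambda>h. h \<bullet> grad \<psi> (x + ?a))) (at x)"
          by (rule has_derivative_compose[where g=\<psi>, rotated]) (auto intro!: derivative_eq_intros)
        then show "GDERIV ?\<psi> x :> grad \<psi> (x + ?a)" by (simp add: gderiv_def)
      qed
      have "(LINT x|lborel. p x *\<^sub>R grad ?\<psi> x) = - (LINT x|lborel. ?\<psi> x *\<^sub>R g x)"
        using w \<psi>' unfolding weak_gradient_def by blast
      then have wg: "(LINT x|lborel. p x *\<^sub>R grad \<psi> (x + ?a)) = - (LINT x|lborel. ?\<psi> x *\<^sub>R g x)"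
        unfolding gr .
      have i1: "integrable lborel (\<lambda>x. p x *\<^sub>R grad \<psi> (x + ?a))"
      proof (rule Bochner_Integration.integrable_bound[where f="\<lambda>x. B' * p x"])
        have "norm (p x *\<^sub>R grad \<psi> (x + ?a)) \<le> norm (B' * p x)" for x
          using mult_right_mono[OF B'[of "x + ?a"] abs_ge_zero[of "p x"]]
            mult_right_mono[OF abs_ge_self[of B'] abs_ge_zero[of "p x"]]
          by (simp add: abs_mult mult.commute)
        then show "AE x in lborel. norm (p x *\<^sub>R grad \<psi> (x + ?a)) \<le> norm (B' * p x)" by simp
      qed (use p in auto)
      have i2: "integrable lborel (\<lambda>x. ?\<psi> x *\<^sub>R g x)"
      proof (rule Bochner_Integration.integrable_bound[where f="\<lambda>x. B * norm (g x)"])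
        have "norm (?\<psi> x *\<^sub>R g x) \<le> norm (B * norm (g x))" for x
          using mult_right_mono[OF B[of "x + ?a"] norm_ge_zero[of "g x"]]
            mult_right_mono[OF abs_ge_self[of B] norm_ge_zero[of "g x"]]
          by (simp add: abs_mult)
        then show "AE x in lborel. norm (?\<psi> x *\<^sub>R g x) \<le> norm (B * norm (g x))" by simp
      qed (use g in auto)
      have "(LINT x|lborel. p x * ((- z) \<bullet> grad \<psi> (x + ?a))) = (LINT x|lborel. (- z) \<bullet> (p x *\<^sub>R grad \<psi> (x + ?a)))"
        by simp
      also have "\<dots> = (- z) \<bullet> (LINT x|lborel. p x *\<^sub>R grad \<psi> (x + ?a))"
        by (rule integral_inner_right) (rule i1)
      also have "\<dots> = z \<bullet> (LINT x|lborel. ?\<psi> x *\<^sub>R g x)"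
        unfolding wg by simp
      also have "\<dots> = (LINT x|lborel. z \<bullet> (?\<psi> x *\<^sub>R g x))"
        by (rule integral_inner_right[symmetric]) (rule i2)
      also have "\<dots> = (LINT x|lborel. (z \<bullet> g x) * \<psi> (x - t *\<^sub>R z))"
        by (simp add: mult.commute)
      also have "\<dots> = (LINT x|lborel. (z \<bullet> g (x + t *\<^sub>R z)) * \<psi> x)"
        using integral_lborel_translation[of "\<lambda>x. (z \<bullet> g x) * \<psi> (x - t *\<^sub>R z)" "t *\<^sub>R z"] by simp
      finally show "(LINT x|lborel. p x * ((- z) \<bullet> grad \<psi> (x + ?a)))
          = (LINT x|lborel. (z \<bullet> g (x + t *\<^sub>R z)) * \<psi> x)" .
    qed
    also have "\<dots> = (LINT x|lborel. line_average (\<lambda>x. z \<bullet> g x) z x * \<psi> x)"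
      by (rule line_average_adjoint(2)[OF zg _ B, symmetric]) measurable
    finally have eq: "(LINT x|lborel. (p (x + z) - p x) * \<psi> x) = (LINT x|lborel. line_average (\<lambda>x. z \<bullet> g x) z x * \<psi> x)" .
    have "(LINT x|lborel. ?F x * \<psi> x)
        = (LINT x|lborel. (p (x + z) - p x) * \<psi> x) - (LINT x|lborel. line_average (\<lambda>x. z \<bullet> g x) z x * \<psi> x)"
      unfolding left_diff_distrib[of "p (_ + z) - p _"]
      by (intro Bochner_Integration.integral_diff integrable_mult_bounded[OF _ _ B]
            Bochner_Integration.integrable_diff p pz la) measurable
    then show "(LINT x|lborel. ?F x * \<psi> x) = 0" using eq by simp
  qed
  then show ?thesis by eventually_elim simp
qed

text \<open>Averaging over segments preserves integrals, so after taking absolute values inside the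
  average only Cauchy-Schwarz remains.\<close>

lemma weak_gradient_translation_L1:
  fixes p :: "real ^ 'n \<Rightarrow> real"
  assumes p: "integrable lborel p" and w: "weak_gradient p g"
    and g: "integrable lborel (\<lambda>x. norm (g x))"
  shows "(LINT x|lborel. \<bar>p (x + z) - p x\<bar>) \<le> norm z * L1_norm g"
proof -
  have [measurable]: "g \<in> borel_measurable borel"
    using w by (intro locally_integrable_measurable) (simp add: weak_gradient_def)
  have zg: "integrable lborel (\<lambda>x. z \<bullet> g x)" using g by (simp add: integrable_norm_iff)
  have azg: "integrable lborel (\<lambda>x. \<bar>z \<bullet> g x\<bar>)" using zg by simp
  have "(LINT x|lborel. \<bar>p (x + z) - p x\<bar>) \<le> (LINT x|lborel. line_average (\<lambda>x. \<bar>z \<bullet> g x\<bar>) z x)"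
  proof (rule integral_mono_AE)
    show "AE x in lborel. \<bar>p (x + z) - p x\<bar> \<le> line_average (\<lambda>x. \<bar>z \<bullet> g x\<bar>) z x"
      using weak_gradient_translation[OF assms, of z] by eventually_elim (simp add: line_average_abs)
  qed (use integrable_lborel_translation[OF p] p line_average(1)[OF azg] in auto)
  also have "\<dots> = (LINT x|lborel. \<bar>z \<bullet> g x\<bar>)" by (rule line_average(2)[OF azg])
  also have "\<dots> \<le> (LINT x|lborel. norm z * norm (g x))"
    by (intro integral_mono azg Cauchy_Schwarz_ineq2) (use g in simp)
  finally show ?thesis by (simp add: L1_norm_def)
qed

section \<open>Rotations and ball averages\<close>

text \<open>If the centres are at distance at most \<open>r\<close>, the ball about \<open>b\<close>
  of radius \<open>r - dist a b\<close> lies in both balls, and Bernoulli's inequality bounds the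
  volume outside it. If they are farther apart, the full volume is already below the bound. The
  factor 2 counts the two one-sided differences.\<close>

lemma nn_integral_ball_difference:
  fixes a b :: "'a::euclidean_space"
  assumes r: "0 < r"
  shows "(\<integral>\<^sup>+x. ennreal \<bar>indicator (ball a r) x - indicator (ball b r) x\<bar> \<partial>lborel)
    \<le> ennreal (measure lborel (ball (0::'a) r) * (2 * DIM('a) / r * dist a b))"
proof -
  define n where "n = DIM('a)"
  define V where "V = measure lborel (ball (0::'a) r)"
  have V: "measure lborel (ball c r) = V" "V = unit_ball_vol n * r ^ n" for c :: 'a
    using r by (simp_all add: V_def n_def content_ball)
  have fin: "emeasure lborel (ball c s) \<noteq> \<top>" for c :: 'a and s
    using emeasure_lborel_ball_finite[of c s] by simp
  have fm: "ball c s - B \<in> fmeasurable lborel" if "B \<in> sets borel" for c :: 'a and s B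
    by (rule fmeasurableI2[of "ball c s"]) (use that fin in \<open>auto simp: fmeasurable_def less_top\<close>)
  have half: "measure lborel (ball a r - ball b r) \<le> V * (n / r * dist a b)" for a b :: 'a
  proof (cases "dist a b \<le> r")
    case True
    let ?s = "r - dist a b"
    have sub: "ball b ?s \<subseteq> ball a r \<inter> ball b r"
      using dist_triangle_lt by (auto simp: algebra_simps) (smt (verit) dist_triangle zero_le_dist)+
    have "measure lborel (ball a r - ball b r) \<le> measure lborel (ball a r - ball b ?s)"
      using sub by (intro measure_mono_fmeasurable fm) auto
    also have "\<dots> = V - measure lborel (ball b ?s)"
      using sub by (subst measure_Diff) (auto simp: V fin)
    also have "measure lborel (ball b ?s) = unit_ball_vol n * ?s ^ n"
      using True by (simp add: content_ball n_def)
    also have "?s ^ n = r ^ n * (1 - dist a b / r) ^ n"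
      using r by (simp add: power_mult_distrib[symmetric] right_diff_distrib)
    also have "V - unit_ball_vol n * (r ^ n * (1 - dist a b / r) ^ n) = V * (1 - (1 - dist a b / r) ^ n)"
      by (simp add: V algebra_simps)
    also have "\<dots> \<le> V * (n * (dist a b / r))"
    proof (rule mult_left_mono)
      have "1 + n * (- (dist a b / r)) \<le> (1 + - (dist a b / r)) ^ n"
        using True r by (intro Bernoulli_inequality) (simp add: divide_le_eq)
      then show "1 - (1 - dist a b / r) ^ n \<le> n * (dist a b / r)" by simp
    qed (simp add: V_def)
    finally show ?thesis by simp
  next
    case False
    have "measure lborel (ball a r - ball b r) \<le> measure lborel (ball a r)"
      by (intro measure_mono_fmeasurable) (auto simp: fmeasurable_def less_top[symmetric] fin)
    also have "\<dots> = V * 1" by (simp add: V)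
    also have "\<dots> \<le> V * (n / r * dist a b)"
    proof (rule mult_left_mono)
      have "1 \<le> dist a b / r" using False r by (simp add: le_divide_eq)
      also have "\<dots> \<le> n * (dist a b / r)"
        using r DIM_positive[where 'a='a] by (intro mult_right_mono[of 1 "real n", simplified]) (auto simp: n_def Suc_le_eq)
      finally show "1 \<le> n / r * dist a b" by simp
    qed (simp add: V_def)
    finally show ?thesis .
  qed
  have fin': "emeasure lborel (ball a r - ball b r) \<noteq> \<top>" for a b :: 'a
    using fin[of a r] emeasure_mono[of "ball a r - ball b r" "ball a r" lborel] by (auto simp: top_unique)
  have "ennreal \<bar>indicator (ball a r) x - indicator (ball b r) x\<bar>
      = indicator (ball a r - ball b r) x + indicator (ball b r - ball a r) x" for x
    by (auto simp: indicator_def)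
  then have "(\<integral>\<^sup>+x. ennreal \<bar>indicator (ball a r) x - indicator (ball b r) x\<bar> \<partial>lborel)
      = (\<integral>\<^sup>+x. indicator (ball a r - ball b r) x + indicator (ball b r - ball a r) x \<partial>lborel)"
    by simp
  also have "\<dots> = emeasure lborel (ball a r - ball b r) + emeasure lborel (ball b r - ball a r)"
    by (subst nn_integral_add) (auto intro!: borel_measurable_indicator)
  also have "\<dots> = ennreal (measure lborel (ball a r - ball b r) + measure lborel (ball b r - ball a r))"
    by (simp add: emeasure_eq_ennreal_measure fin' ennreal_plus)
  also have "\<dots> \<le> ennreal (V * (n / r * dist a b) + V * (n / r * dist a b))"
    using half[of b a] by (intro ennreal_leI add_mono half) (simp add: dist_commute)
  also have "V * (n / r * dist a b) + V * (n / r * dist a b) = V * (2 * n / r * dist a b)"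
    by simp
  finally show ?thesis by (simp add: V_def n_def)
qed

lemma nn_integral_ball_average:
  fixes f :: "'a::euclidean_space \<Rightarrow> real"
  assumes f: "integrable lborel f"
    and \<tau>: "\<And>z. (LINT x|lborel. \<bar>f (x + z) - f x\<bar>) \<le> norm z * G" and "0 < r" "0 \<le> G"
  shows "(\<integral>\<^sup>+x. (\<integral>\<^sup>+z. ennreal (indicator (ball 0 r) z * \<bar>f (x + z) - f x\<bar>) \<partial>lborel) \<partial>lborel)
    \<le> ennreal (measure lborel (ball (0::'a) r) * (r * G))"
proof -
  have [measurable]: "f \<in> borel_measurable borel" using f by auto
  have [measurable]: "ball (0::'a) r \<in> sets borel" by simp
  have "(\<integral>\<^sup>+x. (\<integral>\<^sup>+z. ennreal (indicator (ball 0 r) z * \<bar>f (x + z) - f x\<bar>) \<partial>lborel) \<partial>lborel)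
      = (\<integral>\<^sup>+z. (\<integral>\<^sup>+x. ennreal (indicator (ball 0 r) z * \<bar>f (x + z) - f x\<bar>) \<partial>lborel) \<partial>lborel)"
    by (rule lborel_pair.Fubini') measurable
  also have "\<dots> \<le> (\<integral>\<^sup>+z. ennreal (r * G) * indicator (ball (0::'a) r) z \<partial>lborel)"
  proof (rule nn_integral_mono)
    fix z :: 'a
    have i: "integrable lborel (\<lambda>x. \<bar>f (x + z) - f x\<bar>)"
      using integrable_lborel_translation[OF f] f by simp
    show "(\<integral>\<^sup>+x. ennreal (indicator (ball 0 r) z * \<bar>f (x + z) - f x\<bar>) \<partial>lborel)
        \<le> ennreal (r * G) * indicator (ball (0::'a) r) z"
    proof (cases "z \<in> ball 0 r")
      case True
      then have "(\<integral>\<^sup>+x. ennreal (indicator (ball 0 r) z * \<bar>f (x + z) - f x\<bar>) \<partial>lborel)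
          = ennreal (LINT x|lborel. \<bar>f (x + z) - f x\<bar>)"
        by (simp add: nn_integral_eq_integral[OF i])
      also have "\<dots> \<le> ennreal (r * G)"
        using \<tau>[of z] mult_right_mono[of "norm z" r G] True \<open>0 \<le> G\<close>
        by (intro ennreal_leI) (simp add: less_imp_le)
      finally show ?thesis using True by simp
    qed simp
  qed
  also have "\<dots> = ennreal (r * G) * emeasure lborel (ball (0::'a) r)"
    by (rule nn_integral_cmult_indicator) simp
  also have "emeasure lborel (ball (0::'a) r) = ennreal (measure lborel (ball (0::'a) r))"
    using emeasure_lborel_ball_finite[of "0::'a" r] by (intro emeasure_eq_ennreal_measure) simp
  finally show ?thesis
    using \<open>0 < r\<close> \<open>0 \<le> G\<close> by (simp add: ennreal_mult[symmetric] mult.commute)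
qed

text \<open>Compare \<open>p\<close> and its rotation through their averages over balls of radius \<open>r\<close>: the averages of
  translates are controlled by the gradient, and the averages are close because the balls around
  \<open>x\<close> and its rotation overlap.\<close>

lemma rotation_L1_distance:
  fixes p :: "real ^ 'n \<Rightarrow> real" and R :: "real ^ 'n ^ 'n"
  assumes p: "is_density p" and R: "orthogonal_matrix R"
    and \<tau>: "\<And>z. (LINT x|lborel. \<bar>p (x + z) - p x\<bar>) \<le> norm z * G" and G: "0 \<le> G"
    and r: "0 < r" and E: "integrable lborel (\<lambda>x. p x * norm (R *v x - x))"
  shows "(LINT x|lborel. \<bar>p x - p (R *v x)\<bar>)
    \<le> 2 * r * G + 2 * CARD('n) / r * (LINT x|lborel. p x * norm (R *v x - x))"
proof -
  have [measurable]: "p \<in> borel_measurable borel" by (rule is_density_measurable[OF p])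
  let ?K = "ball (0 :: real ^ 'n) r"
  have [measurable]: "?K \<in> sets borel" by simp
  define V where "V = measure lborel ?K"
  have V: "0 < V" using r by (simp add: V_def content_ball_pos)
  define q where "q x = p (R *v x)" for x
  have [measurable]: "q \<in> borel_measurable borel" unfolding q_def by measurable
  have pi: "integrable lborel p" by (rule is_density_integrable[OF p])
  have qi: "integrable lborel q" unfolding q_def using integral_lborel_orthogonal(2)[OF R, of p] pi by simp
  let ?T = "transpose R"
  let ?c = "\<lambda>x y. indicator ?K (y - x) - indicator ?K (?T *v y - x) :: real"
  let ?A = "\<lambda>f x. \<integral>\<^sup>+z. ennreal (indicator ?K z * \<bar>f (x + z) - f x\<bar>) \<partial>lborel"
  let ?C = "\<lambda>x. \<integral>\<^sup>+y. ennreal (p y * \<bar>?c x y\<bar>) \<partial>lborel"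
  have ind: "integrable lborel (\<lambda>z. indicator ?K z * c)" for c :: real
    using integrable_real_indicator[of ?K lborel] emeasure_lborel_ball_finite[of "0 :: real ^ 'n" r] by simp
  have indf: "integrable lborel (\<lambda>z. f z * indicator ?K (h z))"
    if "integrable lborel f" and [measurable]: "h \<in> borel_measurable borel"
    for f :: "real ^ 'n \<Rightarrow> real" and h
  proof (rule integrable_mult_bounded(1)[where B=1, OF that(1)])
    show "(\<lambda>z. indicator ?K (h z) :: real) \<in> borel_measurable lborel" by measurable
    show "\<bar>indicator ?K (h z) :: real\<bar> \<le> 1" for z by (simp add: indicator_def)
  qed
  have pointwise: "ennreal (V * \<bar>p x - q x\<bar>) \<le> ?A p x + ?A q x + ?C x" for x
  proof -
    have fi: "integrable lborel (\<lambda>z. indicator ?K z * f (x + z))" if "integrable lborel f" for f :: "real ^ 'n \<Rightarrow> real"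
      using indf[OF integrable_lborel_translation[OF that, of x], of "\<lambda>z. z"]
      by (simp add: add.commute mult.commute)
    note ip = fi[OF pi] and iq = fi[OF qi]
    let ?a = "\<lambda>f z. indicator ?K z * (f (x + z) - f x) :: real"
    have ai: "integrable lborel (?a f)" if "integrable lborel f" for f :: "real ^ 'n \<Rightarrow> real"
      using fi[OF that] ind[of "f x"] by (simp add: right_diff_distrib)
    have ci: "integrable lborel (\<lambda>y. p y * ?c x y)"
      unfolding right_diff_distrib by (intro Bochner_Integration.integrable_diff indf pi) measurable
    have "V * (p x - q x) = (LINT z|lborel. indicator ?K z * (p x - q x))"
      by (simp add: V_def)
    \<comment> \<open>Adding and subtracting the values at \<open>x + z\<close> leaves the
      oscillation of each function within the ball and the difference of the two ball
      integrals.\<close>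
    also have "\<dots> = (LINT z|lborel. (?a q z - ?a p z) + (indicator ?K z * p (x + z) - indicator ?K z * q (x + z)))"
      by (intro Bochner_Integration.integral_cong) (simp_all add: algebra_simps)
    also have "\<dots> = (LINT z|lborel. ?a q z) - (LINT z|lborel. ?a p z)
        + ((LINT z|lborel. indicator ?K z * p (x + z)) - (LINT z|lborel. indicator ?K z * q (x + z)))"
      using ai[OF pi] ai[OF qi] ip iq by simp
    also have "(LINT z|lborel. indicator ?K z * p (x + z)) = (LINT y|lborel. p y * indicator ?K (y - x))"
      using integral_lborel_translation[of "\<lambda>y. p y * indicator ?K (y - x)" x]
      by (simp add: add.commute mult.commute)
    also have "(LINT z|lborel. indicator ?K z * q (x + z)) = (LINT y|lborel. q y * indicator ?K (y - x))"
      using integral_lborel_translation[of "\<lambda>y. q y * indicator ?K (y - x)" x]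
      by (simp add: add.commute mult.commute)
    \<comment> \<open>Since \<open>q\<close> is \<open>p\<close> composed with \<open>R\<close>, a
      rotation of the variable restores \<open>p\<close> and moves the rotation into the indicator.
      The two ball integrals now differ only in their indicators.\<close>
    also have "\<dots> = (LINT y|lborel. p y * indicator ?K (?T *v y - x))"
      using integral_lborel_orthogonal(1)[OF R, of "\<lambda>y. p y * indicator ?K (?T *v y - x)"]
      by (simp add: q_def orthogonal_matrix_transpose_cancel[OF R] del: transpose_matrix_vector)
    also have "(LINT y|lborel. p y * indicator ?K (y - x)) - (LINT y|lborel. p y * indicator ?K (?T *v y - x))
        = (LINT y|lborel. p y * ?c x y)"
      unfolding right_diff_distrib
      by (rule Bochner_Integration.integral_diff[symmetric]) (intro indf pi; measurable)+
    finally have eq: "V * (p x - q x) = (LINT z|lborel. ?a q z) - (LINT z|lborel. ?a p z) + (LINT y|lborel. p y * ?c x y)" .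
    have absn: "ennreal \<bar>LINT z|lborel. ?a f z\<bar> \<le> ?A f x" if "integrable lborel f" for f :: "real ^ 'n \<Rightarrow> real"
      using integral_norm_bound_ennreal[OF ai[OF that]] by (simp add: abs_mult)
    have absc: "ennreal \<bar>LINT y|lborel. p y * ?c x y\<bar> \<le> ?C x"
      using integral_norm_bound_ennreal[OF ci] by (simp add: abs_mult is_density_nonneg[OF p])
    have "V * \<bar>p x - q x\<bar> = \<bar>V * (p x - q x)\<bar>" using V by (simp add: abs_mult)
    also have "\<dots> \<le> \<bar>LINT z|lborel. ?a p z\<bar> + \<bar>LINT z|lborel. ?a q z\<bar> + \<bar>LINT y|lborel. p y * ?c x y\<bar>"
      unfolding eq by linarith
    finally have "ennreal (V * \<bar>p x - q x\<bar>) \<le> ennreal (\<bar>LINT z|lborel. ?a p z\<bar> + \<bar>LINT z|lborel. ?a q z\<bar> + \<bar>LINT y|lborel. p y * ?c x y\<bar>)"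
      by (rule ennreal_leI)
    also have "\<dots> = ennreal \<bar>LINT z|lborel. ?a p z\<bar> + ennreal \<bar>LINT z|lborel. ?a q z\<bar> + ennreal \<bar>LINT y|lborel. p y * ?c x y\<bar>"
      by simp
    also have "\<dots> \<le> ?A p x + ?A q x + ?C x"
      by (intro add_mono absn pi qi absc)
    finally show ?thesis .
  qed
  \<comment> \<open>Rotating the variable replaces the shift \<open>z\<close> by
    \<open>R *v z\<close>, of the same norm.\<close>
  have \<tau>q: "(LINT x|lborel. \<bar>q (x + z) - q x\<bar>) \<le> norm z * G" for z
  proof -
    have "(LINT x|lborel. \<bar>q (x + z) - q x\<bar>) = (LINT x|lborel. \<bar>p (x + R *v z) - p x\<bar>)"
      using integral_lborel_orthogonal(1)[OF R, of "\<lambda>x. \<bar>p (x + R *v z) - p x\<bar>"]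
      by (simp add: q_def matrix_vector_right_distrib)
    then show ?thesis using \<tau>[of "R *v z"] by (simp add: norm_orthogonal_matrix[OF R])
  qed
  let ?k = "V * (2 * CARD('n) / r)"
  have C: "(\<integral>\<^sup>+x. ?C x \<partial>lborel) \<le> ennreal (?k * (LINT x|lborel. p x * norm (R *v x - x)))"
  proof -
    have "(\<integral>\<^sup>+x. ?C x \<partial>lborel) = (\<integral>\<^sup>+y. (\<integral>\<^sup>+x. ennreal (p y * \<bar>?c x y\<bar>) \<partial>lborel) \<partial>lborel)"
      by (rule lborel_pair.Fubini') measurable
    also have "\<dots> \<le> (\<integral>\<^sup>+y. ennreal (?k * (p y * norm (R *v y - y))) \<partial>lborel)"
    proof (rule nn_integral_mono)
      fix y
      \<comment> \<open>Read as functions of \<open>x\<close>, the indicators are those of balls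
        about \<open>y\<close> and its image under \<open>?T\<close>.\<close>
      have c: "?c x y = indicator (ball y r) x - indicator (ball (?T *v y) r) x" for x
        by (simp add: indicator_def dist_norm norm_minus_commute)
      have d: "dist y (?T *v y) = norm (R *v y - y)"
      proof -
        have "norm (R *v y - y) = norm (R *v (y - ?T *v y))"
          by (simp add: matrix_vector_mult_diff_distrib orthogonal_matrix_transpose_cancel[OF R]
              del: transpose_matrix_vector)
        then show ?thesis by (simp add: norm_orthogonal_matrix[OF R] dist_norm del: transpose_matrix_vector)
      qed
      have "(\<integral>\<^sup>+x. ennreal (p y * \<bar>?c x y\<bar>) \<partial>lborel) = ennreal (p y) * (\<integral>\<^sup>+x. ennreal \<bar>?c x y\<bar> \<partial>lborel)"
        by (subst nn_integral_cmult[symmetric]) (auto simp: ennreal_mult is_density_nonneg[OF p])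
      also have "\<dots> \<le> ennreal (p y) * ennreal (V * (2 * CARD('n) / r * norm (R *v y - y)))"
        unfolding c d[symmetric] V_def
        using nn_integral_ball_difference[OF r, of y "?T *v y"]
        by (intro mult_left_mono) (simp_all del: transpose_matrix_vector)
      also have "\<dots> = ennreal (?k * (p y * norm (R *v y - y)))"
        using V r by (simp add: ennreal_mult[symmetric] is_density_nonneg[OF p] ac_simps)
      finally show "(\<integral>\<^sup>+x. ennreal (p y * \<bar>?c x y\<bar>) \<partial>lborel) \<le> ennreal (?k * (p y * norm (R *v y - y)))" .
    qed
    also have "\<dots> = ennreal (LINT y|lborel. ?k * (p y * norm (R *v y - y)))"
      using V r by (intro nn_integral_eq_integral integrable_mult_right E) (simp add: is_density_nonneg[OF p])
    finally show ?thesis by simp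
  qed
  have i: "integrable lborel (\<lambda>x. V * \<bar>p x - q x\<bar>)" using pi qi by simp
  have En: "0 \<le> (LINT x|lborel. p x * norm (R *v x - x))"
    by (simp add: is_density_nonneg[OF p])
  have "ennreal (V * (LINT x|lborel. \<bar>p x - q x\<bar>)) = (\<integral>\<^sup>+x. ennreal (V * \<bar>p x - q x\<bar>) \<partial>lborel)"
    using nn_integral_eq_integral[OF i] V by simp
  also have "\<dots> \<le> (\<integral>\<^sup>+x. ?A p x + ?A q x + ?C x \<partial>lborel)"
    by (rule nn_integral_mono) (rule pointwise)
  also have "\<dots> = (\<integral>\<^sup>+x. ?A p x \<partial>lborel) + (\<integral>\<^sup>+x. ?A q x \<partial>lborel) + (\<integral>\<^sup>+x. ?C x \<partial>lborel)"
    by (simp add: nn_integral_add del: transpose_matrix_vector)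
  also have "\<dots> \<le> ennreal (V * (r * G)) + ennreal (V * (r * G)) + ennreal (?k * (LINT x|lborel. p x * norm (R *v x - x)))"
    unfolding V_def
    by (intro add_mono nn_integral_ball_average pi qi \<tau> \<tau>q r G C[unfolded V_def])
  also have "\<dots> = ennreal (V * (2 * r * G + 2 * CARD('n) / r * (LINT x|lborel. p x * norm (R *v x - x))))"
    using V r G En by (subst ennreal_plus[symmetric] | simp add: algebra_simps)+
  finally have "V * (LINT x|lborel. \<bar>p x - q x\<bar>)
      \<le> V * (2 * r * G + 2 * CARD('n) / r * (LINT x|lborel. p x * norm (R *v x - x)))"
    using V r G En by (subst (asm) ennreal_le_iff) auto
  then show ?thesis using V by (simp add: q_def)
qed

section \<open>Marginals of a density and of its rotation\<close>

lemma integral_proj_density: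
  fixes p :: "real ^ 'n \<Rightarrow> real"
  assumes p: "is_density p" and s: "norm s = 1" and [measurable]: "f \<in> borel_measurable borel"
  shows "(LINT t|lborel. proj_density p s t * f t) = (LINT x|lborel. p x * f (s \<bullet> x))"
proof -
  note l = law_proj_density[OF p s]
  have [measurable]: "p \<in> borel_measurable borel" "proj_density p s \<in> borel_measurable borel"
    using p l(2) by (auto dest: is_density_measurable)
  have "(LINT t|lborel. proj_density p s t * f t) = (LINT t|law (proj_density p s). f t)"
    unfolding law_def by (subst integral_density) (auto simp: is_density_nonneg[OF l(2)])
  also have "\<dots> = (LINT x|law p. f (s \<bullet> x))"
    unfolding l(1) by (subst integral_distr) auto
  also have "\<dots> = (LINT x|lborel. p x * f (s \<bullet> x))"
    unfolding law_def by (subst integral_density) (auto simp: is_density_nonneg[OF p])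
  finally show ?thesis .
qed

lemma is_density_orthogonal:
  fixes R :: "real ^ 'n ^ 'n"
  assumes p: "is_density p" and R: "orthogonal_matrix R"
  shows "is_density (\<lambda>x. p (R *v x))"
  using p integral_lborel_orthogonal[OF R is_density_measurable[OF p]]
    measurable_compose[OF borel_measurable_matrix_vector[of R] is_density_measurable[OF p]]
  by (simp add: is_density_def)

text \<open>The sign \<open>f\<close> of the difference of the marginals realises their distance and
  pulls back to a function on the whole space bounded by 1. Integrating it against \<open>p\<close>
  along \<open>row i W\<close> equals, after rotation, integrating along \<open>row i V\<close>
  against the rotated density.\<close>

lemma proj_rows_L1_distance:
  fixes p :: "real ^ 'n \<Rightarrow> real"
  assumes p: "is_density p" and W: "orthogonal_matrix W" and V: "orthogonal_matrix V"
  shows "(LINT t|lborel. \<bar>proj_rows p V i t - proj_rows p W i t\<bar>)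
    \<le> (LINT x|lborel. \<bar>p x - p ((transpose W ** V) *v x)\<bar>)"
proof -
  define R where "R = transpose W ** V"
  have R: "orthogonal_matrix R"
    unfolding R_def by (rule orthogonal_matrix_transpose_mult[OF W V])
  let ?u = "proj_rows p V i" and ?v = "proj_rows p W i"
  have u: "is_density ?u" and v: "is_density ?v"
    using is_density_proj_rows p V W by auto
  have [measurable]: "p \<in> borel_measurable borel" "?u \<in> borel_measurable borel" "?v \<in> borel_measurable borel"
    using p u v by (auto dest: is_density_measurable)
  define f where "f t = sgn (?u t - ?v t)" for t
  have [measurable]: "f \<in> borel_measurable borel" unfolding f_def by measurable
  have f1: "\<bar>f t\<bar> \<le> 1" for t by (simp add: f_def sgn_if)
  note bound = integrable_mult_bounded(1)[where B=1, OF is_density_integrable]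
  have row: "row i W \<bullet> (R *v x) = row i V \<bullet> x" for x
    unfolding R_def by (rule row_inner_transpose_mult[OF W])
  have q: "is_density (\<lambda>x. p (R *v x))" by (rule is_density_orthogonal[OF p R])
  have "(LINT t|lborel. \<bar>?u t - ?v t\<bar>) = (LINT t|lborel. ?u t * f t - ?v t * f t)"
    by (intro Bochner_Integration.integral_cong refl)
       (auto simp: f_def abs_sgn left_diff_distrib[symmetric])
  also have "\<dots> = (LINT t|lborel. ?u t * f t) - (LINT t|lborel. ?v t * f t)"
    using bound[OF u, of f] bound[OF v, of f] f1 by simp
  also have "(LINT t|lborel. ?v t * f t) = (LINT x|lborel. p x * f (row i W \<bullet> x))"
    unfolding proj_rows_def by (rule integral_proj_density) (auto simp: p norm_row_orthogonal_matrix W)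
  also have "\<dots> = (LINT x|lborel. p (R *v x) * f (row i V \<bullet> x))"
    using integral_lborel_orthogonal(1)[OF R, of "\<lambda>x. p x * f (row i W \<bullet> x)"] by (simp add: row)
  also have "(LINT t|lborel. ?u t * f t) = (LINT x|lborel. p x * f (row i V \<bullet> x))"
    unfolding proj_rows_def by (rule integral_proj_density) (auto simp: p norm_row_orthogonal_matrix V)
  also have "(LINT x|lborel. p x * f (row i V \<bullet> x)) - (LINT x|lborel. p (R *v x) * f (row i V \<bullet> x))
      = (LINT x|lborel. p x * f (row i V \<bullet> x) - p (R *v x) * f (row i V \<bullet> x))"
    by (intro Bochner_Integration.integral_diff[symmetric] bound p q f1) measurable
  also have "\<dots> \<le> (LINT x|lborel. \<bar>p x - p (R *v x)\<bar>)"
  proof (rule integral_mono)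
    show "p x * f (row i V \<bullet> x) - p (R *v x) * f (row i V \<bullet> x) \<le> \<bar>p x - p (R *v x)\<bar>" for x
    proof -
      have "p x * f (row i V \<bullet> x) - p (R *v x) * f (row i V \<bullet> x) \<le> \<bar>(p x - p (R *v x)) * f (row i V \<bullet> x)\<bar>"
        by (simp add: left_diff_distrib)
      also have "\<dots> \<le> \<bar>p x - p (R *v x)\<bar>"
        unfolding abs_mult using f1 by (intro mult_left_le) auto
      finally show ?thesis .
    qed
    show "integrable lborel (\<lambda>x. p x * f (row i V \<bullet> x) - p (R *v x) * f (row i V \<bullet> x))"
      by (intro Bochner_Integration.integrable_diff bound p q f1) measurable
  qed (simp add: p q is_density_integrable)
  finally show ?thesis unfolding R_def .
qed

text \<open>Let \<open>?D\<close> be the distance on the right. The step from \<open>p\<close> to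
  its rotation costs \<open>?D / 2\<close>, and so does each marginal when the rotation is compared
  with the product; the triangle inequality doubles both.\<close>

lemma hellinger_sq_marginals_le_L1:
  fixes p :: "real ^ 'n \<Rightarrow> real"
  assumes p: "is_density p" and W: "unmixing_matrix p W" and V: "orthogonal_matrix V"
  shows "hellinger_sq p (prod_rows V (proj_rows p V))
    \<le> (1 + real CARD('n)) * (LINT x|lborel. \<bar>p x - p ((transpose W ** V) *v x)\<bar>)"
proof -
  have W': "orthogonal_matrix W" using W by (simp add: unmixing_matrix_def)
  define R where "R = transpose W ** V"
  have R: "orthogonal_matrix R"
    unfolding R_def by (rule orthogonal_matrix_transpose_mult[OF W' V])
  let ?u = "proj_rows p V" and ?v = "proj_rows p W" and ?q = "\<lambda>x. p (R *v x)"
  let ?D = "LINT x|lborel. \<bar>p x - p (R *v x)\<bar>"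
  have u: "is_density (?u i)" and v: "is_density (?v i)" for i
    using is_density_proj_rows p V W' by auto
  have q: "is_density ?q" by (rule is_density_orthogonal[OF p R])
  have qv: "is_density (prod_rows V ?v)" and pu: "is_density (prod_rows V ?u)"
    using u v by (auto intro: is_density_prod_rows[OF V])
  have "AE x in lborel. p x = prod_rows W ?v x"
    by (rule law_eq_iff[OF p is_density_prod_rows[OF W' v] law_unmixing_matrix[OF p W]])
  from AE_lborel_orthogonal[OF R this]
  have "AE x in lborel. ?q x = prod_rows V ?v x"
    unfolding R_def by (simp add: prod_rows_orthogonal[OF W'])
  then have "hellinger_sq ?q (prod_rows V ?u) = hellinger_sq (prod_rows V ?v) (prod_rows V ?u)"
    by (intro hellinger_sq_cong_AE is_density_measurable q qv pu) auto
  also have "\<dots> \<le> (\<Sum>i\<in>UNIV. hellinger_sq (?v i) (?u i))"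
    by (rule hellinger_sq_prod_rows[OF V v u])
  also have "\<dots> \<le> (\<Sum>i\<in>(UNIV::'n set). ?D / 2)"
  proof (rule sum_mono)
    fix i
    have "hellinger_sq (?v i) (?u i) \<le> (LINT t|lborel. \<bar>?u i t - ?v i t\<bar>) / 2"
      using hellinger_sq_le_L1[OF u v, of i i] by (simp add: hellinger_sq_commute)
    also have "\<dots> \<le> ?D / 2"
      using proj_rows_L1_distance[OF p W' V, of i] by (simp add: R_def)
    finally show "hellinger_sq (?v i) (?u i) \<le> ?D / 2" .
  qed
  finally have "hellinger_sq ?q (prod_rows V ?u) \<le> CARD('n) * (?D / 2)" by simp
  moreover have "hellinger_sq p ?q \<le> ?D / 2"
    by (rule hellinger_sq_le_L1[OF p q])
  ultimately show ?thesis
    using hellinger_sq_triangle[OF p q pu] by (simp add: R_def algebra_simps)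
qed

section \<open>Second moments and the displacement by a rotation\<close>

lemma second_moment_projection:
  fixes p :: "real ^ 'n \<Rightarrow> real"
  assumes p: "is_density p" and mean: "zero_mean p" and m2: "finite_second_moments p"
  shows "integrable lborel (\<lambda>x. p x * (v \<bullet> x)\<^sup>2)"
    and "(LINT x|lborel. p x * (v \<bullet> x)\<^sup>2) \<le> op_norm (covariance_matrix p) * (norm v)\<^sup>2"
proof -
  have [measurable]: "p \<in> borel_measurable borel" by (rule is_density_measurable[OF p])
  let ?S = "covariance_matrix p"
  have i: "integrable lborel (\<lambda>x. x $ i * x $ j * p x)" for i j
  proof (rule Bochner_Integration.integrable_bound)
    show "integrable lborel (\<lambda>x. (norm x)\<^sup>2 * p x)"
      using m2 by (simp add: finite_second_moments_def)
    have "\<bar>x $ i * x $ j\<bar> \<le> (norm x)\<^sup>2" for x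
      unfolding abs_mult power2_eq_square by (intro mult_mono component_le_norm_cart) auto
    then show "AE x in lborel. norm (x $ i * x $ j * p x) \<le> norm ((norm x)\<^sup>2 * p x)"
      by (auto simp: abs_mult intro!: mult_right_mono)
  qed measurable
  have eq: "p x * (v \<bullet> x)\<^sup>2 = (\<Sum>i\<in>UNIV. \<Sum>j\<in>UNIV. v $ i * v $ j * (x $ i * x $ j * p x))" for x
    unfolding inner_vec_def power2_eq_square sum_product by (simp add: sum_distrib_left ac_simps)
  show "integrable lborel (\<lambda>x. p x * (v \<bullet> x)\<^sup>2)"
    unfolding eq by (intro Bochner_Integration.integrable_sum integrable_mult_right i)
  have S: "?S $ i $ j = (LINT x|lborel. x $ i * x $ j * p x)" for i j
    using mean by (simp add: covariance_matrix_def zero_mean_def)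
  have "(LINT x|lborel. p x * (v \<bullet> x)\<^sup>2) = (\<Sum>i\<in>UNIV. \<Sum>j\<in>UNIV. v $ i * v $ j * ?S $ i $ j)"
    unfolding eq S by (simp add: i)
  also have "\<dots> = v \<bullet> (?S *v v)"
    unfolding inner_vec_def matrix_vector_mult_def by (simp add: sum_distrib_left ac_simps)
  also have "\<dots> \<le> norm v * norm (?S *v v)"
    by (rule norm_cauchy_schwarz)
  also have "\<dots> \<le> norm v * (op_norm ?S * norm v)"
    unfolding op_norm_def by (intro mult_left_mono onorm matrix_vector_mul_bounded_linear) simp
  finally show "(LINT x|lborel. p x * (v \<bullet> x)\<^sup>2) \<le> op_norm ?S * (norm v)\<^sup>2"
    by (simp add: power2_eq_square ac_simps)
qed

text \<open>Applying the isometry \<open>W\<close> turns \<open>R *v x - x\<close> into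
  \<open>V *v x - W *v x\<close>, whose coordinates are projections on differences of rows. Here the
  error of the unmixing matrix enters.\<close>

lemma second_moment_rotation:
  fixes p :: "real ^ 'n \<Rightarrow> real" and V W :: "real ^ 'n ^ 'n"
  assumes p: "is_density p" and mean: "zero_mean p" and m2: "finite_second_moments p"
    and W: "orthogonal_matrix W"
  defines "R \<equiv> transpose W ** V"
  shows "integrable lborel (\<lambda>x. p x * (norm (R *v x - x))\<^sup>2)"
    and "(LINT x|lborel. p x * (norm (R *v x - x))\<^sup>2)
      \<le> op_norm (covariance_matrix p) * (\<Sum>i\<in>UNIV. (norm (row i V - row i W))\<^sup>2)"
proof -
  note sm = second_moment_projection[OF p mean m2]
  have eq: "p x * (norm (R *v x - x))\<^sup>2 = (\<Sum>i\<in>UNIV. p x * ((row i V - row i W) \<bullet> x)\<^sup>2)" for x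
  proof -
    have "norm (R *v x - x) = norm (W *v (R *v x - x))"
      by (simp add: norm_orthogonal_matrix[OF W])
    also have "W *v (R *v x - x) = V *v x - W *v x"
      using orthogonal_matrix_transpose_cancel(1)[OF W]
      by (simp add: R_def matrix_vector_mult_diff_distrib matrix_vector_mul_assoc[symmetric]
          del: transpose_matrix_vector)
    also have "(norm \<dots>)\<^sup>2 = (\<Sum>i\<in>UNIV. ((row i V - row i W) \<bullet> x)\<^sup>2)"
      unfolding power2_norm_eq_inner inner_vec_def[of "V *v x - W *v x"]
      by (simp add: matrix_vector_mult_row inner_diff_left power2_eq_square)
    finally show ?thesis by (simp add: sum_distrib_left)
  qed
  show "integrable lborel (\<lambda>x. p x * (norm (R *v x - x))\<^sup>2)"
    unfolding eq by (intro Bochner_Integration.integrable_sum sm)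
  have "(LINT x|lborel. p x * (norm (R *v x - x))\<^sup>2)
      = (\<Sum>i\<in>UNIV. LINT x|lborel. p x * ((row i V - row i W) \<bullet> x)\<^sup>2)"
    unfolding eq by (simp add: sm)
  also have "\<dots> \<le> (\<Sum>i\<in>UNIV. op_norm (covariance_matrix p) * (norm (row i V - row i W))\<^sup>2)"
    by (intro sum_mono sm)
  finally show "(LINT x|lborel. p x * (norm (R *v x - x))\<^sup>2)
      \<le> op_norm (covariance_matrix p) * (\<Sum>i\<in>UNIV. (norm (row i V - row i W))\<^sup>2)"
    by (simp add: sum_distrib_left)
qed

section \<open>Sampling\<close>

lemma space_iid_law: "space (iid_law n p) = space (sample_space n)"
  by (simp add: iid_law_def space_PiM)

lemma sets_iid_law [simp, measurable_cong]: "sets (iid_law n p) = sets (sample_space n)"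
  unfolding iid_law_def by (intro sets_PiM_cong) auto

lemma prob_space_iid_law: "is_density p \<Longrightarrow> prob_space (iid_law n p)"
  unfolding iid_law_def by (intro prob_space_PiM prob_space_law)

text \<open>A finite bound rules out the empty set, whose infimum is infinity. A nonempty set of
  extended naturals contains its infimum, and membership covers all larger sample sizes.\<close>

lemma sufficient_sample_size_leD:
  assumes "sufficient_sample_size Q \<le> enat n"
  shows "0 < n" "Q n"
proof -
  let ?S = "{n. 0 < n \<and> (\<forall>m\<ge>n. Q m)}"
  have "?S \<noteq> {}"
  proof
    assume "?S = {}"
    then have "sufficient_sample_size Q = \<infinity>"
      unfolding sufficient_sample_size_def by (simp only: image_empty Inf_empty top_enat_def)
    then show False using assms by simp
  qed
  then have ne: "enat ` ?S \<noteq> {}" by simp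
  then obtain a where "a \<in> enat ` ?S" by (meson ex_in_conv)
  then have "(LEAST x. x \<in> enat ` ?S) \<in> enat ` ?S" by (rule LeastI)
  then have "Inf (enat ` ?S) \<in> enat ` ?S"
    unfolding Inf_enat_def using ne by (simp only: if_False)
  then obtain k where k: "k \<in> ?S" "Inf (enat ` ?S) = enat k" by auto
  then have "k \<le> n" using assms by (simp add: sufficient_sample_size_def)
  with k(1) show "0 < n" "Q n" by auto
qed

definition proj_sample :: "nat \<Rightarrow> real ^ 'n \<Rightarrow> (nat \<Rightarrow> real ^ 'n) \<Rightarrow> nat \<Rightarrow> real" where
  "proj_sample N s x = (\<lambda>j\<in>{..<N}. s \<bullet> x j)"

lemma measurable_proj_sample [measurable]: "proj_sample N s \<in> sample_space N \<rightarrow>\<^sub>M sample_space N"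
  unfolding proj_sample_def by measurable

text \<open>Links the projected samples fed to the univariate estimator with the iid samples in its
  sample complexity: a coordinatewise image of a product measure is the product of the
  images.\<close>

lemma distr_iid_law_proj:
  fixes p :: "real ^ 'n \<Rightarrow> real"
  assumes p: "is_density p" and s: "norm s = 1"
  shows "distr (iid_law N p) (sample_space N) (proj_sample N s) = iid_law N (proj_density p s)"
proof -
  note l = law_proj_density[OF p s]
  let ?l = "law (proj_density p s)"
  have "distr (iid_law N p) (sample_space N) (proj_sample N s)
      = distr (PiM {..<N} (\<lambda>_. law p)) (PiM {..<N} (\<lambda>_. ?l)) (compose {..<N} (\<lambda>x. s \<bullet> x))"
    by (intro distr_cong sets_PiM_cong) (auto simp: iid_law_def proj_sample_def compose_def)
  also have "\<dots> = PiM {..<N} (\<lambda>_. distr (law p) ?l (\<lambda>x. s \<bullet> x))"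
    by (rule distr_PiM_finite_prob_space')
       (auto intro!: prob_space_law p l(2) simp: measurable_cong_sets[OF sets_law sets_law])
  also have "distr (law p) ?l (\<lambda>x. s \<bullet> x) = distr (law p) borel (\<lambda>x. s \<bullet> x)"
    by (rule distr_cong) auto
  finally show ?thesis
    by (simp add: iid_law_def l(1))
qed

text \<open>For fixed \<open>V\<close> this is a union bound. All rows project the same samples, so
  the estimates for different rows need not be independent.\<close>

lemma prob_projected_estimates:
  fixes p :: "real ^ 'n \<Rightarrow> real" and V :: "real ^ 'n ^ 'n"
  assumes p: "is_density p" and V: "orthogonal_matrix V"
    and fhat: "density_estimator fhat" and N: "0 < N"
    and n: "\<And>s. norm s = 1 \<Longrightarrow> measure (iid_law N (proj_density p s))
      {z \<in> space (iid_law N (proj_density p s)). hellinger_sq (fhat N z) (proj_density p s) \<le> \<epsilon>}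
      \<ge> 1 - \<gamma> / CARD('n)"
  shows "measure (iid_law N p) {x \<in> space (iid_law N p).
    \<forall>i. hellinger_sq (fhat N (proj_sample N (row i V) x)) (proj_rows p V i) \<le> \<epsilon>} \<ge> 1 - \<gamma>"
    (is "measure ?P ?G \<ge> _")
proof -
  interpret P: prob_space ?P by (rule prob_space_iid_law[OF p])
  have [measurable]: "(\<lambda>(z, t). fhat N z t) \<in> sample_space N \<Otimes>\<^sub>M borel \<rightarrow>\<^sub>M borel"
    using fhat N by (simp add: density_estimator_def)
  have u: "is_density (proj_rows p V i)" for i by (rule is_density_proj_rows[OF p V])
  have [measurable]: "proj_rows p V i \<in> borel_measurable borel" for i
    by (rule is_density_measurable[OF u])
  have h [measurable]: "(\<lambda>z. hellinger_sq (fhat N z) (proj_rows p V i)) \<in> borel_measurable (sample_space N)" for i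
    unfolding hellinger_sq_def by measurable
  define B where "B i = {x \<in> space ?P. \<not> hellinger_sq (fhat N (proj_sample N (row i V) x)) (proj_rows p V i) \<le> \<epsilon>}" for i
  have B [measurable]: "B i \<in> sets ?P" for i unfolding B_def by measurable
  have "measure ?P (B i) \<le> \<gamma> / CARD('n)" for i
  proof -
    let ?s = "row i V"
    let ?A = "{z \<in> space (sample_space N). hellinger_sq (fhat N z) (proj_rows p V i) \<le> \<epsilon>}"
    have s: "norm ?s = 1" by (rule norm_row_orthogonal_matrix[OF V])
    have "1 - \<gamma> / CARD('n) \<le> measure (iid_law N (proj_density p ?s)) ?A"
      using n[OF s] by (simp add: proj_rows_def space_iid_law)
    also have "\<dots> = measure (distr ?P (sample_space N) (proj_sample N ?s)) ?A"
      by (simp add: distr_iid_law_proj[OF p s])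
    also have "\<dots> = measure ?P (proj_sample N ?s -` ?A \<inter> space ?P)"
      by (rule measure_distr) measurable
    also have "proj_sample N ?s -` ?A \<inter> space ?P = space ?P - B i"
      using measurable_space[OF measurable_proj_sample[of N ?s]] by (auto simp: B_def space_iid_law)
    also have "measure ?P \<dots> = 1 - measure ?P (B i)"
      by (rule P.prob_compl) measurable
    finally show ?thesis by simp
  qed
  then have "(\<Sum>i\<in>UNIV. measure ?P (B i)) \<le> (\<Sum>i\<in>(UNIV::'n set). \<gamma> / CARD('n))"
    by (intro sum_mono)
  then have "(\<Sum>i\<in>UNIV. measure ?P (B i)) \<le> \<gamma>" by simp
  moreover have "measure ?P (\<Union>i. B i) \<le> (\<Sum>i\<in>UNIV. measure ?P (B i))"
    by (rule P.finite_measure_subadditive_finite) (use B in auto)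
  moreover have "?G = space ?P - (\<Union>i. B i)" by (auto simp: B_def)
  moreover have "measure ?P (space ?P - (\<Union>i. B i)) = 1 - measure ?P (\<Union>i. B i)"
    by (rule P.prob_compl) measurable
  ultimately show ?thesis by simp
qed

lemma borel_measurable_row [measurable (raw)]:
  fixes f :: "'a \<Rightarrow> real ^ 'n ^ 'm"
  assumes "f \<in> borel_measurable M"
  shows "(\<lambda>x. row i (f x)) \<in> borel_measurable M"
proof -
  have "(\<lambda>A :: real ^ 'n ^ 'm. A $ i) \<in> borel_measurable borel"
    by (intro borel_measurable_continuous_onI continuous_intros)
  moreover have "row i A = A $ i" for A :: "real ^ 'n ^ 'm"
    by (simp add: row_def vec_eq_iff)
  ultimately show ?thesis
    using measurable_compose[OF assms] by auto
qed

lemma proposed_estimator_eq: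
  assumes "y \<in> space (sample_space M)"
  shows "proposed_estimator What fhat N M x y
    = prod_rows (What M y) (\<lambda>i. fhat N (proj_sample N (row i (What M y)) x))"
proof -
  have "restrict y {..<M} = y"
    using assms by (auto simp: space_PiM PiE_def extensional_restrict)
  then show ?thesis
    by (simp add: proposed_estimator_def prod_rows_def[abs_def] proj_sample_def Let_def)
qed

text \<open>Joint measurability in both samples is what later allows the success event to be cut
  into slices. The distance integrates over the evaluation point, so measurability is first shown
  jointly in that point too.\<close>

lemma measurable_hellinger_proposed_estimator:
  fixes p :: "real ^ 'n \<Rightarrow> real"
  assumes What: "unmixing_estimator What" and fhat: "density_estimator fhat"
    and NM: "0 < N" "0 < M" and [measurable]: "p \<in> borel_measurable borel"
  shows "(\<lambda>(x, y). hellinger_sq (proposed_estimator What fhat N M x y) p)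
    \<in> borel_measurable (sample_space N \<Otimes>\<^sub>M sample_space M)"
proof -
  have [measurable]: "What M \<in> sample_space M \<rightarrow>\<^sub>M borel"
    using What NM by (simp add: unmixing_estimator_def)
  have f [measurable]: "(\<lambda>(z, t). fhat N z t) \<in> sample_space N \<Otimes>\<^sub>M borel \<rightarrow>\<^sub>M borel"
    using fhat NM by (simp add: density_estimator_def)
  have [measurable]: "(\<lambda>w. proj_sample N (row i (What M (snd (fst w)))) (fst (fst w)))
      \<in> (sample_space N \<Otimes>\<^sub>M sample_space M) \<Otimes>\<^sub>M borel \<rightarrow>\<^sub>M sample_space N" for i
    unfolding proj_sample_def by measurable
  have "(\<lambda>w. prod_rows (What M (snd (fst w)))
        (\<lambda>i. fhat N (proj_sample N (row i (What M (snd (fst w)))) (fst (fst w)))) (snd w))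
      \<in> (sample_space N \<Otimes>\<^sub>M sample_space M) \<Otimes>\<^sub>M borel \<rightarrow>\<^sub>M borel"
    unfolding prod_rows_def
    by (intro borel_measurable_prod measurable_compose[OF _ f, of "\<lambda>w. (_ w, _ w)", simplified]) measurable
  then have "(\<lambda>xy. hellinger_sq (prod_rows (What M (snd xy))
        (\<lambda>i. fhat N (proj_sample N (row i (What M (snd xy))) (fst xy)))) p)
      \<in> borel_measurable (sample_space N \<Otimes>\<^sub>M sample_space M)"
    unfolding hellinger_sq_def
    by (intro borel_measurable_times borel_measurable_const lborel.borel_measurable_lebesgue_integral)
       (measurable, simp add: case_prod_beta)
  then show ?thesis
    by (subst measurable_cong[where g="\<lambda>xy. hellinger_sq (prod_rows (What M (snd xy))
        (\<lambda>i. fhat N (proj_sample N (row i (What M (snd xy))) (fst xy)))) p"])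
       (auto simp: space_pair_measure proposed_estimator_eq)
qed

lemma (in prob_space) distr_samples:
  fixes p :: "'b::euclidean_space \<Rightarrow> real" and X Y :: "nat \<Rightarrow> 'a \<Rightarrow> 'b"
  assumes p: "is_density p"
    and X: "\<And>j. j < n \<Longrightarrow> distributed M lborel (X j) (\<lambda>x. ennreal (p x))"
    and Y: "\<And>j. j < m \<Longrightarrow> distributed M lborel (Y j) (\<lambda>x. ennreal (p x))"
    and ind: "indep_vars (\<lambda>_. borel) (case_sum X Y) ({..<n} <+> {..<m})" and "0 < n"
  shows "distr M (sample_space n \<Otimes>\<^sub>M sample_space m) (\<lambda>\<omega>. (\<lambda>j\<in>{..<n}. X j \<omega>, \<lambda>j\<in>{..<m}. Y j \<omega>))
    = iid_law n p \<Otimes>\<^sub>M iid_law m p"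
proof -
  let ?Z = "case_sum X Y" and ?I = "{..<n} <+> {..<m}"
  interpret L: prob_space "law p" by (rule prob_space_law[OF p])
  have Z: "distr M borel (?Z k) = law p" and rv: "random_variable borel (?Z k)" if "k \<in> ?I" for k
  proof -
    have d: "distributed M lborel (?Z k) (\<lambda>x. ennreal (p x))" using that X Y by auto
    show "distr M borel (?Z k) = law p"
      using distributed_distr_eq_density[OF d] unfolding law_def by (metis distr_cong sets_lborel)
    show "random_variable borel (?Z k)"
      using distributed_measurable[OF d] by simp
  qed
  have "?I \<noteq> {}" using \<open>0 < n\<close> by auto
  then have "distr M (PiM ?I (\<lambda>_. borel)) (\<lambda>\<omega>. \<lambda>k\<in>?I. ?Z k \<omega>) = PiM ?I (\<lambda>k. distr M borel (?Z k))"
    using ind by (subst (asm) indep_vars_iff_distr_eq_PiM') (auto intro: rv)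
  also have "\<dots> = PiM ?I (\<lambda>_. law p)" by (intro PiM_cong refl Z)
  finally have joint: "distr M (PiM ?I (\<lambda>_. borel)) (\<lambda>\<omega>. \<lambda>k\<in>?I. ?Z k \<omega>) = PiM ?I (\<lambda>_. law p)" .
  have [measurable]: "(\<lambda>\<omega>. \<lambda>k\<in>?I. ?Z k \<omega>) \<in> M \<rightarrow>\<^sub>M PiM ?I (\<lambda>_. borel)"
    by (intro measurable_restrict rv)
  \<comment> \<open>Selecting coordinates along an injection keeps iid samples iid;
    \<open>Inl\<close> yields the \<open>X\<close> block and \<open>Inr\<close> the \<open>Y\<close>
    block.\<close>
  have marginal: "distr M (sample_space l) (\<lambda>\<omega>. \<lambda>j\<in>{..<l}. ?Z (f j) \<omega>) = iid_law l p"
    if f: "inj_on f {..<l}" "f \<in> {..<l} \<rightarrow> ?I" for f l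
  proof -
    let ?r = "\<lambda>z. \<lambda>j\<in>{..<l}. z (f j)"
    have [measurable]: "?r \<in> PiM ?I (\<lambda>_. borel) \<rightarrow>\<^sub>M (sample_space l :: (nat \<Rightarrow> 'b) measure)"
      using f(2) by (intro measurable_restrict measurable_component_singleton) auto
    have "distr M (sample_space l) (\<lambda>\<omega>. \<lambda>j\<in>{..<l}. ?Z (f j) \<omega>)
        = distr (distr M (PiM ?I (\<lambda>_. borel)) (\<lambda>\<omega>. \<lambda>k\<in>?I. ?Z k \<omega>)) (sample_space l) ?r"
      using f(2) by (subst distr_distr) (auto intro!: distr_cong restrict_ext simp: comp_def Pi_iff)
    also have "\<dots> = distr (PiM ?I (\<lambda>_. law p)) (PiM {..<l} (\<lambda>_. law p)) ?r"
      unfolding joint by (intro distr_cong refl sets_PiM_cong) auto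
    also have "\<dots> = iid_law l p"
      unfolding iid_law_def using f by (intro distr_PiM_reindex) (auto intro: prob_space_law[OF p])
    finally show ?thesis .
  qed
  have mX: "distr M (sample_space n) (\<lambda>\<omega>. \<lambda>j\<in>{..<n}. X j \<omega>) = iid_law n p"
    using marginal[of Inl n] by (simp add: Pi_iff InlI)
  have mY: "distr M (sample_space m) (\<lambda>\<omega>. \<lambda>j\<in>{..<m}. Y j \<omega>) = iid_law m p"
    using marginal[of Inr m] by (simp add: Pi_iff InrI)
  let ?A = "Inl ` {..<n}" and ?B = "Inr ` {..<m}"
  \<comment> \<open>Disjoint blocks of an independent family are independent, so the joint law of
    the two samples is a product.\<close>
  have "indep_var (PiM ?A (\<lambda>_. borel)) (\<lambda>\<omega>. restrict (\<lambda>k. ?Z k \<omega>) ?A) (PiM ?B (\<lambda>_. borel)) (\<lambda>\<omega>. restrict (\<lambda>k. ?Z k \<omega>) ?B)"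
    by (rule indep_var_restrict[OF ind]) auto
  then have "indep_var (sample_space n) ((\<lambda>z. \<lambda>j\<in>{..<n}. z (Inl j)) \<circ> (\<lambda>\<omega>. restrict (\<lambda>k. ?Z k \<omega>) ?A))
      (sample_space m) ((\<lambda>z. \<lambda>j\<in>{..<m}. z (Inr j)) \<circ> (\<lambda>\<omega>. restrict (\<lambda>k. ?Z k \<omega>) ?B))"
    by (rule indep_var_compose) (intro measurable_restrict measurable_component_singleton; simp)+
  also have "(\<lambda>z. \<lambda>j\<in>{..<n}. z (Inl j)) \<circ> (\<lambda>\<omega>. restrict (\<lambda>k. ?Z k \<omega>) ?A) = (\<lambda>\<omega>. \<lambda>j\<in>{..<n}. X j \<omega>)"
    by (auto simp: fun_eq_iff restrict_def)
  also have "(\<lambda>z. \<lambda>j\<in>{..<m}. z (Inr j)) \<circ> (\<lambda>\<omega>. restrict (\<lambda>k. ?Z k \<omega>) ?B) = (\<lambda>\<omega>. \<lambda>j\<in>{..<m}. Y j \<omega>)"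
    by (auto simp: fun_eq_iff restrict_def)
  finally show ?thesis
    unfolding indep_var_distribution_eq mX mY by simp
qed

section \<open>The sample complexity bound\<close>

text \<open>A substitute for Jensen's inequality: if the mean of \<open>s\<close> under a
  probability density is at most \<open>c\<close>, integrating gives at most
  \<open>2 * c powr \<beta>\<close>. That factor 2 is absorbed by the half in the log-likelihood
  bound.\<close>

lemma powr_le_linear:
  fixes c s \<beta> :: real
  assumes "0 < c" "0 \<le> s" "0 \<le> \<beta>" "\<beta> \<le> 1"
  shows "s powr \<beta> \<le> c powr \<beta> * (1 + s / c)"
proof -
  have "(s / c) powr \<beta> \<le> 1 + s / c"
  proof (cases "s / c \<le> 1")
    case True
    then have "(s / c) powr \<beta> \<le> 1" using assms by (intro powr_le1) auto
    then show ?thesis using assms by (smt (verit) divide_nonneg_pos)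
  next
    case False
    then have "(s / c) powr \<beta> \<le> (s / c) powr 1" using assms by (intro powr_mono) auto
    then show ?thesis using False by simp
  qed
  from mult_left_mono[OF this, of "c powr \<beta>"] show ?thesis
    using assms by (simp add: powr_mult[symmetric])
qed

lemma sum_squares_le_if_rms_le:
  assumes "sqrt (1 / real CARD('n::finite) * S) \<le> T" "0 \<le> S"
  shows "S \<le> real CARD('n) * T\<^sup>2"
proof -
  have "1 / real CARD('n) * S = (sqrt (1 / real CARD('n) * S))\<^sup>2" using assms(2) by simp
  also have "\<dots> \<le> T\<^sup>2" using assms by (intro power_mono) auto
  finally show ?thesis by (simp add: field_simps)
qed

text \<open>For positive \<sigma> the product is exactly 1; the inequality also covers \<sigma> = 0,
  where it is 0.\<close>

lemma mult_square_powr_half_le_1: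
  fixes \<sigma> :: real
  assumes "0 \<le> \<sigma>"
  shows "\<sigma> * (\<sigma> powr (- (1/2)))\<^sup>2 \<le> 1"
proof (cases "\<sigma> = 0")
  case False
  then have "(\<sigma> powr (- (1/2)))\<^sup>2 = \<sigma> powr (- 1)"
    by (simp add: power2_eq_square powr_add[symmetric])
  then show ?thesis using False assms by (simp add: powr_minus)
qed simp

lemma op_norm_nonneg: "0 \<le> op_norm A"
  unfolding op_norm_def by (rule onorm_pos_le[OF matrix_vector_mul_bounded_linear])

lemma marginals_close_S1:
  fixes p :: "real ^ 'n \<Rightarrow> real"
  defines "d \<equiv> real CARD('n)"
  assumes p: "is_density p" and mean: "zero_mean p" and S1: "smoothness_S1 \<alpha> p"
    and W: "unmixing_matrix p W" and V: "orthogonal_matrix V" and "0 < \<epsilon>"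
    and rms: "sqrt (1 / d * (\<Sum>i\<in>UNIV. (norm (row i V - row i W))\<^sup>2))
      \<le> 1/4 * d powr (- ((2 + \<alpha>) / (1 + \<alpha>)))
        * holder_seminorm \<alpha> (grad (neg_log p)) powr (- (1 / (1 + \<alpha>)))
        * op_norm (covariance_matrix p) powr (- (1/2)) * \<epsilon> powr (1 / (1 + \<alpha>))"
  shows "hellinger_sq p (prod_rows V (proj_rows p V)) \<le> \<epsilon> / 4"
proof -
  have S: "finite_second_moments p" "\<And>x. 0 < p x" "0 < \<alpha>" "\<alpha> \<le> 1"
    "bdd_above (holder_quotients \<alpha> (grad (neg_log p)))"
    using S1 by (auto simp: smoothness_S1_def)
  have W': "orthogonal_matrix W" using W by (simp add: unmixing_matrix_def)
  have d: "1 \<le> d" by (simp add: d_def Suc_le_eq)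
  define R where "R = transpose W ** V"
  have R: "orthogonal_matrix R"
    unfolding R_def by (rule orthogonal_matrix_transpose_mult[OF W' V])
  define L where "L = holder_seminorm \<alpha> (grad (neg_log p))"
  define \<sigma> where "\<sigma> = op_norm (covariance_matrix p)"
  define \<beta> where "\<beta> = (1 + \<alpha>) / 2"
  define \<tau> where "\<tau> = 1/4 * d powr (- ((2 + \<alpha>) / (1 + \<alpha>))) * \<epsilon> powr (1 / (1 + \<alpha>))"
  define I where "I = (LINT x|lborel. p x * norm (R *v x - x) powr (1 + \<alpha>))"
  note rl = rotation_log_likelihood[OF p S1 R]
  have h: "hellinger_sq p (prod_rows V (proj_rows p V)) \<le> L * I / 2"
    using hellinger_sq_marginals_le_log_likelihood[OF p S(2) W V rl(1)[unfolded R_def]] rl(2)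
    by (simp add: R_def L_def I_def)
  have L0: "0 \<le> L" unfolding L_def by (rule holder_seminorm_nonneg[OF S(5)])
  show ?thesis
  proof (cases "L = 0")
    \<comment> \<open>At \<open>L = 0\<close> the negative power of \<open>L\<close> is 0 by
      convention rather than infinite. The log-likelihood bound alone already gives distance 0
      here.\<close>
    case True
    then show ?thesis using h \<open>0 < \<epsilon>\<close> by simp
  next
    case False
    with L0 have L: "0 < L" by simp
    have \<tau>0: "0 < \<tau>" using d \<open>0 < \<epsilon>\<close> by (simp add: \<tau>_def)
    \<comment> \<open>The bound on the mean squared displacement that remains once \<sigma> cancels.
      The power of \<open>L\<close> in it is such that \<open>L * c powr \<beta>\<close> no longer
      depends on \<open>L\<close>.\<close>
    define c where "c = d * (\<tau> * L powr (- (1 / (1 + \<alpha>))))\<^sup>2"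
    have c: "0 < c" using d \<tau>0 L by (simp add: c_def)
    let ?m = "LINT x|lborel. p x * (norm (R *v x - x))\<^sup>2"
    note sm = second_moment_rotation[OF p mean S(1) W', of V, folded R_def]
    have "?m \<le> \<sigma> * (\<Sum>i\<in>UNIV. (norm (row i V - row i W))\<^sup>2)"
      using sm(2) by (simp add: \<sigma>_def)
    also have "\<dots> \<le> \<sigma> * (d * (\<tau> * L powr (- (1 / (1 + \<alpha>))) * \<sigma> powr (- (1/2)))\<^sup>2)"
      unfolding d_def
    proof (intro mult_left_mono sum_squares_le_if_rms_le sum_nonneg)
      show "sqrt (1 / real CARD('n) * (\<Sum>i\<in>UNIV. (norm (row i V - row i W))\<^sup>2))
          \<le> \<tau> * L powr (- (1 / (1 + \<alpha>))) * \<sigma> powr (- (1/2))"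
        using rms by (simp add: \<tau>_def L_def \<sigma>_def d_def ac_simps)
    qed (simp_all add: \<sigma>_def op_norm_nonneg)
    also have "\<dots> = c * (\<sigma> * (\<sigma> powr (- (1/2)))\<^sup>2)"
      by (simp add: c_def power_mult_distrib)
    also have "\<dots> \<le> c * 1"
      using c by (intro mult_left_mono mult_square_powr_half_le_1) (simp_all add: \<sigma>_def op_norm_nonneg)
    finally have m: "?m \<le> c" by simp
    have \<beta>2: "2 * \<beta> = 1 + \<alpha>" by (simp add: \<beta>_def)
    have "I \<le> (LINT x|lborel. c powr \<beta> * (p x + p x * (norm (R *v x - x))\<^sup>2 / c))"
      unfolding I_def
    proof (rule integral_mono[OF rl(3)])
      show "integrable lborel (\<lambda>x. c powr \<beta> * (p x + p x * (norm (R *v x - x))\<^sup>2 / c))"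
        using sm(1) p by (simp add: is_density_integrable)
      fix x
      let ?n = "norm (R *v x - x)"
      have "?n powr (1 + \<alpha>) = (?n\<^sup>2) powr \<beta>"
        by (cases "?n = 0") (simp_all add: \<beta>2 powr_powr flip: powr_numeral)
      also have "\<dots> \<le> c powr \<beta> * (1 + ?n\<^sup>2 / c)"
        using c S by (intro powr_le_linear) (auto simp: \<beta>_def)
      finally have "?n powr (1 + \<alpha>) \<le> c powr \<beta> * (1 + ?n\<^sup>2 / c)" .
      from mult_left_mono[OF this is_density_nonneg[OF p, of x]]
      show "p x * ?n powr (1 + \<alpha>) \<le> c powr \<beta> * (p x + p x * ?n\<^sup>2 / c)"
        by (simp add: algebra_simps)
    qed
    also have "\<dots> = c powr \<beta> * (1 + ?m / c)"
      using sm(1) p by (simp add: is_density_integrable is_density_integral)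
    also have "\<dots> \<le> c powr \<beta> * 2"
      using m c by (intro mult_left_mono) (simp_all add: divide_le_eq)
    finally have "L * I \<le> L * (c powr \<beta> * 2)" using L by (intro mult_left_mono) auto
    with h have "hellinger_sq p (prod_rows V (proj_rows p V)) \<le> L * c powr \<beta>" by simp
    also have "c powr \<beta> = d powr \<beta> * (\<tau> powr (1 + \<alpha>) * (L powr (- (1 / (1 + \<alpha>)))) powr (1 + \<alpha>))"
    proof -
      define k where "k = \<tau> * L powr (- (1 / (1 + \<alpha>)))"
      have k: "0 < k" using \<tau>0 L by (simp add: k_def)
      have "c powr \<beta> = d powr \<beta> * (k\<^sup>2) powr \<beta>"
        using d k by (simp add: c_def k_def[symmetric] powr_mult)
      also have "(k\<^sup>2) powr \<beta> = k powr (1 + \<alpha>)"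
        using k by (simp add: powr_powr \<beta>2 flip: powr_numeral)
      also have "k powr (1 + \<alpha>) = \<tau> powr (1 + \<alpha>) * (L powr (- (1 / (1 + \<alpha>)))) powr (1 + \<alpha>)"
        unfolding k_def by (rule powr_mult)
      finally show ?thesis .
    qed
    also have "(L powr (- (1 / (1 + \<alpha>)))) powr (1 + \<alpha>) = 1 / L"
    proof -
      have "(L powr (- (1 / (1 + \<alpha>)))) powr (1 + \<alpha>) = L powr (- (1 / (1 + \<alpha>)) * (1 + \<alpha>))"
        by (rule powr_powr)
      also have "- (1 / (1 + \<alpha>)) * (1 + \<alpha>) = - 1" using S(3) by simp
      finally show ?thesis using L by (simp add: powr_minus_divide)
    qed
    also have "\<tau> powr (1 + \<alpha>) = (1/4) powr (1 + \<alpha>) * d powr (- (2 + \<alpha>)) * \<epsilon>"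
    proof -
      have "- ((2 + \<alpha>) / (1 + \<alpha>)) * (1 + \<alpha>) = - (2 + \<alpha>)" "1 / (1 + \<alpha>) * (1 + \<alpha>) = 1"
        using S(3) by simp_all
      then have "\<tau> powr (1 + \<alpha>) = (1/4) powr (1 + \<alpha>) * d powr (- (2 + \<alpha>)) * \<epsilon> powr 1"
        unfolding \<tau>_def by (simp only: powr_mult powr_powr)
      then show ?thesis using \<open>0 < \<epsilon>\<close> by simp
    qed
    also have "L * (d powr \<beta> * ((1/4) powr (1 + \<alpha>) * d powr (- (2 + \<alpha>)) * \<epsilon> * (1 / L)))
        = (1/4) powr (1 + \<alpha>) * (d powr \<beta> * d powr (- (2 + \<alpha>))) * \<epsilon>"
      using L by simp
    also have "d powr \<beta> * d powr (- (2 + \<alpha>)) = d powr (\<beta> - (2 + \<alpha>))"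
      by (simp only: powr_add[symmetric] diff_conv_add_uminus)
    \<comment> \<open>The exponent of \<open>d\<close> is -(3 + \<alpha>)/2, hence negative, and the
      power of 1/4 supplies the required quarter.\<close>
    also have "(1/4) powr (1 + \<alpha>) * d powr (\<beta> - (2 + \<alpha>)) * \<epsilon> \<le> (1/4) powr 1 * 1 * \<epsilon>"
    proof (intro mult_right_mono mult_mono)
      show "(1/4 :: real) powr (1 + \<alpha>) \<le> (1/4) powr 1" using S(3) by (intro powr_mono') auto
      have "d powr (\<beta> - (2 + \<alpha>)) \<le> d powr 0" using d S(3,4) by (intro powr_mono) (auto simp: \<beta>_def)
      then show "d powr (\<beta> - (2 + \<alpha>)) \<le> 1" using d by simp
    qed (use \<open>0 < \<epsilon>\<close> in auto)
    finally show ?thesis by simp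
  qed
qed

lemma marginals_close_S2:
  fixes p :: "real ^ 'n \<Rightarrow> real"
  defines "d \<equiv> real CARD('n)"
  assumes p: "is_density p" and mean: "zero_mean p" and S2: "smoothness_S2 g p"
    and W: "unmixing_matrix p W" and V: "orthogonal_matrix V" and "0 < \<epsilon>"
    and rms: "sqrt (1 / d * (\<Sum>i\<in>UNIV. (norm (row i V - row i W))\<^sup>2))
      \<le> 4 powr (-4) * (L1_norm g * d powr (7/4) + d powr (9/4)) powr (-2)
        * op_norm (covariance_matrix p) powr (- (1/2)) * \<epsilon>\<^sup>2"
  shows "hellinger_sq p (prod_rows V (proj_rows p V)) \<le> \<epsilon> / 4"
proof -
  have S: "finite_second_moments p" "weak_gradient p g" "integrable lborel (\<lambda>x. norm (g x))"
    using S2 by (auto simp: smoothness_S2_def)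
  have W': "orthogonal_matrix W" using W by (simp add: unmixing_matrix_def)
  have d: "1 \<le> d" by (simp add: d_def Suc_le_eq)
  define R where "R = transpose W ** V"
  have R: "orthogonal_matrix R"
    unfolding R_def by (rule orthogonal_matrix_transpose_mult[OF W' V])
  define \<sigma> where "\<sigma> = op_norm (covariance_matrix p)"
  define G where "G = L1_norm g"
  have G: "0 \<le> G" by (simp add: G_def L1_norm_def)
  \<comment> \<open>Taking \<open>d powr (7/4)\<close> out of the bracket in the sample size leaves
    \<open>G + sqrt d\<close>. The summand \<open>sqrt d\<close> keeps \<open>H\<close> positive
    when \<open>G = 0\<close>, and \<open>4 * G \<le> H\<close> follows from the
    arithmetic-geometric mean inequality and \<open>sqrt d \<ge> 1\<close>.\<close>
  define H where "H = (G + sqrt d)\<^sup>2"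
  have H: "0 < H" "4 * G \<le> H"
  proof -
    have "0 < G + sqrt d" using G d by (intro add_nonneg_pos) auto
    then show "0 < H" by (simp add: H_def)
    have "4 * G \<le> 4 * (G * sqrt d)" using G d mult_left_mono[of 1 "sqrt d" G] by simp
    also have "\<dots> \<le> H"
      using zero_le_power2[of "G - sqrt d"] by (simp add: H_def power2_eq_square algebra_simps)
    finally show "4 * G \<le> H" .
  qed
  have B: "(G * d powr (7/4) + d powr (9/4)) powr (-2) = 1 / (d ^ 3 * sqrt d * H)"
  proof -
    have "d powr (9/4) = d powr (7/4) * d powr (1/2)"
      by (simp add: powr_add[symmetric])
    also have "d powr (1/2) = sqrt d" using d by (simp add: powr_half_sqrt)
    finally have e: "G * d powr (7/4) + d powr (9/4) = d powr (7/4) * (G + sqrt d)"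
      by (simp add: algebra_simps)
    have "0 < G + sqrt d" using G d by (intro add_nonneg_pos) auto
    then have "(d powr (7/4) * (G + sqrt d)) powr (-2) = 1 / (d powr (7/4) * (G + sqrt d))\<^sup>2"
      using d by (simp add: powr_minus_divide powr_numeral)
    also have "(d powr (7/4) * (G + sqrt d))\<^sup>2 = d powr (3 + 1/2) * H"
      using d by (simp add: H_def power_mult_distrib power2_eq_square powr_add[symmetric])
    also have "d powr (3 + 1/2) = d ^ 3 * sqrt d"
      unfolding powr_add using d by (simp add: powr_half_sqrt powr_numeral)
    finally show ?thesis unfolding e .
  qed
  \<comment> \<open>This will bound the mean displacement. The root mean square row error is at most
    \<open>T\<close> times the power of \<sigma>, so the second moment of the displacement is at
    most \<open>d * T\<^sup>2\<close>, which is \<open>c\<^sup>2\<close>.\<close>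
  define c where "c = \<epsilon>\<^sup>2 / (256 * d ^ 3 * H)"
  have c: "0 < c" using d H \<open>0 < \<epsilon>\<close> by (simp add: c_def)
  define T where "T = \<epsilon>\<^sup>2 / (256 * (d ^ 3 * sqrt d * H))"
  have T: "d * T\<^sup>2 = c\<^sup>2"
    using d by (simp add: T_def c_def power_divide power_mult_distrib)
  let ?m = "LINT x|lborel. p x * (norm (R *v x - x))\<^sup>2"
  note sm = second_moment_rotation[OF p mean S(1) W', of V, folded R_def]
  have "?m \<le> \<sigma> * (\<Sum>i\<in>UNIV. (norm (row i V - row i W))\<^sup>2)"
    using sm(2) by (simp add: \<sigma>_def)
  also have "\<dots> \<le> \<sigma> * (d * (T * \<sigma> powr (- (1/2)))\<^sup>2)"
    unfolding d_def
  proof (intro mult_left_mono sum_squares_le_if_rms_le sum_nonneg)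
    have "(4::real) powr (-4) = 1 / 256" by (simp add: powr_minus_divide powr_numeral)
    note [simp] = this
    show "sqrt (1 / real CARD('n) * (\<Sum>i\<in>UNIV. (norm (row i V - row i W))\<^sup>2)) \<le> T * \<sigma> powr (- (1/2))"
      using rms unfolding G_def[symmetric] B \<sigma>_def[symmetric] d_def[symmetric] by (simp add: T_def ac_simps)
  qed (simp_all add: \<sigma>_def op_norm_nonneg)
  also have "\<dots> = c\<^sup>2 * (\<sigma> * (\<sigma> powr (- (1/2)))\<^sup>2)"
    unfolding T[symmetric] by (simp add: power_mult_distrib)
  also have "\<dots> \<le> c\<^sup>2 * 1"
    by (intro mult_left_mono mult_square_powr_half_le_1) (simp_all add: \<sigma>_def op_norm_nonneg)
  finally have m: "?m \<le> c\<^sup>2" by simp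
  have [measurable]: "p \<in> borel_measurable borel" by (rule is_density_measurable[OF p])
  \<comment> \<open>A linearised Cauchy-Schwarz inequality: with second moment at most
    \<open>c\<^sup>2\<close>, integrating bounds the first moment by \<open>c\<close>.\<close>
  have le: "p x * norm (R *v x - x) \<le> (p x * (norm (R *v x - x))\<^sup>2 / c + c * p x) / 2" for x
  proof -
    let ?n = "norm (R *v x - x)"
    have "2 * (?n * c) \<le> ?n\<^sup>2 + c\<^sup>2"
      using zero_le_power2[of "?n - c"] by (simp add: power2_eq_square algebra_simps)
    then have "?n \<le> (?n\<^sup>2 / c + c) / 2" using c by (simp add: field_simps power2_eq_square)
    from mult_left_mono[OF this is_density_nonneg[OF p, of x]] show ?thesis
      by (simp add: algebra_simps)
  qed
  have int: "integrable lborel (\<lambda>x. (p x * (norm (R *v x - x))\<^sup>2 / c + c * p x) / 2)"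
    using sm(1) p by (simp add: is_density_integrable)
  have E: "integrable lborel (\<lambda>x. p x * norm (R *v x - x))"
  proof (rule Bochner_Integration.integrable_bound[OF int])
    show "AE x in lborel. norm (p x * norm (R *v x - x)) \<le> norm ((p x * (norm (R *v x - x))\<^sup>2 / c + c * p x) / 2)"
      using le is_density_nonneg[OF p] by (intro AE_I2) (smt (verit) mult_nonneg_nonneg norm_ge_zero real_norm_def)
  qed measurable
  have "(LINT x|lborel. p x * norm (R *v x - x)) \<le> (LINT x|lborel. (p x * (norm (R *v x - x))\<^sup>2 / c + c * p x) / 2)"
    by (rule integral_mono[OF E int le])
  also have "\<dots> = (?m / c + c) / 2"
    using sm(1) p by (simp add: is_density_integrable is_density_integral)
  also have "\<dots> \<le> c"
    using m c by (simp add: field_simps power2_eq_square)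
  finally have Ec: "(LINT x|lborel. p x * norm (R *v x - x)) \<le> c" .
  \<comment> \<open>The radius balances the two terms of the ball average bound: with
    \<open>G\<close> replaced by \<open>H / 4\<close>, each equals \<epsilon> / (16 d).\<close>
  define r where "r = \<epsilon> / (8 * d * H)"
  have r: "0 < r" using d H \<open>0 < \<epsilon>\<close> by (simp add: r_def)
  let ?D = "LINT x|lborel. \<bar>p x - p (R *v x)\<bar>"
  have "?D \<le> 2 * r * G + 2 * CARD('n) / r * (LINT x|lborel. p x * norm (R *v x - x))"
    using weak_gradient_translation_L1[OF is_density_integrable[OF p] S(2,3)]
    by (intro rotation_L1_distance p R G r E) (simp add: G_def)
  also have "\<dots> \<le> 2 * r * (H / 4) + 2 * CARD('n) / r * c"
    using H r Ec by (intro add_mono mult_left_mono) auto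
  also have "\<dots> = \<epsilon> / (8 * d)"
    using H d \<open>0 < \<epsilon>\<close> by (simp add: r_def c_def d_def[symmetric] field_simps power2_eq_square power3_eq_cube)
  finally have D: "?D \<le> \<epsilon> / (8 * d)" .
  have "hellinger_sq p (prod_rows V (proj_rows p V)) \<le> (1 + d) * ?D"
    using hellinger_sq_marginals_le_L1[OF p W V] by (simp add: R_def d_def)
  also have "\<dots> \<le> (2 * d) * (\<epsilon> / (8 * d))"
    using D d by (intro mult_mono) auto
  also have "\<dots> = \<epsilon> / 4" using d by simp
  finally show ?thesis .
qed

theorem corollary3p15:
  fixes p :: "real ^ 'n \<Rightarrow> real"
    and What :: "nat \<Rightarrow> (nat \<Rightarrow> real ^ 'n) \<Rightarrow> real ^ 'n ^ 'n"
    and fhat :: "nat \<Rightarrow> (nat \<Rightarrow> real) \<Rightarrow> real \<Rightarrow> real"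
    and \<Omega> :: "'w measure"
    and X Y :: "nat \<Rightarrow> 'w \<Rightarrow> real ^ 'n"
    and N M :: nat
    and \<epsilon> \<gamma> \<alpha> d :: real
    and g :: "real ^ 'n \<Rightarrow> real ^ 'n"
  defines "d \<equiv> real CARD('n)"
  assumes density: "is_density p"
    and mean: "zero_mean p"
    and components: "orthogonal_independent_components p"
    and estimators: "unmixing_estimator What" "density_estimator fhat"
    and "prob_space \<Omega>"
    and distr_X: "\<And>j. j < N \<Longrightarrow> distributed \<Omega> lborel (X j) (\<lambda>x. ennreal (p x))"
    and distr_Y: "\<And>j. j < M \<Longrightarrow> distributed \<Omega> lborel (Y j) (\<lambda>x. ennreal (p x))"
    and indep: "prob_space.indep_vars \<Omega> (\<lambda>_. borel) (case_sum X Y) ({..<N} <+> {..<M})"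
    and "0 < \<epsilon>" and "0 < \<gamma>" and "\<gamma> < 1"
    and N: "enat N \<ge> (SUP s \<in> sphere 0 1.
              N_star fhat (\<epsilon> / (4 * d)) (\<gamma> / (2 * d)) (proj_density p s))"
    and M: "(smoothness_S1 \<alpha> p \<and>
              enat M \<ge> M_star What
                (1/4 * d powr (- ((2 + \<alpha>) / (1 + \<alpha>)))
                 * holder_seminorm \<alpha> (grad (neg_log p)) powr (- (1 / (1 + \<alpha>)))
                 * op_norm (covariance_matrix p) powr (- (1/2))
                 * \<epsilon> powr (1 / (1 + \<alpha>))) (\<gamma> / 2) p)
          \<or> (smoothness_S2 g p \<and>
              enat M \<ge> M_star What
                (4 powr (-4) * (L1_norm g * d powr (7/4) + d powr (9/4)) powr (-2)
                 * op_norm (covariance_matrix p) powr (- (1/2)) * \<epsilon>\<^sup>2) (\<gamma> / 2) p)"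
  shows "measure \<Omega> {\<omega> \<in> space \<Omega>.
           hellinger_sq (proposed_estimator What fhat N M (\<lambda>j. X j \<omega>) (\<lambda>j. Y j \<omega>)) p \<le> \<epsilon>}
         \<ge> 1 - \<gamma>"
proof -
  interpret \<Omega>: prob_space \<Omega> by fact
  have d: "1 \<le> d" by (simp add: d_def Suc_le_eq)
  have [measurable]: "p \<in> borel_measurable borel" by (rule is_density_measurable[OF density])
  let ?u = "\<lambda>V. proj_rows p V"
  have Ns: "N_star fhat (\<epsilon> / (4 * d)) (\<gamma> / (2 * d)) (proj_density p s) \<le> enat N" if "norm s = 1" for s :: "real ^ 'n"
    by (rule order_trans[OF SUP_upper N]) (use that in simp)
  \<comment> \<open>Some unit vector exists, so the supremum is not over an empty set and forces
    \<open>N\<close> to be positive; the estimators are constrained only at positive sample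
    sizes.\<close>
  have "norm (axis undefined 1 :: real ^ 'n) = 1" by simp
  from sufficient_sample_size_leD(1)[OF Ns[OF this, unfolded N_star_def]]
  have N0: "0 < N" .
  have Nprob: "measure (iid_law N (proj_density p s))
      {z \<in> space (iid_law N (proj_density p s)). hellinger_sq (fhat N z) (proj_density p s) \<le> \<epsilon> / (4 * d)}
      \<ge> 1 - \<gamma> / 2 / CARD('n)" if "norm s = 1" for s :: "real ^ 'n"
    using sufficient_sample_size_leD(2)[OF Ns[OF that, unfolded N_star_def]] by (simp add: d_def)
  define good where "good V \<longleftrightarrow> orthogonal_matrix V \<and> hellinger_sq p (prod_rows V (?u V)) \<le> \<epsilon> / 4" for V
  \<comment> \<open>Both smoothness cases are reduced to one radius \<open>T\<close>: any orthogonal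
    matrix within \<open>T\<close> of an unmixing matrix has product marginals within a quarter of
    \<epsilon>. The rest does not distinguish them.\<close>
  obtain T where MT: "M_star What T (\<gamma> / 2) p \<le> enat M"
    and T: "\<And>V W. unmixing_matrix p W \<Longrightarrow> orthogonal_matrix V \<Longrightarrow>
      sqrt (1 / real CARD('n) * (\<Sum>i\<in>UNIV. (norm (row i V - row i W))\<^sup>2)) \<le> T \<Longrightarrow> good V"
    using M
  proof
    assume "smoothness_S1 \<alpha> p \<and> enat M \<ge> M_star What
                (1/4 * d powr (- ((2 + \<alpha>) / (1 + \<alpha>)))
                 * holder_seminorm \<alpha> (grad (neg_log p)) powr (- (1 / (1 + \<alpha>)))
                 * op_norm (covariance_matrix p) powr (- (1/2))
                 * \<epsilon> powr (1 / (1 + \<alpha>))) (\<gamma> / 2) p"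
    then show thesis
      using marginals_close_S1[OF density mean _ _ _ \<open>0 < \<epsilon>\<close>, of \<alpha>]
      by (intro that) (auto simp: good_def d_def)
  next
    assume "smoothness_S2 g p \<and> enat M \<ge> M_star What
                (4 powr (-4) * (L1_norm g * d powr (7/4) + d powr (9/4)) powr (-2)
                 * op_norm (covariance_matrix p) powr (- (1/2)) * \<epsilon>\<^sup>2) (\<gamma> / 2) p"
    then show thesis
      using marginals_close_S2[OF density mean _ _ _ \<open>0 < \<epsilon>\<close>, of g]
      by (intro that) (auto simp: good_def d_def)
  qed
  note Mprob = sufficient_sample_size_leD[OF MT[unfolded M_star_def]]
  let ?P = "iid_law N p" and ?Q = "iid_law M p"
  interpret P: prob_space ?P by (rule prob_space_iid_law[OF density])
  interpret Q: prob_space ?Q by (rule prob_space_iid_law[OF density])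
  interpret PQ: pair_prob_space ?P ?Q ..
  define E where "E = {y \<in> space ?Q. \<exists>W. unmixing_matrix p W \<and>
      sqrt (1 / real CARD('n) * (\<Sum>i\<in>UNIV. (norm (row i (What M y) - row i W))\<^sup>2)) \<le> T}"
  have E1: "1 - \<gamma> / 2 \<le> measure ?Q E" using Mprob(2) by (simp add: E_def)
  text \<open>Membership in \<open>E\<close> involves an existential quantifier over matrices. Non-measurable sets have
    measure \<open>0\<close>, so the lower bound yields measurability.\<close>
  have E [measurable]: "E \<in> sets ?Q"
    using E1 \<open>\<gamma> < 1\<close> measure_notin_sets[of E ?Q] by (cases "E \<in> sets ?Q") auto
  let ?h = "\<lambda>x y. hellinger_sq (proposed_estimator What fhat N M x y) p"
  have h [measurable]: "(\<lambda>(x, y). ?h x y) \<in> borel_measurable (sample_space N \<Otimes>\<^sub>M sample_space M)"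
    by (rule measurable_hellinger_proposed_estimator[OF estimators N0 Mprob(1)]) measurable
  define A where "A = {xy \<in> space (sample_space N \<Otimes>\<^sub>M sample_space M). (case xy of (x, y) \<Rightarrow> ?h x y) \<le> \<epsilon>}"
  have A [measurable]: "A \<in> sets (sample_space N \<Otimes>\<^sub>M sample_space M)" unfolding A_def by measurable
  have sPQ: "sets (?P \<Otimes>\<^sub>M ?Q) = sets (sample_space N \<Otimes>\<^sub>M sample_space M)"
    by (intro sets_pair_measure_cong) simp_all
  \<comment> \<open>With \<open>y\<close> fixed the matrix \<open>?V\<close> is constant, so the
    univariate guarantees apply along its rows.\<close>
  have slice: "ennreal (1 - \<gamma> / 2) \<le> emeasure ?P ((\<lambda>x. (x, y)) -` A)" if y: "y \<in> E" for y
  proof -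
    let ?V = "What M y"
    have ys: "y \<in> space (sample_space M)" using y by (simp add: E_def space_iid_law)
    have V: "orthogonal_matrix ?V"
      using estimators(1) Mprob(1) ys by (simp add: unmixing_estimator_def)
    then have g: "hellinger_sq p (prod_rows ?V (?u ?V)) \<le> \<epsilon> / 4"
      using T y by (auto simp: E_def good_def)
    let ?f = "\<lambda>x i. fhat N (proj_sample N (row i ?V) x)"
    let ?G = "{x \<in> space ?P. \<forall>i. hellinger_sq (?f x i) (?u ?V i) \<le> \<epsilon> / (4 * d)}"
    have "1 - \<gamma> / 2 \<le> measure ?P ?G"
      by (rule prob_projected_estimates[OF density V estimators(2) N0 Nprob])
    moreover have "?G \<subseteq> (\<lambda>x. (x, y)) -` A"
    proof
      fix x assume x: "x \<in> ?G"
      then have xs: "x \<in> space (sample_space N)" by (simp add: space_iid_law)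
      have f: "is_density (?f x i)" for i
        using estimators(2) N0 measurable_space[OF measurable_proj_sample xs]
        by (simp add: density_estimator_def)
      have u: "is_density (?u ?V i)" for i by (rule is_density_proj_rows[OF density V])
      have "hellinger_sq (prod_rows ?V (?f x)) (prod_rows ?V (?u ?V)) \<le> (\<Sum>i\<in>UNIV. hellinger_sq (?f x i) (?u ?V i))"
        by (rule hellinger_sq_prod_rows[OF V f u])
      also have "\<dots> \<le> (\<Sum>i\<in>(UNIV::'n set). \<epsilon> / (4 * d))" using x by (intro sum_mono) simp
      also have "\<dots> = \<epsilon> / 4" using d by (simp add: d_def)
      finally have "hellinger_sq (prod_rows ?V (?f x)) (prod_rows ?V (?u ?V)) \<le> \<epsilon> / 4" .
      \<comment> \<open>Two errors of at most a quarter of \<epsilon>, each doubled by the triangle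
        inequality.\<close>
      then have "hellinger_sq (prod_rows ?V (?f x)) p \<le> \<epsilon>"
        using hellinger_sq_triangle[OF is_density_prod_rows[where f="?f x", OF V f]
            is_density_prod_rows[where f="?u ?V", OF V u] density] g
        by (simp add: hellinger_sq_commute[of p])
      then show "x \<in> (\<lambda>x. (x, y)) -` A"
        using xs ys by (simp add: A_def space_pair_measure proposed_estimator_eq)
    qed
    moreover have "(\<lambda>x. (x, y)) -` A \<in> sets ?P"
      using sets_Pair2[OF A, of y] by simp
    ultimately show ?thesis
      using P.finite_measure_mono[of ?G "(\<lambda>x. (x, y)) -` A"]
      by (simp add: P.emeasure_eq_measure)
  qed
  \<comment> \<open>The slice bound is integrated over \<open>E\<close> only. Both success
    probabilities are at least 1 - \<gamma>/2, and their product is at least 1 - \<gamma>.\<close>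
  have "ennreal ((1 - \<gamma> / 2) * (1 - \<gamma> / 2)) \<le> ennreal ((1 - \<gamma> / 2) * measure ?Q E)"
    using E1 \<open>\<gamma> < 1\<close> by (intro ennreal_leI mult_left_mono) auto
  also have "\<dots> = (\<integral>\<^sup>+y. ennreal (1 - \<gamma> / 2) * indicator E y \<partial>?Q)"
    using \<open>\<gamma> < 1\<close> by (simp add: nn_integral_cmult_indicator[OF E] Q.emeasure_eq_measure ennreal_mult)
  also have "\<dots> \<le> (\<integral>\<^sup>+y. emeasure ?P ((\<lambda>x. (x, y)) -` A) \<partial>?Q)"
    by (intro nn_integral_mono) (auto simp: indicator_def slice)
  also have "\<dots> = emeasure (?P \<Otimes>\<^sub>M ?Q) A"
    by (rule PQ.emeasure_pair_measure_alt2[symmetric]) (use A sPQ in simp)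
  also have "\<dots> = ennreal (measure (?P \<Otimes>\<^sub>M ?Q) A)"
    by (rule PQ.emeasure_eq_measure)
  finally have "(1 - \<gamma> / 2) * (1 - \<gamma> / 2) \<le> measure (?P \<Otimes>\<^sub>M ?Q) A"
    by simp
  moreover have "1 - \<gamma> \<le> (1 - \<gamma> / 2) * (1 - \<gamma> / 2)"
    by (simp add: algebra_simps)
  moreover have "measure (?P \<Otimes>\<^sub>M ?Q) A = measure \<Omega> {\<omega> \<in> space \<Omega>. ?h (\<lambda>j. X j \<omega>) (\<lambda>j. Y j \<omega>) \<le> \<epsilon>}"
  proof -
    let ?X = "\<lambda>\<omega>. \<lambda>j\<in>{..<N}. X j \<omega>" and ?Y = "\<lambda>\<omega>. \<lambda>j\<in>{..<M}. Y j \<omega>"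
    have [measurable]: "?X \<in> \<Omega> \<rightarrow>\<^sub>M sample_space N" "?Y \<in> \<Omega> \<rightarrow>\<^sub>M sample_space M"
      using distributed_measurable[OF distr_X] distributed_measurable[OF distr_Y]
      by (auto intro!: measurable_restrict)
    \<comment> \<open>The estimator reads only the first \<open>N\<close> and \<open>M\<close>
      entries, so infinite sequences may be replaced by the extensional samples of the product
      spaces.\<close>
    have eq: "proposed_estimator What fhat N M (?X \<omega>) (?Y \<omega>) = proposed_estimator What fhat N M (\<lambda>j. X j \<omega>) (\<lambda>j. Y j \<omega>)" for \<omega>
      by (simp add: proposed_estimator_def cong: restrict_cong)
    have "distr \<Omega> (sample_space N \<Otimes>\<^sub>M sample_space M) (\<lambda>\<omega>. (?X \<omega>, ?Y \<omega>)) = ?P \<Otimes>\<^sub>M ?Q"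
      by (rule \<Omega>.distr_samples[OF density distr_X distr_Y indep N0])
    then have "measure (?P \<Otimes>\<^sub>M ?Q) A
        = measure (distr \<Omega> (sample_space N \<Otimes>\<^sub>M sample_space M) (\<lambda>\<omega>. (?X \<omega>, ?Y \<omega>))) A"
      by (simp only:)
    also have "\<dots> = measure \<Omega> ((\<lambda>\<omega>. (?X \<omega>, ?Y \<omega>)) -` A \<inter> space \<Omega>)"
      by (rule measure_distr) measurable
    also have "(\<lambda>\<omega>. (?X \<omega>, ?Y \<omega>)) -` A \<inter> space \<Omega> = {\<omega> \<in> space \<Omega>. ?h (\<lambda>j. X j \<omega>) (\<lambda>j. Y j \<omega>) \<le> \<epsilon>}"
      by (auto simp: A_def eq space_pair_measure space_PiM)
    finally show ?thesis .
  qed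
  ultimately show ?thesis by simp
qed

end
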